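(* Let $\mathcal{G}$ be an arithmetical semigroup satisfying Axiom A with constants $\kappa>0$, $A>0$, $0<\theta<1$, and satisfying Conditions B and G (see context). Then for every $\varepsilon>0$ there exists a constant $C=C(\varepsilon,\mathcal{G})$ such that for all sufficiently large $T$ and all $\alpha>(1+\theta)/2$, $$N(\alpha,T)\le C\, T^{\frac{6-2\theta}{1-\theta}(1-\alpha)+\varepsilon}.$$
   Context: An arithmetical semigroup $\mathcal{G}$ is a commutative semigroup with unit $e$, freely generated by a countable set $\mathcal{P}$ of "primes" (every element has an essentially unique factorization into primes), together with a multiplicative norm $|\cdot|:\mathcal{G}\to(0,\infty)$ ($|gh|=|g||h|$) such that every bounded interval contains the norms of only finitely many elements; then $|e|=1$ and $|g|>1$ for $g\neq e$. Let $\mathcal{N}(x):=\#\{g\in\mathcal{G}: |g|\le x\}$ and $\mathcal{R}(x):=\mathcal{N}(x)-\kappa(x-1)$. Axiom A (with constants $\kappa>0$, $A>0$, $0<\theta<1$) means $|\mathcal{R}(x)|\le A x^{\theta}$ for all $x\ge1$. The Beurling zeta function is $\zeta(s)=\sum_{g\in\mathcal{G}}|g|^{-s}=\int_1^\infty x^{-s}\,d\mathcal{N}(x)$, which under Axiom A extends meromorphically to $\Re s>\theta$ with a single simple pole at $s=1$. Condition B: $|g|\in\mathbb{N}$ for all $g\in\mathcal{G}$; then put $G(\nu):=\#\{g\in\mathcal{G}:|g|=\nu\}$. Condition G: for some $p>1$ the function $F_p(X):=\frac1X\sum_{g\in\mathcal{G},\,|g|\le X}G(|g|)^p$ satisfies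 $\log F_p(X)=o(\log X)$ as $X\to\infty$ (i.e. $F_p(X)=O(X^{\varepsilon})$ for every fixed $\varepsilon>0$). For $\theta<b$ and $T>0$, $N(b,T)$ denotes the number of zeros $\rho=\beta+i\gamma$ of $\zeta$ (counted with multiplicity) with $\beta\ge b$ and $|\gamma|\le T$. *)

theory Defs
  imports
    "HOL-Complex_Analysis.Complex_Analysis"
    "HOL-Library.Multiset"
    "HOL-Library.Landau_Symbols"
begin

text \<open>
  The semigroup is the whole of a type \<open>'a\<close> of class \<open>comm_monoid_mult\<close>, with unit \<open>1\<close>.
  Free generation by \<open>P\<close> is existence and uniqueness of the multiset of primes with a given
  product; in particular \<open>1 \<notin> P\<close>.
\<close>

locale arithmetical_semigroup =
  fixes P :: "'a::comm_monoid_mult set"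
    and nrm :: "'a \<Rightarrow> real"
  assumes countable_primes: "countable P"
    and unique_factorization: "\<exists>!M. set_mset M \<subseteq> P \<and> prod_mset M = g"
    and nrm_pos: "nrm g > 0"
    and nrm_mult: "nrm (g * h) = nrm g * nrm h"
    and finite_nrm_interval: "finite {g. a \<le> nrm g \<and> nrm g \<le> b}"

definition counting_fun :: "('a \<Rightarrow> real) \<Rightarrow> real \<Rightarrow> nat" where
  "counting_fun nrm x = card {g. nrm g \<le> x}"

definition remainder_fun :: "('a \<Rightarrow> real) \<Rightarrow> real \<Rightarrow> real \<Rightarrow> real" where
  "remainder_fun nrm \<kappa> x = real (counting_fun nrm x) - \<kappa> * (x - 1)"

definition axiom_A :: "('a \<Rightarrow> real) \<Rightarrow> real \<Rightarrow> real \<Rightarrow> real \<Rightarrow> bool" where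
  "axiom_A nrm \<kappa> A \<theta> \<longleftrightarrow>
     \<kappa> > 0 \<and> A > 0 \<and> 0 < \<theta> \<and> \<theta> < 1 \<and>
     (\<forall>x\<ge>1. \<bar>remainder_fun nrm \<kappa> x\<bar> \<le> A * x powr \<theta>)"

definition condition_B :: "('a \<Rightarrow> real) \<Rightarrow> bool" where
  "condition_B nrm \<longleftrightarrow> (\<forall>g. nrm g \<in> \<nat>)"

definition nrm_multiplicity :: "('a \<Rightarrow> real) \<Rightarrow> real \<Rightarrow> nat" where
  "nrm_multiplicity nrm \<nu> = card {g. nrm g = \<nu>}"

definition F_mean :: "('a \<Rightarrow> real) \<Rightarrow> real \<Rightarrow> real \<Rightarrow> real" where
  "F_mean nrm p X = (\<Sum>g | nrm g \<le> X. real (nrm_multiplicity nrm (nrm g)) powr p) / X"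

definition condition_G :: "('a \<Rightarrow> real) \<Rightarrow> bool" where
  "condition_G nrm \<longleftrightarrow>
     (\<exists>p>1. (\<lambda>X. ln (F_mean nrm p X)) \<in> o[at_top](\<lambda>X. ln X))"

text \<open>
  The Beurling zeta function is the meromorphic continuation to \<open>Re s > \<theta>\<close>, with \<open>1\<close> as its
  only possible pole, of the Dirichlet series over the semigroup. By the identity theorem the
  choice determines it at every \<open>s \<noteq> 1\<close> of this half-plane. Its values at \<open>1\<close> and for
  \<open>Re s \<le> \<theta>\<close> are arbitrary and must not be used.
\<close>

definition beurling_zeta :: "('a \<Rightarrow> real) \<Rightarrow> real \<Rightarrow> complex \<Rightarrow> complex" where
  "beurling_zeta nrm \<theta> =
     (SOME f. f meromorphic_on {s. Re s > \<theta>} \<and>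
              f holomorphic_on ({s. Re s > \<theta>} - {1}) \<and>
              (\<forall>s. Re s > 1 \<longrightarrow> f s = (\<Sum>\<^sub>\<infinity>g. complex_of_real (nrm g) powr (- s))))"

definition zeta_zeros :: "('a \<Rightarrow> real) \<Rightarrow> real \<Rightarrow> real \<Rightarrow> real \<Rightarrow> complex set" where
  "zeta_zeros nrm \<theta> b T =
     {\<rho>. \<rho> \<noteq> 1 \<and> beurling_zeta nrm \<theta> \<rho> = 0 \<and> Re \<rho> \<ge> b \<and> \<bar>Im \<rho>\<bar> \<le> T}"

text \<open>
  Meaningful for \<open>b > \<theta>\<close>. The values lie in \<open>ennreal\<close> so that an infinite set of zeros would
  be counted as \<open>\<infinity>\<close>, whereas a finite sum over it would be \<open>0\<close>.
\<close>

definition zeta_zero_count :: "('a \<Rightarrow> real) \<Rightarrow> real \<Rightarrow> real \<Rightarrow> real \<Rightarrow> ennreal" where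
  "zeta_zero_count nrm \<theta> b T =
     (\<Sum>\<^sub>\<infinity>\<rho>\<in>zeta_zeros nrm \<theta> b T. of_nat (nat (zorder (beurling_zeta nrm \<theta>) \<rho>)))"

end

theory Submission
  imports Defs "HOL-Real_Asymp.Real_Asymp"
begin

text \<open>
  Write \<open>\<zeta>(s) = \<Sum> G(n) n powr (- s)\<close> and let \<open>M\<close> be the partial sum of \<open>1 / \<zeta>\<close> of length \<open>X\<close>. At a zero
  \<open>\<rho>\<close> the partial sum of \<open>\<zeta>\<close> of length \<open>N\<close> is small by Axiom A, while its product with \<open>M\<close> has the form
  \<open>1 + D(\<rho>)\<close>, where the Dirichlet polynomial \<open>D\<close> is supported on \<open>X < n \<le> N X\<close> and has coefficients
  \<open>O(n powr \<epsilon> * G n)\<close>. Hence \<open>D\<close> is large at the zeros. Choosing one zero from each horizontal strip of height 1,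
  Bombieri's inequality bounds how often this happens: Condition B makes the frequencies logarithms of
  integers, so that the scalar products are sums \<open>\<Sum> n powr (- 1 - z)\<close>, which the midpoint rule evaluates, and
  Condition G bounds the mean square of the coefficients. With \<open>X = T powr (3/2)\<close> and
  \<open>N = T powr (3 / (2 (1 - \<theta>)))\<close> the number of strips is \<open>O((N X) powr (2 - 2 \<alpha> + \<epsilon>))\<close>, which gives the
  exponent \<open>(6 - 3 \<theta>) (1 - \<alpha>) / (1 - \<theta>) + \<epsilon>\<close>. By Jensen's inequality each strip contains only
  \<open>O(log T)\<close> zeros.
\<close>

section \<open>A Jensen-type bound for the number of zeros\<close>

text \<open>\<open>D\<close> need not be large at each single zero. By Axiom A the partial sum at a
  zero \<rho> has size \<open>\<kappa> N powr (1 - Re \<rho>) / |\<rho> - 1|\<close> up to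
  \<open>O(|\<rho>| N powr (\<theta> - Re \<rho>))\<close>; times the trivial bound for
  \<open>M\<close> the first term becomes about
  \<open>(N X) powr (1 - \<alpha>) / |Im \<rho>|\<close>, which need not be small. So
  \<open>1 \<le> 2 |D|^2 + 2 |error|^2\<close> is kept and summed over the strips, the two at the
  real axis being counted separately: the sum of \<open>1 / |Im \<rho>|^2\<close> costs at most a
  logarithm, and the error gets the same size \<open>(N X) powr (2 - 2 \<alpha>)\<close> as
  Bombieri's bound. The second error term contributes this size times
  \<open>T^3 N powr (2 \<theta> - 2)\<close>, which fixes \<open>N\<close>. The midpoint rule
  contributes \<open>T^2 / X^2\<close> for each pair of strips, hence \<open>T^3 / X^2\<close> in a
  row of scalar products, which fixes \<open>X\<close>. A first-order rule would force
  \<open>X = T^2\<close> and the exponent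
  \<open>(7 - 4 \<theta>) (1 - \<alpha>) / (1 - \<theta>)\<close>, too large for
  \<open>\<theta> < 1/2\<close>.\<close>

text \<open>\<open>zor_poly\<close> yields the cofactor only on a small disc about \<open>z\<close>.
  Away from \<open>z\<close> it is the quotient of \<open>f\<close> by the power; the two agree on
  the overlap and glue to one function on all of \<open>S\<close>.\<close>

lemma holomorphic_divide_out_zero:
  assumes f: "f holomorphic_on S" "open S" "connected S"
    and z: "z \<in> S" and nz: "\<exists>w\<in>S. f w \<noteq> 0"
  obtains g where "g holomorphic_on S" "g z \<noteq> 0"
    "\<And>w. w \<in> S \<Longrightarrow> f w = g w * (w - z) ^ nat (zorder f z)"
proof -
  define n where "n = nat (zorder f z)"
  define p where "p = zor_poly f z"
  obtain r where r: "r > 0" "cball z r \<subseteq> S" "p holomorphic_on cball z r"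
    "\<And>w. w \<in> cball z r \<Longrightarrow> f w = p w * (w - z) ^ n \<and> p w \<noteq> 0"
    using zorder_exist_zero[OF f z nz] unfolding n_def p_def by blast
  define g where "g w = (if w = z then p z else f w / (w - z) ^ n)" for w
  have gp: "g w = p w" if "w \<in> ball z r" for w
    using r(4)[of w] that by (auto simp: g_def)
  have "g holomorphic_on ball z r"
    using r(3) gp by (metis ball_subset_cball holomorphic_cong holomorphic_on_subset)
  moreover have "g holomorphic_on (S - {z})"
  proof -
    have "(\<lambda>w. f w / (w - z) ^ n) holomorphic_on (S - {z})"
      by (intro holomorphic_intros holomorphic_on_subset[OF f(1)]) auto
    thus ?thesis by (rule holomorphic_transform) (auto simp: g_def)
  qed
  ultimately have "g holomorphic_on (ball z r \<union> (S - {z}))"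
    using f(2) by (intro holomorphic_on_Un) auto
  moreover have "ball z r \<union> (S - {z}) = S"
    using r(1,2) z by (auto simp: subset_iff)
  ultimately have "g holomorphic_on S" by simp
  moreover have "g z \<noteq> 0" using r(1) r(4)[of z] by (auto simp: g_def)
  moreover have "f w = g w * (w - z) ^ n" if "w \<in> S" for w
    using r(1) r(4)[of z] by (auto simp: g_def)
  ultimately show ?thesis using that unfolding n_def by blast
qed

lemma norm_blaschke_factor:
  assumes "norm (u :: complex) = R"
  shows "norm (of_real (R\<^sup>2) - cnj v * u) = R * norm (u - v)"
proof -
  have "of_real (R\<^sup>2) - cnj v * u = u * cnj (u - v)"
    using complex_norm_square[of u] assms by (simp add: algebra_simps)
  thus ?thesis using assms by (metis complex_mod_cnj norm_mult)
qed

text \<open>Multiplying by Blaschke factors removes the zeros one at a time without changing the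
  modulus on the circle.\<close>

lemma jensen_zero_bound:
  assumes "finite Z" "f holomorphic_on ball a R'" "0 < r" "r < R" "R < R'"
    and "f a \<noteq> 0" "\<And>z. z \<in> sphere a R \<Longrightarrow> norm (f z) \<le> B"
    and "Z \<subseteq> cball a r" "\<And>z. z \<in> Z \<Longrightarrow> f z = 0"
  shows "norm (f a) * (R / r) ^ (\<Sum>z\<in>Z. nat (zorder f z)) \<le> B"
  using assms
proof (induction Z arbitrary: f rule: finite_induct)
  case empty
  have "norm (f a) \<le> B"
  proof (rule maximum_modulus_frontier[where S = "cball a R" and f = f and \<xi> = a])
    show "continuous_on (closure (cball a R)) f"
      using empty by (auto intro!: holomorphic_on_imp_continuous_on
          holomorphic_on_subset[OF empty.prems(1)])
    show "f holomorphic_on interior (cball a R)"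
      using empty by (auto intro!: holomorphic_on_subset[OF empty.prems(1)])
  qed (use empty in auto)
  thus ?case by simp
next
  case (insert \<rho> Z)
  have S: "open (ball a R')" "connected (ball a R')" by auto
  have "a \<in> ball a R'" using insert.prems by auto
  hence nz: "\<exists>w\<in>ball a R'. f w \<noteq> 0" using insert.prems by blast
  have \<rho>: "\<rho> \<in> ball a R'" "dist a \<rho> \<le> r" using insert.prems by auto
  have "\<rho> \<noteq> a" using insert.prems by auto
  define m where "m = nat (zorder f \<rho>)"
  obtain g where g: "g holomorphic_on ball a R'" "g \<rho> \<noteq> 0"
    "\<And>w. w \<in> ball a R' \<Longrightarrow> f w = g w * (w - \<rho>) ^ m"
    using holomorphic_divide_out_zero[OF insert.prems(1) S \<rho>(1) nz] unfolding m_def by metis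
  \<comment> \<open>\<open>f1\<close> is \<open>f\<close> with the \<open>m\<close> factors
    \<open>w - \<rho>\<close> replaced by \<open>b\<close>. On the circle of radius \<open>R\<close>
    both have the same modulus. The zero of \<open>b\<close> is the mirror image of \<rho> in that
    circle, hence outside \<open>cball a r\<close>, and at the centre each exchange gains a factor
    \<open>R / norm (a - \<rho>) \<ge> R / r\<close>.\<close>
  define b where "b z = (of_real (R\<^sup>2) - cnj (\<rho> - a) * (z - a)) / of_real R" for z
  define f1 where "f1 z = g z * b z ^ m" for z
  have R: "R > 0" "R \<noteq> 0" using insert.prems by auto
  have hol1: "f1 holomorphic_on ball a R'"
    unfolding f1_def b_def by (intro holomorphic_intros g(1)) (use R in auto)
  have b_nz: "b z \<noteq> 0" if "z \<in> cball a r" for z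
  proof
    assume "b z = 0"
    hence "of_real (R\<^sup>2) = cnj (\<rho> - a) * (z - a)" using R by (simp add: b_def)
    hence "norm (of_real (R\<^sup>2) :: complex) = norm (\<rho> - a) * norm (z - a)"
      by (metis complex_mod_cnj norm_mult)
    hence "R\<^sup>2 = norm (\<rho> - a) * norm (z - a)" by (simp add: norm_power)
    also have "\<dots> \<le> r * r" using \<rho> that insert.prems(2)
      by (intro mult_mono) (auto simp: dist_norm norm_minus_commute)
    also have "\<dots> < R * R" using insert.prems by (intro mult_strict_mono) auto
    finally show False by (simp add: power2_eq_square)
  qed
  have f1a: "norm (f1 a) = norm (f a) * (R / norm (a - \<rho>)) ^ m"
  proof -
    have "b a = of_real R" using R by (simp add: b_def power2_eq_square)
    moreover have "f a = g a * (a - \<rho>) ^ m" using g(3) \<open>a \<in> ball a R'\<close> by blast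
    ultimately show ?thesis using \<open>\<rho> \<noteq> a\<close> R
      by (simp add: f1_def norm_mult norm_power power_divide)
  qed
  \<comment> \<open>Off \<rho>, \<open>f1\<close> is \<open>f\<close> times
    \<open>(b w / (w - \<rho>)) ^ m\<close>, which is analytic and nonzero at the remaining zeros,
    so their orders do not change.\<close>
  have zo: "zorder f1 z = zorder f z" if "z \<in> Z" for z
  proof -
    have zr: "z \<in> cball a r" "z \<in> ball a R'" "z \<noteq> \<rho>" using that insert.prems insert.hyps by auto
    have "f1 analytic_on {z}" "f analytic_on {z}"
      using hol1 insert.prems(1) zr(2) S(1) analytic_at by blast+
    define q where "q w = (b w / (w - \<rho>)) ^ m" for w
    have q: "q analytic_on {z}"
      unfolding q_def b_def by (intro analytic_intros) (use zr R in auto)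
    have qz: "q z \<noteq> 0" using b_nz[OF zr(1)] zr(3) by (simp add: q_def)
    have ev: "\<forall>\<^sub>F w in at z. w \<in> ball a R' - {\<rho>}"
      using zr S(1) by (intro eventually_at_in_open') auto
    have "zorder f1 z = zorder (\<lambda>w. q w * f w) z"
    proof (rule zorder_cong)
      show "\<forall>\<^sub>F w in at z. f1 w = q w * f w" using ev
        by eventually_elim (auto simp: f1_def q_def g(3) power_divide)
    qed simp
    also have "\<dots> = zorder q z + zorder f z"
    proof (rule zorder_times_analytic[OF q \<open>f analytic_on {z}\<close>])
      have "\<forall>\<^sub>F w in at z. f w \<noteq> 0"
        using non_zero_neighbour_alt[OF insert.prems(1) S zr(2) \<open>a \<in> ball a R'\<close> insert.prems(5)]
        by (auto elim: eventually_mono)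
      moreover have "\<forall>\<^sub>F w in at z. q w \<noteq> 0"
        using q qz by (metis analytic_at_imp_isCont continuous_within tendsto_imp_eventually_ne)
      ultimately show "\<forall>\<^sub>F w in at z. q w * f w \<noteq> 0" by eventually_elim auto
    qed
    also have "zorder q z = 0" using q qz by (rule zorder_eq_0I)
    finally show ?thesis by simp
  qed
  have IH: "norm (f1 a) * (R / r) ^ (\<Sum>z\<in>Z. nat (zorder f1 z)) \<le> B"
  proof (rule insert.IH)
    show "f1 a \<noteq> 0"
      using f1a insert.prems(5) R \<open>\<rho> \<noteq> a\<close>
      by (metis divide_eq_0_iff eq_iff_diff_eq_0 mult_eq_0_iff norm_eq_zero power_not_zero)
    show "norm (f1 z) \<le> B" if "z \<in> sphere a R" for z
    proof -
      have z: "norm (z - a) = R" "z \<in> ball a R'"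
        using that insert.prems by (auto simp: dist_norm norm_minus_commute)
      have "norm (b z) = norm (z - \<rho>)"
        using norm_blaschke_factor[OF z(1), of "\<rho> - a"] R by (simp add: b_def norm_divide)
      hence "norm (f1 z) = norm (f z)"
        using g(3)[OF z(2)] by (simp add: f1_def norm_mult norm_power)
      thus ?thesis using insert.prems(6) that by simp
    qed
    show "f1 z = 0" if "z \<in> Z" for z
    proof -
      have "f z = 0" "z \<in> ball a R'" "z \<noteq> \<rho>" using that insert.prems insert.hyps by auto
      thus ?thesis using g(3)[of z] by (simp add: f1_def)
    qed
  qed (use insert.prems hol1 in auto)
  have "norm (f a) * (R / r) ^ (\<Sum>z\<in>insert \<rho> Z. nat (zorder f z))
      = norm (f a) * (R / r) ^ m * (R / r) ^ (\<Sum>z\<in>Z. nat (zorder f1 z))"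
    using insert.hyps zo by (simp add: m_def power_add)
  also have "\<dots> \<le> norm (f a) * (R / norm (a - \<rho>)) ^ m * (R / r) ^ (\<Sum>z\<in>Z. nat (zorder f1 z))"
    using \<rho>(2) \<open>\<rho> \<noteq> a\<close> R insert.prems(2)
    by (intro mult_right_mono mult_left_mono power_mono divide_left_mono) (auto simp: dist_norm)
  also have "\<dots> \<le> B" using IH f1a by simp
  finally show ?case .
qed

section \<open>Large values of Dirichlet polynomials\<close>

lemma powr_has_field_derivative_real_segment:
  assumes "z \<in> closed_segment (complex_of_real a) (complex_of_real b)" "0 < a" "a \<le> b"
  shows "((\<lambda>z. z powr w) has_field_derivative w * z powr (w - 1)) (at z within S)"
    "\<exists>u. z = of_real u \<and> a \<le> u \<and> u \<le> b"
proof -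
  have "z \<in> of_real ` closed_segment a b" using assms by (simp add: closed_segment_of_real)
  then obtain u where u: "z = of_real u" "a \<le> u" "u \<le> b"
    using assms by (auto simp: closed_segment_eq_real_ivl)
  show "\<exists>u. z = of_real u \<and> a \<le> u \<and> u \<le> b" using u by blast
  have "z \<notin> \<real>\<^sub>\<le>\<^sub>0" using u assms by (auto simp: complex_nonpos_Reals_iff)
  thus "((\<lambda>z. z powr w) has_field_derivative w * z powr (w - 1)) (at z within S)"
    by (intro has_field_derivative_at_within[OF has_field_derivative_powr])
qed

lemma norm_powr_diff_le:
  assumes "0 < a" "a \<le> b" "Re w \<le> 1"
  shows "norm (complex_of_real b powr w - complex_of_real a powr w)
    \<le> norm w * a powr (Re w - 1) * (b - a)"
proof -
  have "norm (complex_of_real b powr w - complex_of_real a powr w)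
    \<le> norm w * a powr (Re w - 1) * norm (complex_of_real b - complex_of_real a)"
  proof (rule field_differentiable_bound[where S = "closed_segment (of_real a) (of_real b)"
        and f' = "\<lambda>z. w * z powr (w - 1)"])
    fix z assume z: "z \<in> closed_segment (complex_of_real a) (complex_of_real b)"
    show "((\<lambda>a. a powr w) has_field_derivative w * z powr (w - 1))
       (at z within closed_segment (complex_of_real a) (complex_of_real b))"
      using powr_has_field_derivative_real_segment(1)[OF z assms(1,2)] .
    obtain u where u: "z = of_real u" "a \<le> u" "u \<le> b"
      using powr_has_field_derivative_real_segment(2)[OF z assms(1,2)] by blast
    have "norm (z powr (w - 1)) = u powr (Re w - 1)"
      using u assms by (simp add: norm_powr_real_powr)
    also have "\<dots> \<le> a powr (Re w - 1)"
      using u assms by (intro powr_mono2') auto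
    finally show "norm (w * z powr (w - 1)) \<le> norm w * a powr (Re w - 1)"
      by (simp add: norm_mult mult_left_mono)
  qed auto
  also have "norm (complex_of_real b - complex_of_real a) = b - a"
    using assms by (metis abs_of_nonneg diff_ge_0_iff_ge norm_of_real of_real_diff)
  finally show ?thesis .
qed

text \<open>The expression is \<open>s - 1\<close> times the difference between
  \<open>b powr (- s)\<close> and the integral of \<open>x powr (- s)\<close> over the unit interval
  from \<open>a\<close> to \<open>b\<close>. Multiplying through by \<open>s - 1\<close> keeps the
  estimate valid at \<open>s = 1\<close>. It controls the part of a zeta summand that comes from the
  density \<kappa>.\<close>

lemma norm_powr_integral_diff_le:
  assumes "0 < a" "Re s \<ge> -1"
  defines "b \<equiv> a + 1"
  shows "norm ((s - 1) * complex_of_real b powr (- s) + complex_of_real b powr (1 - s)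
      - complex_of_real a powr (1 - s)) \<le> norm (s - 1) * norm s * a powr (- Re s - 1)"
proof -
  define f where "f z = z powr (1 - s) + (s - 1) * complex_of_real b powr (- s) * z" for z
  have ab: "a \<le> b" by (simp add: b_def)
  have "norm (f (of_real b) - f (of_real a))
    \<le> norm (s - 1) * norm s * a powr (- Re s - 1) * norm (complex_of_real b - complex_of_real a)"
  proof (rule field_differentiable_bound[where S = "closed_segment (of_real a) (of_real b)"
        and f' = "\<lambda>z. (1 - s) * z powr (1 - s - 1) + (s - 1) * complex_of_real b powr (- s)"])
    fix z assume z: "z \<in> closed_segment (complex_of_real a) (complex_of_real b)"
    show "(f has_field_derivative (1 - s) * z powr (1 - s - 1) + (s - 1) * complex_of_real b powr (- s))
       (at z within closed_segment (complex_of_real a) (complex_of_real b))"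
      unfolding f_def
      by (intro DERIV_add powr_has_field_derivative_real_segment(1)[OF z assms(1) ab])
        (auto intro!: derivative_eq_intros)
    obtain u where u: "z = of_real u" "a \<le> u" "u \<le> b"
      using powr_has_field_derivative_real_segment(2)[OF z assms(1) ab] by blast
    have "norm ((1 - s) * z powr (1 - s - 1) + (s - 1) * complex_of_real b powr (- s))
        = norm ((s - 1) * (complex_of_real b powr (- s) - of_real u powr (- s)))"
      by (simp add: u(1) algebra_simps)
    also have "\<dots> \<le> norm (s - 1) * (norm s * u powr (- Re s - 1) * (b - u))"
      unfolding norm_mult using norm_powr_diff_le[of u b "- s"] assms u
      by (intro mult_left_mono) auto
    also have "\<dots> \<le> norm (s - 1) * (norm s * a powr (- Re s - 1) * 1)"
    proof (intro mult_left_mono mult_mono)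
      show "u powr (- Re s - 1) \<le> a powr (- Re s - 1)"
        by (rule powr_mono2') (use assms u in auto)
    qed (use u in \<open>auto simp: b_def\<close>)
    finally show "norm ((1 - s) * z powr (1 - s - 1) + (s - 1) * complex_of_real b powr (- s))
      \<le> norm (s - 1) * norm s * a powr (- Re s - 1)" by (simp add: mult_ac)
  qed auto
  moreover have "norm (complex_of_real b - complex_of_real a) = 1" by (simp add: b_def)
  moreover have "f (of_real b) - f (of_real a) = (s - 1) * complex_of_real b powr (- s)
      + complex_of_real b powr (1 - s) - complex_of_real a powr (1 - s)"
    by (simp add: f_def b_def algebra_simps)
  ultimately show ?thesis by simp
qed

text \<open>\<open>w * x powr (w - 1)\<close> is the derivative of \<open>x powr w\<close> at the
  midpoint. In the Taylor expansions about \<open>x\<close> to both ends the quadratic terms cancel,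
  so that only the third derivative remains. This gains two powers of \<open>x\<close> over the
  derivative itself.\<close>

lemma norm_powr_midpoint_le:
  assumes "x > 1 / 2" "Re w \<le> 3"
  shows "norm (complex_of_real (x + 1/2) powr w - complex_of_real (x - 1/2) powr w
      - w * complex_of_real x powr (w - 1))
    \<le> norm w * norm (w - 1) * norm (w - 2) * (x - 1/2) powr (Re w - 3) / 8"
proof -
  define a b where "a = x - 1/2" and "b = x + 1/2"
  have ab: "0 < a" "a \<le> b" using assms by (auto simp: a_def b_def)
  define S where "S = closed_segment (complex_of_real a) (complex_of_real b)"
  \<comment> \<open>\<open>F i\<close> is the derivative of order \<open>i\<close> of
    \<open>z powr w\<close>, for \<open>i\<close> up to 3; the exponents stay unsimplified so that
    they match the derivative rule literally.\<close>
  define F :: "nat \<Rightarrow> complex \<Rightarrow> complex" where "F i z =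
    (if i = 0 then z powr w else if i = 1 then w * z powr (w - 1)
     else if i = 2 then w * ((w - 1) * z powr (w - 1 - 1))
     else w * ((w - 1) * ((w - 1 - 1) * z powr (w - 1 - 1 - 1))))" for i z
  define B where "B = norm w * norm (w - 1) * norm (w - 2) * a powr (Re w - 3)"
  have der: "(F i has_field_derivative F (Suc i) z) (at z within S)" if z: "z \<in> S" and i: "i \<le> 2" for i z
  proof -
    note d = powr_has_field_derivative_real_segment(1)[OF z[unfolded S_def] ab]
    have F: "F 0 = (\<lambda>z. z powr w)" "F 1 = (\<lambda>z. w * z powr (w - 1))"
      "F 2 = (\<lambda>z. w * ((w - 1) * z powr (w - 1 - 1)))"
      "F 3 = (\<lambda>z. w * ((w - 1) * ((w - 1 - 1) * z powr (w - 1 - 1 - 1))))"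
      by (auto simp: F_def)
    have "(F 0 has_field_derivative F 1 z) (at z within S)"
      "(F 1 has_field_derivative F 2 z) (at z within S)"
      "(F 2 has_field_derivative F 3 z) (at z within S)"
      unfolding F by (intro d DERIV_cmult)+
    moreover have "i = 0 \<or> i = 1 \<or> i = 2" using i by linarith
    ultimately show ?thesis by (auto simp: numeral_2_eq_2 numeral_3_eq_3)
  qed
  have bd: "norm (F (Suc 2) z) \<le> B" if z: "z \<in> S" for z
  proof -
    obtain u where u: "z = of_real u" "a \<le> u" "u \<le> b"
      using powr_has_field_derivative_real_segment(2)[OF z[unfolded S_def] ab] by blast
    have "norm (F (Suc 2) z) = norm w * norm (w - 1) * norm (w - 2) * u powr (Re w - 3)"
      using u ab by (simp add: F_def norm_mult norm_powr_real_powr diff_diff_eq numeral_3_eq_3)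
    also have "\<dots> \<le> B" unfolding B_def using u ab assms
      by (intro mult_left_mono powr_mono2') auto
    finally show ?thesis .
  qed
  have "complex_of_real ` {a..b} = S"
    using ab by (simp add: S_def closed_segment_of_real closed_segment_eq_real_ivl)
  moreover have "x \<in> {a..b}" "a \<in> {a..b}" "b \<in> {a..b}" by (simp_all add: a_def b_def)
  ultimately have mem: "of_real x \<in> S" "of_real a \<in> S" "of_real b \<in> S" by blast+
  have cS: "convex S" by (simp add: S_def)
  have exp: "(\<Sum>i\<le>2. F i p * h ^ i / fact i) = F 0 p + F 1 p * h + F 2 p * h\<^sup>2 / 2"
    for p h by (simp add: numeral_2_eq_2)
  have n1: "norm (complex_of_real b - of_real x) = 1/2" "norm (complex_of_real a - of_real x) = 1/2"
    "complex_of_real b - of_real x = 1/2" "complex_of_real a - of_real x = -1/2"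
    by (simp_all add: a_def b_def norm_divide)
  have T1: "norm (F 0 (of_real b) - (F 0 (of_real x) + F 1 (of_real x) * (1/2) + F 2 (of_real x) * (1/2)\<^sup>2 / 2)) \<le> B * (1/2) ^ 3 / 2"
    using complex_Taylor[OF cS der bd mem(1) mem(3)] unfolding exp n1 by simp
  have T2: "norm (F 0 (of_real a) - (F 0 (of_real x) + F 1 (of_real x) * (-1/2) + F 2 (of_real x) * (-1/2)\<^sup>2 / 2)) \<le> B * (1/2) ^ 3 / 2"
    using complex_Taylor[OF cS der bd mem(1) mem(2)] unfolding exp n1 by simp
  have "norm (F 0 (of_real b) - F 0 (of_real a) - F 1 (of_real x)) \<le> B * (1/2) ^ 3 / 2 + B * (1/2) ^ 3 / 2"
    by (rule order_trans[OF eq_refl order_trans[OF norm_triangle_ineq4 add_mono[OF T1 T2]]])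
      (rule arg_cong[where f = norm], simp add: field_simps power2_eq_square)
  also have "\<dots> = B / 8" by (simp add: power3_eq_cube)
  finally show ?thesis by (simp add: F_def B_def a_def b_def)
qed

lemma sum_inverse_cubes_le:
  assumes "1 \<le> X" "X \<le> Y"
  shows "(\<Sum>n\<in>{X<..Y}. 1 / real n ^ 3) \<le> 1 / real X ^ 2 - 1 / real Y ^ 2"
  using assms(2)
proof (induction Y rule: dec_induct)
  case (step n)
  have n: "real n > 0" using assms step by simp
  have "{X<..Suc n} = insert (Suc n) {X<..n}" using step by auto
  moreover have "1 / real (Suc n) ^ 3 \<le> 1 / real n ^ 2 - 1 / real (Suc n) ^ 2"
    using n by (simp add: divide_simps) (simp add: algebra_simps power2_eq_square power3_eq_cube)
  ultimately show ?case using step by simp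
qed simp

text \<open>By the midpoint rule \<open>- z\<close> times the sum is a telescoping sum of
  \<open>f n = (n + 1/2) powr (- z)\<close> up to errors of order \<open>n powr (- 3)\<close>. The
  two boundary terms are at most 1 because \<open>Re z \<ge> 0\<close>. The error constant
  \<open>E\<close> contains a factor \<open>norm z\<close>, so after division by
  \<open>norm z\<close> it stays bounded as \<open>z\<close> tends to 0.\<close>

lemma norm_sum_powr_le:
  assumes z: "Re z \<ge> 0" "Im z \<noteq> 0" and XY: "1 \<le> X" "X \<le> Y"
  shows "norm (\<Sum>n\<in>{X<..Y}. of_nat n powr (- 1 - z))
    \<le> 2 / \<bar>Im z\<bar> + norm (z + 1) * norm (z + 2) / real X ^ 2"
proof -
  have z0: "norm z > 0" using z by auto
  define f where "f n = complex_of_real (real n + 1/2) powr (- z)" for n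
  define E where "E = norm (- z) * norm (- z - 1) * norm (- z - 2)"
  have err: "norm (f n - f (n - 1) - (- z) * of_nat n powr (- 1 - z)) \<le> E * (1 / real n ^ 3)"
    if "n \<in> {X<..Y}" for n
  proof -
    have n2: "n \<ge> 2" using that XY by auto
    have "norm (complex_of_real (real n + 1/2) powr (- z) - complex_of_real (real n - 1/2) powr (- z)
      - (- z) * complex_of_real (real n) powr (- 1 - z)) \<le> E * (real n - 1/2) powr (Re (- z) - 3) / 8"
      using norm_powr_midpoint_le[of "real n" "- z"] n2 z
      unfolding E_def minus_diff_commute[of z 1] by simp
    also have "(real n - 1/2) powr (Re (- z) - 3) \<le> (real n - 1/2) powr (- 3)"
      using n2 z by (intro powr_mono) auto
    \<comment> \<open>Replacing \<open>n - 1/2\<close> by \<open>n / 2\<close> costs a factor 8,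
      which the 8 in \<open>norm_powr_midpoint_le\<close> cancels.\<close>
    also have "\<dots> \<le> (real n / 2) powr (- 3)"
      using n2 by (intro powr_mono2') auto
    also have "(real n / 2) powr (- 3) = 8 / real n ^ 3"
      using n2 by (simp add: powr_minus powr_divide field_simps powr_realpow)
    also have "E * (8 / real n ^ 3) / 8 = E * (1 / real n ^ 3)" by simp
    finally have "norm (complex_of_real (real n + 1/2) powr (- z) - complex_of_real (real n - 1/2) powr (- z)
      - (- z) * complex_of_real (real n) powr (- 1 - z)) \<le> E * (1 / real n ^ 3)"
      by (simp add: E_def mult_left_mono divide_right_mono)
    moreover have "real (n - 1) + 1/2 = real n - 1/2" using n2 by (simp add: of_nat_diff)
    ultimately show ?thesis unfolding f_def by (simp only: of_real_of_nat_eq)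
  qed
  have fb: "norm (f n) \<le> 1" if "n \<ge> 1" for n
  proof -
    have "norm (f n) = (real n + 1/2) powr (- Re z)"
      unfolding f_def by (subst norm_powr_real_powr) auto
    also have "\<dots> \<le> (real n + 1/2) powr 0" using that z by (intro powr_mono) auto
    finally show ?thesis by simp
  qed
  have tel: "(\<Sum>n\<in>{X<..Y}. f n - f (n - 1)) = f Y - f X"
    using XY(2)
  proof (induction Y rule: dec_induct)
    case (step n)
    have "{X<..Suc n} = insert (Suc n) {X<..n}" using step by auto
    thus ?case using step by simp
  qed simp
  have "norm z * norm (\<Sum>n\<in>{X<..Y}. of_nat n powr (- 1 - z))
      = norm (\<Sum>n\<in>{X<..Y}. (- z) * of_nat n powr (- 1 - z))"
    by (simp add: norm_mult sum_negf flip: sum_distrib_left)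
  also have "\<dots> = norm ((f Y - f X) - (\<Sum>n\<in>{X<..Y}. f n - f (n - 1) - (- z) * of_nat n powr (- 1 - z)))"
    unfolding sum_subtractf[of "\<lambda>n. f n - f (n - 1)"] tel by simp
  also have "\<dots> \<le> norm (f Y) + norm (f X) + (\<Sum>n\<in>{X<..Y}. norm (f n - f (n - 1) - (- z) * of_nat n powr (- 1 - z)))"
    by (intro order_trans[OF norm_triangle_ineq4] add_mono norm_triangle_ineq4 norm_sum)
  also have "\<dots> \<le> 1 + 1 + (\<Sum>n\<in>{X<..Y}. E * (1 / real n ^ 3))"
    using XY by (intro add_mono fb sum_mono err) auto
  also have "(\<Sum>n\<in>{X<..Y}. E * (1 / real n ^ 3)) \<le> E * (1 / real X ^ 2)"
    unfolding sum_distrib_left[symmetric] using sum_inverse_cubes_le[OF XY]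
    by (intro mult_left_mono) (auto simp: E_def intro: order_trans)
  finally have "norm z * norm (\<Sum>n\<in>{X<..Y}. of_nat n powr (- 1 - z)) \<le> 2 + E * (1 / real X ^ 2)"
    by simp
  moreover have "E = norm z * (norm (z + 1) * norm (z + 2))"
  proof -
    have "norm (- z - 1) = norm (z + 1)" "norm (- z - 2) = norm (z + 2)"
      by (metis minus_add_distrib norm_minus_cancel uminus_add_conv_diff add.commute)+
    thus ?thesis by (simp add: E_def)
  qed
  ultimately have "norm (\<Sum>n\<in>{X<..Y}. of_nat n powr (- 1 - z)) \<le> 2 / norm z + norm (z + 1) * norm (z + 2) / real X ^ 2"
    using z0 by (simp add: field_simps)
  also have "2 / norm z \<le> 2 / \<bar>Im z\<bar>"
    using z z0 abs_Im_le_cmod[of z] by (intro divide_left_mono) auto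
  finally show ?thesis by simp
qed

lemma sum_inverse_le_ln:
  assumes "n \<ge> 1"
  shows "(\<Sum>k=1..n. 1 / real k) \<le> 1 + ln (real n)"
  using assms
proof (induction n rule: dec_induct)
  case (step n)
  have "ln (real n / real (Suc n)) \<le> real n / real (Suc n) - 1"
    using step by (intro ln_le_minus_one) auto
  hence "1 / real (Suc n) \<le> ln (real (Suc n)) - ln (real n)"
    using step by (simp add: ln_div field_simps)
  thus ?case using step by simp
qed simp

lemma sum_inverse_int_le_ln:
  assumes "J \<subseteq> {- int t..int t}" "0 \<notin> J" "t \<ge> 1"
  shows "(\<Sum>j\<in>J. 1 / \<bar>real_of_int j\<bar>) \<le> 2 * (1 + ln t)"
proof -
  have fin: "finite J" using assms(1) finite_subset by blast
  have half: "(\<Sum>j\<in>B. 1 / \<bar>real_of_int j\<bar>) \<le> 1 + ln t"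
    if B: "B \<subseteq> J" "inj_on (\<lambda>j. nat \<bar>j\<bar>) B" for B
  proof -
    have "(\<Sum>j\<in>B. 1 / \<bar>real_of_int j\<bar>) = (\<Sum>j\<in>B. 1 / real (nat \<bar>j\<bar>))" by simp
    also have "\<dots> = (\<Sum>d\<in>(\<lambda>j. nat \<bar>j\<bar>) ` B. 1 / real d)" using B(2) by (simp add: sum.reindex)
    also have "\<dots> \<le> (\<Sum>d=1..t. 1 / real d)"
    proof (rule sum_mono2)
      show "(\<lambda>j. nat \<bar>j\<bar>) ` B \<subseteq> {1..t}"
      proof clarify
        fix j assume "j \<in> B"
        hence "j \<noteq> 0" "- int t \<le> j" "j \<le> int t" using B(1) assms by auto
        thus "nat \<bar>j\<bar> \<in> {1..t}" unfolding atLeastAtMost_iff by linarith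
      qed
    qed auto
    also have "\<dots> \<le> 1 + ln t" using assms(3) by (rule sum_inverse_le_ln)
    finally show ?thesis .
  qed
  have "J = {j\<in>J. j < 0} \<union> {j\<in>J. j > 0}" using assms(2) by (auto simp: neq_iff[of _ "0 :: int"]) (metis linorder_neqE)
  hence "(\<Sum>j\<in>J. 1 / \<bar>real_of_int j\<bar>)
      = (\<Sum>j\<in>{j\<in>J. j < 0} \<union> {j\<in>J. j > 0}. 1 / \<bar>real_of_int j\<bar>)" by simp
  also have "\<dots> = (\<Sum>j\<in>{j\<in>J. j < 0}. 1 / \<bar>real_of_int j\<bar>) + (\<Sum>j\<in>{j\<in>J. j > 0}. 1 / \<bar>real_of_int j\<bar>)"
    using fin by (intro sum.union_disjoint) auto
  also have "\<dots> \<le> (1 + ln t) + (1 + ln t)"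
    by (intro add_mono half) (auto simp: inj_on_def)
  finally show ?thesis by simp
qed

section \<open>Bombieri's inequality and its application to one point per strip\<close>

text \<open>Duality: with the conjugate values as weights \<open>c k\<close>, the left side
  \<open>S\<close> is a scalar product of \<xi> with \<open>V\<close>, the combination of the \<psi>
  with these weights. Cauchy-Schwarz leaves the mean square of \<open>V\<close>, a quadratic form in
  the \<open>c k\<close>; by \<open>2 |c k| |c l| \<le> |c k|^2 + |c l|^2\<close> and the symmetry
  of \<open>q\<close> it is at most \<open>M * S\<close>, and one factor \<open>S\<close>
  cancels.\<close>

lemma bombieri_inequality:
  fixes \<xi> :: "'n \<Rightarrow> complex" and \<psi> :: "'k \<Rightarrow> 'n \<Rightarrow> complex"
  assumes M0: "M \<ge> 0" and M: "\<And>k. k \<in> K \<Longrightarrow> (\<Sum>l\<in>K. norm (\<Sum>n\<in>I. \<psi> k n * cnj (\<psi> l n))) \<le> M"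
  shows "(\<Sum>k\<in>K. (norm (\<Sum>n\<in>I. \<xi> n * \<psi> k n))\<^sup>2) \<le> M * (\<Sum>n\<in>I. (norm (\<xi> n))\<^sup>2)"
proof -
  define c where "c k = cnj (\<Sum>n\<in>I. \<xi> n * \<psi> k n)" for k
  define S where "S = (\<Sum>k\<in>K. (norm (c k))\<^sup>2)"
  define q where "q k l = norm (\<Sum>n\<in>I. \<psi> k n * cnj (\<psi> l n))" for k l
  define V where "V n = (\<Sum>k\<in>K. c k * \<psi> k n)" for n
  have q_sym: "q k l = q l k" for k l
  proof -
    have "(\<Sum>n\<in>I. \<psi> k n * cnj (\<psi> l n)) = cnj (\<Sum>n\<in>I. \<psi> l n * cnj (\<psi> k n))"
      by (simp add: mult.commute)
    thus ?thesis unfolding q_def by (metis complex_mod_cnj)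
  qed
  have S0: "S \<ge> 0" unfolding S_def by (intro sum_nonneg) auto
  have "complex_of_real S = (\<Sum>k\<in>K. c k * (\<Sum>n\<in>I. \<xi> n * \<psi> k n))"
    unfolding S_def of_real_sum
    by (intro sum.cong refl) (simp only: complex_norm_square c_def complex_cnj_cnj)
  also have "\<dots> = (\<Sum>n\<in>I. \<xi> n * V n)"
    unfolding V_def sum_distrib_left by (subst sum.swap) (simp add: mult_ac)
  finally have "norm (complex_of_real S) = norm (\<Sum>n\<in>I. \<xi> n * V n)" by (rule arg_cong)
  hence "S = norm (\<Sum>n\<in>I. \<xi> n * V n)" using S0 by (simp only: norm_of_real abs_of_nonneg)
  also have "\<dots> \<le> (\<Sum>n\<in>I. norm (\<xi> n) * norm (V n))"
    by (rule order_trans[OF norm_sum]) (simp add: norm_mult)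
  finally have "S\<^sup>2 \<le> (\<Sum>n\<in>I. norm (\<xi> n) * norm (V n))\<^sup>2" using S0 by (intro power_mono)
  also have "\<dots> \<le> (\<Sum>n\<in>I. (norm (\<xi> n))\<^sup>2) * (\<Sum>n\<in>I. (norm (V n))\<^sup>2)"
    by (rule Cauchy_Schwarz_ineq_sum)
  also have "\<dots> \<le> (\<Sum>n\<in>I. (norm (\<xi> n))\<^sup>2) * (M * S)"
  proof (intro mult_left_mono sum_nonneg)
    have "complex_of_real (\<Sum>n\<in>I. (norm (V n))\<^sup>2) = (\<Sum>n\<in>I. V n * cnj (V n))"
      unfolding of_real_sum by (intro sum.cong refl) (simp only: complex_norm_square)
    also have "\<dots> = (\<Sum>n\<in>I. \<Sum>k\<in>K. \<Sum>l\<in>K. c k * cnj (c l) * (\<psi> k n * cnj (\<psi> l n)))"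
      by (simp add: V_def sum_product mult_ac)
    also have "\<dots> = (\<Sum>k\<in>K. \<Sum>l\<in>K. c k * cnj (c l) * (\<Sum>n\<in>I. \<psi> k n * cnj (\<psi> l n)))"
      unfolding sum_distrib_left
      by (subst sum.swap, intro sum.cong refl, subst sum.swap, rule refl)
    finally have "norm (complex_of_real (\<Sum>n\<in>I. (norm (V n))\<^sup>2)) \<le> (\<Sum>k\<in>K. \<Sum>l\<in>K. norm (c k) * norm (c l) * q k l)"
      by (simp add: q_def norm_mult sum_norm_le del: of_real_sum)
    moreover have "(\<Sum>n\<in>I. (norm (V n))\<^sup>2) \<ge> 0" by (intro sum_nonneg) auto
    ultimately have "(\<Sum>n\<in>I. (norm (V n))\<^sup>2) \<le> (\<Sum>k\<in>K. \<Sum>l\<in>K. norm (c k) * norm (c l) * q k l)"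
      by (simp only: norm_of_real abs_of_nonneg)
    also have "\<dots> \<le> (\<Sum>k\<in>K. \<Sum>l\<in>K. ((norm (c k))\<^sup>2 / 2 + (norm (c l))\<^sup>2 / 2) * q k l)"
    proof (intro sum_mono mult_right_mono)
      fix k l
      show "norm (c k) * norm (c l) \<le> (norm (c k))\<^sup>2 / 2 + (norm (c l))\<^sup>2 / 2"
        using sum_squares_bound[of "norm (c k)" "norm (c l)"] by simp
    qed (simp add: q_def)
    also have "\<dots> = (\<Sum>k\<in>K. \<Sum>l\<in>K. (norm (c k))\<^sup>2 / 2 * q k l) + (\<Sum>k\<in>K. \<Sum>l\<in>K. (norm (c l))\<^sup>2 / 2 * q k l)"
      by (simp add: distrib_right sum.distrib)
    also have "(\<Sum>k\<in>K. \<Sum>l\<in>K. (norm (c l))\<^sup>2 / 2 * q k l) = (\<Sum>k\<in>K. \<Sum>l\<in>K. (norm (c k))\<^sup>2 / 2 * q k l)"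
      by (subst sum.swap) (simp add: q_sym)
    also have "(\<Sum>k\<in>K. \<Sum>l\<in>K. (norm (c k))\<^sup>2 / 2 * q k l) + (\<Sum>k\<in>K. \<Sum>l\<in>K. (norm (c k))\<^sup>2 / 2 * q k l)
        = (\<Sum>k\<in>K. (norm (c k))\<^sup>2 * (\<Sum>l\<in>K. q k l))"
      unfolding sum_distrib_left sum.distrib[symmetric] by (intro sum.cong refl) simp
    also have "\<dots> \<le> (\<Sum>k\<in>K. (norm (c k))\<^sup>2 * M)"
      using M by (intro sum_mono mult_left_mono) (auto simp: q_def)
    also have "\<dots> = M * S" unfolding S_def sum_distrib_left by (simp add: mult.commute)
    finally show "(\<Sum>n\<in>I. (norm (V n))\<^sup>2) \<le> M * S" .
  qed auto
  finally have "S * S \<le> (M * (\<Sum>n\<in>I. (norm (\<xi> n))\<^sup>2)) * S"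
    by (simp add: power2_eq_square mult_ac)
  moreover have "M * (\<Sum>n\<in>I. (norm (\<xi> n))\<^sup>2) \<ge> 0"
    using M0 by (simp add: sum_nonneg)
  ultimately have "S \<le> M * (\<Sum>n\<in>I. (norm (\<xi> n))\<^sup>2)"
    using S0 by (metis less_eq_real_def mult_le_cancel_right not_le)
  moreover have "S = (\<Sum>k\<in>K. (norm (\<Sum>n\<in>I. \<xi> n * \<psi> k n))\<^sup>2)"
    unfolding S_def c_def by (simp only: complex_mod_cnj)
  ultimately show ?thesis by simp
qed

text \<open>The point \<open>s j\<close> lies in the strip with imaginary parts from
  \<open>j\<close> to \<open>j + 1\<close>. Scalar products belonging to strips at distance at least
  2 are estimated by \<open>norm_sum_powr_le\<close>; each \<open>j\<close> has at most three closer
  strips, itself included, for which the harmonic sum is good enough.\<close>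

lemma dirichlet_large_values:
  fixes s :: "int \<Rightarrow> complex" and b :: "nat \<Rightarrow> complex"
  assumes J: "J \<subseteq> {- int m..int m}" "m \<ge> 1"
    and s: "\<And>j. j \<in> J \<Longrightarrow> \<alpha> \<le> Re (s j) \<and> Re (s j) \<le> 1 \<and> of_int j \<le> Im (s j) \<and> Im (s j) \<le> of_int j + 1"
    and \<alpha>: "1/2 \<le> \<alpha>" "\<alpha> \<le> 1" and X: "real m ^ 3 \<le> real X ^ 2" "X \<le> Y"
  shows "(\<Sum>j\<in>J. (norm (\<Sum>n\<in>{X<..Y}. b n * of_nat n powr (- s j)))\<^sup>2)
    \<le> 127 * (1 + ln Y) * (real Y powr (2 - 2 * \<alpha>) * (\<Sum>n\<in>{X<..Y}. (norm (b n))\<^sup>2 / n))"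
proof -
  have finJ: "finite J" using J finite_subset by blast
  have "real m ^ 2 \<le> real m ^ 3" using J(2) by (intro power_increasing) auto
  hence "real m ^ 2 \<le> real X ^ 2" using X(1) by linarith
  hence mX: "m \<le> X" using power2_le_imp_le[of "real m" "real X"] by simp
  have X1: "1 \<le> X" "1 \<le> Y" using mX J(2) X(2) by auto
  have lnY: "ln (real Y) \<ge> 0" using X1 by simp
  define I where "I = {X<..Y}"
  \<comment> \<open>The exponent \<alpha> is moved into \<xi> and a factor
    \<open>n powr (- 1/2)\<close> is kept in \<psi>. The products then are
    \<open>n powr (- 1 - z j l)\<close> with \<open>Re (z j l) \<ge> 0\<close>, as
    \<open>norm_sum_powr_le\<close> demands.\<close>
  define \<psi> where "\<psi> j n = of_nat n powr (- 1/2 - (s j - of_real \<alpha>))" for j and n :: nat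
  define \<xi> where "\<xi> n = b n * of_nat n powr (of_real (1/2 - \<alpha>))" for n :: nat
  define z where "z j l = s j + cnj (s l) - 2 * of_real \<alpha>" for j l
  have I0: "n > 0" if "n \<in> I" for n using that by (simp add: I_def)
  have prod: "\<psi> j n * cnj (\<psi> l n) = of_nat n powr (- 1 - z j l)" if "n \<in> I" for j l n
  proof -
    have "cnj (\<psi> l n) = of_nat n powr cnj (- 1/2 - (s l - of_real \<alpha>))"
      unfolding \<psi>_def using I0[OF that] by (subst cnj_powr) (auto simp: complex_is_Real_iff)
    hence "\<psi> j n * cnj (\<psi> l n)
        = of_nat n powr ((- 1/2 - (s j - of_real \<alpha>)) + cnj (- 1/2 - (s l - of_real \<alpha>)))"
      by (simp only: \<psi>_def powr_add)
    also have "(- 1/2 - (s j - of_real \<alpha>)) + cnj (- 1/2 - (s l - of_real \<alpha>)) = - 1 - z j l"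
      by (simp add: z_def complex_eq_iff)
    finally show ?thesis .
  qed
  define q where "q j l = norm (\<Sum>n\<in>I. of_nat n powr (- 1 - z j l))" for j l
  have near: "q j l \<le> 1 + ln Y" if "j \<in> J" "l \<in> J" for j l
  proof -
    have "q j l \<le> (\<Sum>n\<in>I. 1 / real n)"
      unfolding q_def
    proof (rule sum_norm_le)
      fix n assume n: "n \<in> I"
      have "norm (of_nat n powr (- 1 - z j l)) = real n powr (- 1 - Re (z j l))"
        using I0[OF n] norm_powr_real_powr[of "of_nat n" "- 1 - z j l"] by simp
      also have "\<dots> \<le> real n powr (- 1)"
        using s[OF that(1)] s[OF that(2)] I0[OF n] by (intro powr_mono) (auto simp: z_def)
      finally show "norm (of_nat n powr (- 1 - z j l)) \<le> 1 / real n"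
        using I0[OF n] by (simp add: powr_minus field_simps)
    qed
    also have "\<dots> \<le> (\<Sum>n=1..Y. 1 / real n)"
      unfolding I_def by (intro sum_mono2) auto
    also have "\<dots> \<le> 1 + ln Y" using X1 by (intro sum_inverse_le_ln)
    finally show ?thesis .
  qed
  have far: "q j l \<le> 4 / \<bar>j - l\<bar> + 36 / m" if "j \<in> J" "l \<in> J" "\<bar>j - l\<bar> \<ge> 2" for j l
  proof -
    define y where "y = Im (z j l)"
    have sj: "\<alpha> \<le> Re (s j)" "Re (s j) \<le> 1" "of_int j \<le> Im (s j)" "Im (s j) \<le> of_int j + 1"
      "\<alpha> \<le> Re (s l)" "Re (s l) \<le> 1" "of_int l \<le> Im (s l)" "Im (s l) \<le> of_int l + 1"
      using s[OF that(1)] s[OF that(2)] by auto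
    have d: "\<bar>real_of_int (j - l)\<bar> \<ge> 2" using that(3) by linarith
    have "\<bar>j\<bar> \<le> int m" "\<bar>l\<bar> \<le> int m" using J(1) that(1,2) by (auto simp: subset_iff abs_le_iff)
    hence d2: "\<bar>real_of_int (j - l)\<bar> \<le> 2 * real m" by linarith
    have y: "y = Im (s j) - Im (s l)" by (simp add: y_def z_def)
    \<comment> \<open>Points of strips whose indices differ by \<open>d \<ge> 2\<close> have
      imaginary parts at distance at least \<open>d - 1 \<ge> d / 2\<close> and at most
      \<open>d + 1 \<le> 2 m + 1 \<le> 3 m\<close>.\<close>
    have yl: "\<bar>y\<bar> \<ge> \<bar>real_of_int (j - l)\<bar> / 2" using d sj unfolding y by (auto simp: abs_if split: if_splits)
    have "real m \<ge> 1" using J(2) by simp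
    hence yu: "\<bar>y\<bar> \<le> 3 * real m" using d2 sj unfolding y of_int_diff by linarith
    have x: "0 \<le> Re (z j l)" "Re (z j l) \<le> 1" using sj \<alpha> by (auto simp: z_def)
    have "norm (z j l) \<le> \<bar>Re (z j l)\<bar> + \<bar>y\<bar>" unfolding y_def by (rule cmod_le)
    hence nz: "norm (z j l) \<le> 4 * real m" using x yu J(2) by auto
    have "q j l \<le> 2 / \<bar>y\<bar> + norm (z j l + 1) * norm (z j l + 2) / real X ^ 2"
      unfolding q_def I_def y_def
      by (rule norm_sum_powr_le) (use x yl d X1 X in \<open>auto simp: y_def\<close>)
    also have "\<dots> \<le> 2 / (\<bar>real_of_int (j - l)\<bar> / 2) + (6 * real m) * (6 * real m) / real m ^ 3"
    proof (intro add_mono divide_left_mono frac_le mult_mono yl X(1))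
      show "norm (z j l + 1) \<le> 6 * real m" "norm (z j l + 2) \<le> 6 * real m"
        using nz J(2) norm_triangle_ineq[of "z j l" 1] norm_triangle_ineq[of "z j l" 2] by auto
    qed (use d J(2) yl in auto)
    also have "(6 * real m) * (6 * real m) / real m ^ 3 = 36 / m"
      using J(2) by (simp add: power3_eq_cube)
    finally show ?thesis by simp
  qed
  have ln2m: "ln (real (2 * m)) \<le> 1 + ln Y"
  proof -
    have "ln (real (2 * m)) \<le> ln (2 * real Y)"
      using J(2) mX X(2) by (subst ln_le_cancel_iff) auto
    also have "\<dots> = ln 2 + ln Y" using X1 by (simp add: ln_mult)
    also have "ln 2 \<le> (1::real)" using ln_le_minus_one[of "2::real"] by simp
    finally show ?thesis by simp
  qed
  have M: "(\<Sum>l\<in>J. norm (\<Sum>n\<in>I. \<psi> j n * cnj (\<psi> l n))) \<le> 127 * (1 + ln Y)" if j: "j \<in> J" for j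
  proof -
    have jm: "\<bar>j - l\<bar> \<le> 2 * int m" if "l \<in> J" for l
    proof -
      have "- int m \<le> l \<and> l \<le> int m" "- int m \<le> j \<and> j \<le> int m" using J(1) that j by auto
      thus ?thesis by linarith
    qed
    have "(\<Sum>l\<in>J. norm (\<Sum>n\<in>I. \<psi> j n * cnj (\<psi> l n))) = (\<Sum>l\<in>J. q j l)"
      by (intro sum.cong refl) (simp add: q_def prod cong: sum.cong)
    also have "\<dots> = (\<Sum>l\<in>{l\<in>J. \<bar>j - l\<bar> \<ge> 2}. q j l) + (\<Sum>l\<in>{l\<in>J. \<not> \<bar>j - l\<bar> \<ge> 2}. q j l)"
      using finJ by (subst sum.union_disjoint[symmetric]) (auto intro: sum.cong)
    also have "(\<Sum>l\<in>{l\<in>J. \<not> \<bar>j - l\<bar> \<ge> 2}. q j l) \<le> 3 * (1 + ln Y)"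
    proof -
      have sub: "{l\<in>J. \<not> \<bar>j - l\<bar> \<ge> 2} \<subseteq> {j - 1, j, j + 1}" by auto
      have "card {l\<in>J. \<not> \<bar>j - l\<bar> \<ge> 2} \<le> card {j - 1, j, j + 1}"
        by (rule card_mono[OF _ sub]) auto
      also have "\<dots> \<le> 3" by (simp add: card_insert_if)
      finally have c: "card {l\<in>J. \<not> \<bar>j - l\<bar> \<ge> 2} \<le> 3" .
      have "(\<Sum>l\<in>{l\<in>J. \<not> \<bar>j - l\<bar> \<ge> 2}. q j l) \<le> of_nat (card {l\<in>J. \<not> \<bar>j - l\<bar> \<ge> 2}) * (1 + ln Y)"
        using near j by (intro sum_bounded_above) auto
      also have "\<dots> \<le> 3 * (1 + ln Y)" using c lnY by (intro mult_right_mono) auto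
      finally show ?thesis .
    qed
    also have "(\<Sum>l\<in>{l\<in>J. \<bar>j - l\<bar> \<ge> 2}. q j l) \<le> (\<Sum>l\<in>{l\<in>J. \<bar>j - l\<bar> \<ge> 2}. 4 / \<bar>j - l\<bar> + 36 / m)"
      using far j by (intro sum_mono) auto
    also have "\<dots> = (\<Sum>l\<in>{l\<in>J. \<bar>j - l\<bar> \<ge> 2}. 4 / \<bar>j - l\<bar>) + real (card {l\<in>J. \<bar>j - l\<bar> \<ge> 2}) * (36 / m)"
      by (simp add: sum.distrib)
    \<comment> \<open>Here \<open>m^3 \<le> X^2\<close> pays off: the midpoint errors, at most
      \<open>36 / m\<close> each, are summed over at most \<open>2 m + 1 \<le> 3 m\<close> strips
      and stay bounded.\<close>
    also have "real (card {l\<in>J. \<bar>j - l\<bar> \<ge> 2}) * (36 / m) \<le> (3 * real m) * (36 / m)"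
    proof (rule mult_right_mono)
      have "card {l\<in>J. \<bar>j - l\<bar> \<ge> 2} \<le> card {- int m..int m}" using J(1) by (intro card_mono) auto
      also have "\<dots> \<le> 3 * m" using J(2) by simp
      finally show "real (card {l\<in>J. \<bar>j - l\<bar> \<ge> 2}) \<le> 3 * real m" by linarith
    qed simp
    also have "(3 * real m) * (36 / m) = 108" using J(2) by simp
    also have "(\<Sum>l\<in>{l\<in>J. \<bar>j - l\<bar> \<ge> 2}. 4 / real_of_int \<bar>j - l\<bar>) \<le> 8 * (2 + ln Y)"
    proof -
      define D where "D = (\<lambda>l. j - l) ` {l\<in>J. \<bar>j - l\<bar> \<ge> 2}"
      have "(\<Sum>l\<in>{l\<in>J. \<bar>j - l\<bar> \<ge> 2}. 4 / real_of_int \<bar>j - l\<bar>) = (\<Sum>d\<in>D. 4 / \<bar>real_of_int d\<bar>)"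
        unfolding D_def by (subst sum.reindex) (auto simp: inj_on_def)
      also have "\<dots> = 4 * (\<Sum>d\<in>D. 1 / \<bar>real_of_int d\<bar>)" by (simp add: sum_distrib_left)
      also have "\<dots> \<le> 4 * (2 * (1 + ln (real (2 * m))))"
      proof (intro mult_left_mono sum_inverse_int_le_ln)
        show "D \<subseteq> {- int (2 * m)..int (2 * m)}" using jm by (force simp: D_def abs_le_iff)
        show "0 \<notin> D" by (auto simp: D_def)
      qed (use J(2) in auto)
      finally show ?thesis using ln2m by simp
    qed
    \<comment> \<open>\<open>127 = 3 + 108 + 16\<close>: the near strips, the midpoint errors, and
      the constant part of \<open>8 * (2 + ln Y)\<close>.\<close>
    finally show ?thesis using lnY by (simp add: field_simps)
  qed
  have "(\<Sum>j\<in>J. (norm (\<Sum>n\<in>I. b n * of_nat n powr (- s j)))\<^sup>2)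
      = (\<Sum>j\<in>J. (norm (\<Sum>n\<in>I. \<xi> n * \<psi> j n))\<^sup>2)"
  proof (intro sum.cong refl arg_cong[where f = "\<lambda>x. (norm x)\<^sup>2"])
    fix j n
    have "of_nat n powr (- s j) = of_nat n powr (of_real (1/2 - \<alpha>)) * (of_nat n powr (- 1/2 - (s j - of_real \<alpha>)) :: complex)"
      by (subst powr_add[symmetric]) simp
    thus "b n * of_nat n powr (- s j) = \<xi> n * \<psi> j n" by (simp add: \<xi>_def \<psi>_def mult_ac)
  qed
  also have "\<dots> \<le> 127 * (1 + ln Y) * (\<Sum>n\<in>I. (norm (\<xi> n))\<^sup>2)"
    by (rule bombieri_inequality[OF _ M]) (use lnY in auto)
  also have "\<dots> \<le> 127 * (1 + ln Y) * (\<Sum>n\<in>I. real Y powr (2 - 2 * \<alpha>) * ((norm (b n))\<^sup>2 / n))"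
  proof (intro mult_left_mono sum_mono)
    fix n assume n: "n \<in> I"
    have "norm (of_nat n powr complex_of_real (1/2 - \<alpha>)) = real n powr (1/2 - \<alpha>)"
      using I0[OF n] norm_powr_real_powr[of "of_nat n" "complex_of_real (1/2 - \<alpha>)"] by simp
    hence "(norm (\<xi> n))\<^sup>2 = (norm (b n))\<^sup>2 * (real n powr (1/2 - \<alpha>))\<^sup>2"
      by (simp add: \<xi>_def norm_mult power_mult_distrib)
    also have "(real n powr (1/2 - \<alpha>))\<^sup>2 = real n powr (2 - 2 * \<alpha> - 1)"
      by (simp add: power2_eq_square flip: powr_add)
    also have "\<dots> = real n powr (2 - 2 * \<alpha>) / real n" using I0[OF n] by (subst powr_diff) simp
    also have "(norm (b n))\<^sup>2 * (real n powr (2 - 2 * \<alpha>) / real n)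
        \<le> (norm (b n))\<^sup>2 * (real Y powr (2 - 2 * \<alpha>) / real n)"
      using n \<alpha> by (intro mult_left_mono divide_right_mono powr_mono2) (auto simp: I_def)
    finally show "(norm (\<xi> n))\<^sup>2 \<le> real Y powr (2 - 2 * \<alpha>) * ((norm (b n))\<^sup>2 / n)"
      by (simp add: mult.commute)
  qed (use lnY in auto)
  finally show ?thesis unfolding I_def sum_distrib_left[symmetric] .
qed

section \<open>Partial summation and the absorption of logarithms\<close>

text \<open>Each term is compared with
  \<open>n powr (- \<delta>) - (n + 1) powr (- \<delta>)\<close>, which telescopes and by the mean
  value theorem equals \<open>\<delta> * \<xi> powr (- \<delta> - 1)\<close>. Since
  \<open>\<xi> < n + 1 \<le> 2 n\<close>, the comparison costs
  \<open>2 powr (1 + \<delta>)\<close>.\<close>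

lemma sum_powr_tail_le:
  fixes \<delta> :: real
  assumes "\<delta> > 0" "1 \<le> N" "N \<le> M"
  shows "(\<Sum>n=N..<M. real n powr (- \<delta> - 1)) \<le> 2 powr (1 + \<delta>) / \<delta> * (real N powr (- \<delta>) - real M powr (- \<delta>))"
  using assms(3)
proof (induction M rule: dec_induct)
  case (step n)
  have n: "real n > 0" "real n \<ge> 1" using assms step by auto
  have "\<exists>\<xi>. real n < \<xi> \<and> \<xi> < real n + 1 \<and>
      (real n + 1) powr (- \<delta>) - real n powr (- \<delta>) = (real n + 1 - real n) * (- \<delta> * \<xi> powr (- \<delta> - 1))"
    by (rule MVT2) (use n in \<open>auto intro!: derivative_eq_intros\<close>)
  then obtain \<xi> where \<xi>: "real n < \<xi>" "\<xi> < real n + 1"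
    "real n powr (- \<delta>) - (real n + 1) powr (- \<delta>) = \<delta> * \<xi> powr (- \<delta> - 1)" by force
  have "2 powr (- \<delta> - 1) * real n powr (- \<delta> - 1) = (2 * real n) powr (- \<delta> - 1)"
    using n by (simp add: powr_mult)
  also have "\<dots> \<le> \<xi> powr (- \<delta> - 1)" using \<xi> n assms by (intro powr_mono2') auto
  finally have "2 powr (1 + \<delta>) / \<delta> * (\<delta> * (2 powr (- \<delta> - 1) * real n powr (- \<delta> - 1)))
      \<le> 2 powr (1 + \<delta>) / \<delta> * (\<delta> * \<xi> powr (- \<delta> - 1))"
    using assms by (intro mult_left_mono) auto
  also have "2 powr (1 + \<delta>) / \<delta> * (\<delta> * (2 powr (- \<delta> - 1) * real n powr (- \<delta> - 1))) = real n powr (- \<delta> - 1)"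
  proof -
    have "2 powr (1 + \<delta>) * 2 powr (- \<delta> - 1) = (1::real)" by (simp flip: powr_add)
    thus ?thesis using assms by (simp add: mult.assoc[symmetric])
  qed
  finally have "real n powr (- \<delta> - 1) \<le> 2 powr (1 + \<delta>) / \<delta> * (real n powr (- \<delta>) - real (Suc n) powr (- \<delta>))"
    unfolding \<xi>(3)[symmetric] by (simp add: add.commute)
  thus ?case using step by (simp add: algebra_simps)
qed simp

text \<open>Abel summation, with \<open>1 / (k (k + 1))\<close> as the difference of consecutive
  weights; a linear bound on the partial sums up to \<open>N\<close> leaves a harmonic sum.\<close>

lemma sum_divide_le_of_sum_le:
  fixes a :: "nat \<Rightarrow> real" and \<eta> :: real
  assumes \<eta>: "\<eta> \<ge> 0" and K: "K \<ge> 0" and S: "\<And>k. k \<ge> 1 \<Longrightarrow> (\<Sum>n=1..k. a n) \<le> K * real k powr (1 + \<eta>)"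
    and N: "N \<ge> 1"
  shows "(\<Sum>n=1..N. a n / n) \<le> K * real N powr \<eta> * (2 + ln N)"
proof -
  define S where "S k = (\<Sum>n=1..k. a n)" for k
  have id: "(\<Sum>n=1..k. a n / n) = S k / (real k + 1) + (\<Sum>n=1..k. S n / (real n * (real n + 1)))" for k
  proof (induction k)
    case (Suc k)
    have "S k / (real k + 1) + a (Suc k) / real (Suc k)
      = S (Suc k) / (real (Suc k) + 1) + S (Suc k) / (real (Suc k) * (real (Suc k) + 1))"
      by (simp add: S_def divide_simps) (simp add: algebra_simps)
    thus ?case using Suc by simp
  qed (simp add: S_def)
  have Sb: "S n \<le> K * real N powr \<eta> * real n" if "1 \<le> n" "n \<le> N" for n
  proof -
    have "S n \<le> K * real n powr (1 + \<eta>)" using assms(3) that by (simp add: S_def)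
    also have "\<dots> = K * real n powr \<eta> * real n" using that by (simp add: powr_add)
    also have "\<dots> \<le> K * real N powr \<eta> * real n" using that \<eta> K
      by (intro mult_right_mono mult_left_mono powr_mono2) auto
    finally show ?thesis .
  qed
  define Q where "Q = K * real N powr \<eta>"
  have Q0: "Q \<ge> 0" using K by (simp add: Q_def)
  have "S N / (real N + 1) \<le> Q * 1"
  proof -
    have "S N / (real N + 1) \<le> Q * real N / (real N + 1)"
      using Sb[of N] N unfolding Q_def by (intro divide_right_mono) auto
    also have "\<dots> \<le> Q * 1" using Q0 by (simp add: field_simps)
    finally show ?thesis .
  qed
  moreover have "(\<Sum>n=1..N. S n / (real n * (real n + 1))) \<le> (\<Sum>n=1..N. Q * (1 / real n))"
  proof (rule sum_mono)
    fix n assume n: "n \<in> {1..N}"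
    have "S n / (real n * (real n + 1)) \<le> Q * real n / (real n * real n)"
      using Sb[of n] n Q0 unfolding Q_def[symmetric] by (intro frac_le mult_left_mono) auto
    thus "S n / (real n * (real n + 1)) \<le> Q * (1 / real n)" using n by simp
  qed
  moreover have "(\<Sum>n=1..N. Q * (1 / real n)) \<le> Q * (1 + ln N)"
    unfolding sum_distrib_left[symmetric] using Q0 N by (intro mult_left_mono sum_inverse_le_ln)
  ultimately show ?thesis unfolding id[of N] Q_def by (simp add: algebra_simps)
qed

lemma two_plus_ln_le_powr:
  fixes x \<eta> :: real
  assumes "\<eta> > 0" "x \<ge> 1"
  shows "2 + ln x \<le> (2 + 1 / \<eta>) * x powr \<eta>"
proof -
  have "ln x \<le> x powr \<eta> / \<eta>" using assms by (intro ln_powr_bound)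
  moreover have "1 \<le> x powr \<eta>" using assms by (intro ge_one_powr_ge_zero) auto
  ultimately show ?thesis by (simp add: algebra_simps)
qed

section \<open>Analytic continuation\<close>

text \<open>In the application \<open>G n\<close> is the number of elements of norm \<open>n\<close>, and \<open>m n\<close> is the sum of the
  Moebius function of the semigroup over these elements.\<close>

locale beurling_coeffs =
  fixes G m :: "nat \<Rightarrow> real" and \<kappa> A \<theta> :: real
  assumes G_nonneg: "G n \<ge> 0" and G_1: "G 1 = 1"
    and \<kappa>: "\<kappa> > 0" and A: "A > 0" and \<theta>: "0 < \<theta>" "\<theta> < 1"
    and G_count: "N \<ge> 1 \<Longrightarrow> \<bar>(\<Sum>n=1..N. G n) - \<kappa> * (real N - 1)\<bar> \<le> A * real N powr \<theta>"
    and m_le: "\<bar>m n\<bar> \<le> G n"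
    and m_conv: "n \<ge> 1 \<Longrightarrow> (\<Sum>d | d dvd n. m d * G (n div d)) = (if n = 1 then 1 else 0)"
    and G_conv_le: "\<eta> > 0 \<Longrightarrow> \<exists>K. \<forall>n\<ge>1. (\<Sum>d | d dvd n. G d * G (n div d)) \<le> K * real n powr \<eta> * G n"
    and G_square_le: "\<eta> > 0 \<Longrightarrow> \<exists>K. \<forall>N\<ge>1. (\<Sum>n=1..N. (G n)\<^sup>2) \<le> K * real N powr (1 + \<eta>)"
begin

definition remainder :: "nat \<Rightarrow> real" where
  "remainder N = (\<Sum>n=1..N. G n) - \<kappa> * (real N - 1)"

definition zeta_partial :: "nat \<Rightarrow> complex \<Rightarrow> complex" where
  "zeta_partial N s = (\<Sum>n=1..N. of_real (G n) * of_nat n powr (- s))"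

text \<open>The added term compensates the density \<kappa>: \<open>(s - 1)\<close> times the sum of
  \<open>\<kappa> * n powr (- s)\<close> over \<open>n \<le> N\<close> behaves like a constant minus
  \<open>\<kappa> * N powr (1 - s)\<close>. What remains depends on \<open>remainder\<close> only
  and converges for \<open>Re s > \<theta>\<close>; the factor \<open>s - 1\<close> clears the
  pole.\<close>

definition xi_partial :: "nat \<Rightarrow> complex \<Rightarrow> complex" where
  "xi_partial N s = (s - 1) * zeta_partial N s + of_real \<kappa> * of_nat N powr (1 - s)"

text \<open>The continuation of \<open>(s - 1) \<zeta>(s)\<close> to \<open>Re s > \<theta>\<close>.\<close>

definition xi :: "complex \<Rightarrow> complex" where
  "xi s = lim (\<lambda>N. xi_partial N s)"

text \<open>\<open>2 * A\<close> pays for the remainder terms at the two ends of the summation by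
  parts, the other summand for the series of steps, with the constant of
  \<open>sum_powr_tail_le\<close>.\<close>

definition xi_const :: "real \<Rightarrow> real" where
  "xi_const \<delta> = 2 * A + (\<kappa> + A) * (2 powr (1 + \<delta>) / \<delta>)"

lemma xi_const_pos: "\<delta> > 0 \<Longrightarrow> xi_const \<delta> > 0"
  unfolding xi_const_def using \<kappa> A by (intro add_pos_pos mult_pos_pos divide_pos_pos) auto

lemma norm_nat_powr: "n \<ge> 1 \<Longrightarrow> norm (of_nat n powr s :: complex) = real n powr Re s"
  using norm_powr_real_powr[of "of_nat n" s] by simp

lemma remainder_le: "N \<ge> 1 \<Longrightarrow> \<bar>remainder N\<bar> \<le> A * real N powr \<theta>"
  using G_count by (simp add: remainder_def)

text \<open>\<open>B\<close> is \<open>xi_partial\<close> without the boundary term of a summation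
  by parts. Writing \<open>G (Suc n)\<close> as \<kappa> plus the increment of
  \<open>remainder\<close>, the \<kappa>-part is a summand compared with an integral, and the rest
  is \<open>remainder n\<close> times a difference of powers. Axiom A makes both
  \<open>O(n powr (\<theta> - Re s - 1))\<close>, which is summable for
  \<open>Re s > \<theta>\<close>.\<close>

lemma xi_partial_step:
  fixes s :: complex
  defines "B \<equiv> \<lambda>N. xi_partial N s - (s - 1) * of_real (remainder N) * of_nat N powr (- s)"
  assumes n: "n \<ge> 1" and s: "Re s > 0"
  shows "norm (B (Suc n) - B n) \<le> norm (s - 1) * norm s * (\<kappa> + A) * real n powr (\<theta> - Re s - 1)"
proof -
  define p where "p k = (of_nat k :: complex) powr (- s)" for k :: nat
  define r where "r k = (of_nat k :: complex) powr (1 - s)" for k :: nat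
  have G_Suc: "G (Suc n) = \<kappa> + remainder (Suc n) - remainder n"
    by (simp add: remainder_def algebra_simps)
  have "B (Suc n) - B n = of_real \<kappa> * ((s - 1) * p (Suc n) + r (Suc n) - r n)
      + (s - 1) * of_real (remainder n) * (p n - p (Suc n))"
    unfolding B_def xi_partial_def zeta_partial_def p_def[symmetric] r_def[symmetric]
    by (simp add: G_Suc algebra_simps)
  also have "norm \<dots> \<le> norm (of_real \<kappa> * ((s - 1) * p (Suc n) + r (Suc n) - r n))
      + norm ((s - 1) * of_real (remainder n) * (p n - p (Suc n)))" by (rule norm_triangle_ineq)
  also have "norm (of_real \<kappa> * ((s - 1) * p (Suc n) + r (Suc n) - r n))
      \<le> \<kappa> * (norm (s - 1) * norm s * real n powr (\<theta> - Re s - 1))"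
  proof -
    have "norm ((s - 1) * p (Suc n) + r (Suc n) - r n) \<le> norm (s - 1) * norm s * real n powr (- Re s - 1)"
      using norm_powr_integral_diff_le[of "real n" s] n s by (simp add: p_def r_def add.commute)
    also have "\<dots> \<le> norm (s - 1) * norm s * real n powr (\<theta> - Re s - 1)"
      using n \<theta> by (intro mult_left_mono powr_mono) auto
    finally show ?thesis using \<kappa> by (simp add: norm_mult)
  qed
  also have "norm ((s - 1) * of_real (remainder n) * (p n - p (Suc n)))
      \<le> norm (s - 1) * (A * real n powr \<theta>) * (norm s * real n powr (- Re s - 1))"
  proof -
    have "norm (p n - p (Suc n)) \<le> norm s * real n powr (- Re s - 1)"
      using norm_powr_diff_le[of "real n" "real (Suc n)" "- s"] n s
      by (simp add: p_def norm_minus_commute)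
    thus ?thesis unfolding norm_mult using remainder_le[OF n] A by (intro mult_mono) auto
  qed
  also have "norm (s - 1) * (A * real n powr \<theta>) * (norm s * real n powr (- Re s - 1))
      = norm (s - 1) * norm s * A * real n powr (\<theta> - Re s - 1)"
  proof -
    have "real n powr (\<theta> - Re s - 1) = real n powr \<theta> * real n powr (- Re s - 1)"
      by (subst powr_add[symmetric]) (simp add: algebra_simps)
    thus ?thesis by (simp add: mult_ac)
  qed
  finally show ?thesis by (simp add: algebra_simps)
qed

lemma xi_partial_cauchy:
  assumes \<delta>: "\<delta> > 0" and s: "Re s \<ge> \<theta> + \<delta>" and N: "1 \<le> N" "N \<le> M"
  shows "norm (xi_partial M s - xi_partial N s)
    \<le> xi_const \<delta> * norm (s - 1) * (1 + norm s) * real N powr (\<theta> - Re s)"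
proof -
  define B where "B = (\<lambda>N. xi_partial N s - (s - 1) * of_real (remainder N) * of_nat N powr (- s))"
  define W where "W = norm (s - 1)"
  define U where "U = real N powr (\<theta> - Re s)"
  have W0: "W \<ge> 0" "U \<ge> 0" by (auto simp: W_def U_def)
  have R: "norm ((s - 1) * of_real (remainder k) * of_nat k powr (- s)) \<le> W * A * U"
    if "N \<le> k" for k
  proof -
    have k: "k \<ge> 1" using that N by simp
    have "norm ((s - 1) * of_real (remainder k) * of_nat k powr (- s))
        = W * (\<bar>remainder k\<bar> * real k powr (- Re s))"
      using k by (simp add: norm_mult norm_nat_powr W_def)
    also have "\<dots> \<le> W * (A * real k powr \<theta> * real k powr (- Re s))"
      using remainder_le[OF k] W0 by (intro mult_left_mono mult_right_mono) auto
    also have "\<dots> = W * A * real k powr (\<theta> - Re s)"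
      using k by (simp add: powr_diff powr_minus field_simps)
    also have "\<dots> \<le> W * A * U" unfolding U_def
      using that N s \<delta> W0 A by (intro mult_left_mono powr_mono2') auto
    finally show ?thesis .
  qed
  have "norm (B M - B N) \<le> W * norm s * (\<kappa> + A) * (U * (2 powr (1 + \<delta>) / \<delta>))"
  proof -
    have "B M - B N = (\<Sum>n=N..<M. B (Suc n) - B n)" using N by (simp add: sum_Suc_diff')
    also have "norm \<dots> \<le> (\<Sum>n=N..<M. W * norm s * (\<kappa> + A) * (real N powr (\<theta> - Re s + \<delta>) * real n powr (- \<delta> - 1)))"
    proof (rule sum_norm_le)
      fix n assume n: "n \<in> {N..<M}"
      have "norm (B (Suc n) - B n) \<le> W * norm s * (\<kappa> + A) * real n powr (\<theta> - Re s - 1)"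
        unfolding B_def W_def using n N s \<delta> \<theta> by (intro xi_partial_step) auto
      \<comment> \<open>The first factor decreases in \<open>n\<close> because
        \<open>Re s \<ge> \<theta> + \<delta>\<close>, so its value at \<open>N\<close> comes out of
        the sum; the second is summed. This keeps the full decay
        \<open>N powr (\<theta> - Re s)\<close> with a constant that depends on \<delta>
        alone.\<close>
      also have "real n powr (\<theta> - Re s - 1) = real n powr (\<theta> - Re s + \<delta>) * real n powr (- \<delta> - 1)"
        by (subst powr_add[symmetric]) (simp add: algebra_simps)
      also have "W * norm s * (\<kappa> + A) * (real n powr (\<theta> - Re s + \<delta>) * real n powr (- \<delta> - 1))
        \<le> W * norm s * (\<kappa> + A) * (real N powr (\<theta> - Re s + \<delta>) * real n powr (- \<delta> - 1))"
        using n N s W0 \<kappa> A by (intro mult_left_mono mult_right_mono powr_mono2') auto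
      finally show "norm (B (Suc n) - B n) \<le> W * norm s * (\<kappa> + A) * (real N powr (\<theta> - Re s + \<delta>) * real n powr (- \<delta> - 1))" .
    qed
    also have "\<dots> = W * norm s * (\<kappa> + A) * (real N powr (\<theta> - Re s + \<delta>) * (\<Sum>n=N..<M. real n powr (- \<delta> - 1)))"
      by (simp add: sum_distrib_left)
    also have "\<dots> \<le> W * norm s * (\<kappa> + A) * (real N powr (\<theta> - Re s + \<delta>) * (2 powr (1 + \<delta>) / \<delta> * real N powr (- \<delta>)))"
    proof (intro mult_left_mono)
      have "2 powr (1 + \<delta>) / \<delta> * (real N powr (- \<delta>) - real M powr (- \<delta>)) \<le> 2 powr (1 + \<delta>) / \<delta> * real N powr (- \<delta>)"
        using \<delta> by (intro mult_left_mono) auto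
      thus "(\<Sum>n=N..<M. real n powr (- \<delta> - 1)) \<le> 2 powr (1 + \<delta>) / \<delta> * real N powr (- \<delta>)"
        using sum_powr_tail_le[OF \<delta> N] by linarith
    qed (use W0 \<kappa> A in auto)
    also have "real N powr (\<theta> - Re s + \<delta>) * (2 powr (1 + \<delta>) / \<delta> * real N powr (- \<delta>)) = U * (2 powr (1 + \<delta>) / \<delta>)"
    proof -
      have "real N powr (\<theta> - Re s + \<delta>) * real N powr (- \<delta>) = U"
        unfolding U_def by (subst powr_add[symmetric]) (simp add: algebra_simps)
      thus ?thesis by (simp add: mult_ac)
    qed
    finally show ?thesis .
  qed
  moreover have "xi_partial M s - xi_partial N s = (B M - B N)
      + ((s - 1) * of_real (remainder M) * of_nat M powr (- s) - (s - 1) * of_real (remainder N) * of_nat N powr (- s))"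
    by (simp add: B_def)
  hence "norm (xi_partial M s - xi_partial N s) \<le> norm (B M - B N)
      + (norm ((s - 1) * of_real (remainder M) * of_nat M powr (- s)) + norm ((s - 1) * of_real (remainder N) * of_nat N powr (- s)))"
    by (metis norm_triangle_le add_left_mono norm_triangle_ineq4)
  ultimately have "norm (xi_partial M s - xi_partial N s)
      \<le> W * norm s * (\<kappa> + A) * (U * (2 powr (1 + \<delta>) / \<delta>)) + (W * A * U + W * A * U)"
    using R[of M] R[of N] N by linarith
  also have "\<dots> = W * U * ((2 * A) * 1 + ((\<kappa> + A) * (2 powr (1 + \<delta>) / \<delta>)) * norm s)"
    by (simp add: algebra_simps add_divide_distrib)
  also have "\<dots> \<le> W * U * ((2 * A) * (1 + norm s) + ((\<kappa> + A) * (2 powr (1 + \<delta>) / \<delta>)) * (1 + norm s))"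
    using W0 A \<kappa> \<delta> by (intro mult_left_mono add_mono) auto
  also have "\<dots> = xi_const \<delta> * W * (1 + norm s) * U" by (simp add: xi_const_def algebra_simps add_divide_distrib)
  finally show ?thesis by (simp add: W_def U_def)
qed

lemma xi_partial_tendsto:
  assumes "Re s > \<theta>"
  shows "(\<lambda>N. xi_partial N s) \<longlonglongrightarrow> xi s"
proof -
  define \<delta> where "\<delta> = Re s - \<theta>"
  have \<delta>: "\<delta> > 0" using assms by (simp add: \<delta>_def)
  define E where "E N = xi_const \<delta> * norm (s - 1) * (1 + norm s) * real N powr (- \<delta>)" for N :: nat
  have "E \<longlonglongrightarrow> 0" unfolding E_def using \<delta> by real_asymp
  have "Cauchy (\<lambda>N. xi_partial N s)"
  proof (rule metric_CauchyI)
    fix e :: real assume "e > 0"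
    have "\<forall>\<^sub>F N in sequentially. E N < e \<and> N \<ge> 1"
      using order_tendstoD(2)[OF \<open>E \<longlonglongrightarrow> 0\<close> \<open>e > 0\<close>] eventually_ge_at_top[of 1]
      by eventually_elim auto
    then obtain N where N: "E N < e" "N \<ge> 1" and N': "\<And>k. k \<ge> N \<Longrightarrow> E k < e"
      by (auto simp: eventually_at_top_linorder)
    have *: "dist (xi_partial j s) (xi_partial k s) < e" if "k \<ge> N" "j \<ge> k" for j k
    proof -
      have "dist (xi_partial j s) (xi_partial k s) \<le> E k"
        unfolding dist_norm E_def
        using xi_partial_cauchy[OF \<delta>, of s k j] that N by (simp add: \<delta>_def)
      thus ?thesis using N' that by fastforce
    qed
    show "\<exists>N. \<forall>j\<ge>N. \<forall>k\<ge>N. dist (xi_partial j s) (xi_partial k s) < e"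
      using * by (metis dist_commute nle_le)
  qed
  thus ?thesis unfolding xi_def by (simp add: Cauchy_convergent_iff convergent_LIMSEQ_iff)
qed

text \<open>The limit \<open>M \<rightarrow> \<infinity>\<close> of the Cauchy estimate. Large
  \<open>N\<close> makes the partial sums small at zeros of \<open>xi\<close>, while
  \<open>N = 1\<close> shows that \<open>xi\<close> grows at most quadratically in
  \<open>norm s\<close>.\<close>

lemma xi_approx:
  assumes "\<delta> > 0" "Re s \<ge> \<theta> + \<delta>" "1 \<le> N"
  shows "norm (xi s - xi_partial N s) \<le> xi_const \<delta> * norm (s - 1) * (1 + norm s) * real N powr (\<theta> - Re s)"
proof (rule tendsto_upperbound)
  show "(\<lambda>M. norm (xi_partial M s - xi_partial N s)) \<longlonglongrightarrow> norm (xi s - xi_partial N s)"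
    using assms by (intro tendsto_intros xi_partial_tendsto) auto
  show "\<forall>\<^sub>F M in sequentially. norm (xi_partial M s - xi_partial N s)
      \<le> xi_const \<delta> * norm (s - 1) * (1 + norm s) * real N powr (\<theta> - Re s)"
    using eventually_ge_at_top[of N] by eventually_elim (use assms xi_partial_cauchy in auto)
qed simp

lemma xi_holomorphic: "xi holomorphic_on {s. Re s > \<theta>}"
proof (rule holomorphic_uniform_sequence[where f = "\<lambda>N. xi_partial (Suc N)"])
  show "open {s. Re s > \<theta>}" by (rule open_halfspace_Re_gt)
  show "xi_partial (Suc N) holomorphic_on {s. Re s > \<theta>}" for N
    unfolding xi_partial_def zeta_partial_def by (intro holomorphic_intros) auto
  fix x :: complex assume "x \<in> {s. Re s > \<theta>}"
  hence x: "Re x > \<theta>" by simp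
  define \<delta> where "\<delta> = (Re x - \<theta>) / 2"
  have \<delta>: "\<delta> > 0" using x by (simp add: \<delta>_def)
  have ball: "Re s \<ge> \<theta> + \<delta> \<and> norm s \<le> norm x + \<delta>" if "s \<in> cball x \<delta>" for s
  proof -
    have "norm (x - s) \<le> \<delta>" using that by (simp add: dist_norm)
    moreover have "Re x - Re s \<le> norm (x - s)" using complex_Re_le_cmod[of "x - s"] by simp
    moreover have "norm s \<le> norm x + norm (x - s)"
      using norm_triangle_ineq4[of x "x - s"] by simp
    moreover have "\<theta> + \<delta> = Re x - \<delta>" by (simp add: \<delta>_def field_simps)
    ultimately show ?thesis by linarith
  qed
  define E where "E N = xi_const \<delta> * (norm x + \<delta> + 1) * (1 + (norm x + \<delta>)) * real (Suc N) powr (- \<delta>)" for N :: nat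
  have "E \<longlonglongrightarrow> 0" unfolding E_def using \<delta> by real_asymp
  have "uniform_limit (cball x \<delta>) (\<lambda>N. xi_partial (Suc N)) xi sequentially"
    unfolding uniform_limit_iff
  proof (intro allI impI)
    fix e :: real assume "e > 0"
    show "\<forall>\<^sub>F N in sequentially. \<forall>s\<in>cball x \<delta>. dist (xi_partial (Suc N) s) (xi s) < e"
      using order_tendstoD(2)[OF \<open>E \<longlonglongrightarrow> 0\<close> \<open>e > 0\<close>]
    proof eventually_elim
      case (elim N)
      show ?case
      proof
        fix s assume "s \<in> cball x \<delta>"
        note b = ball[OF this]
        have "dist (xi_partial (Suc N) s) (xi s) \<le> xi_const \<delta> * norm (s - 1) * (1 + norm s) * real (Suc N) powr (\<theta> - Re s)"
          using xi_approx[OF \<delta>, of s "Suc N"] b by (simp add: dist_norm norm_minus_commute)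
        also have "\<dots> \<le> E N" unfolding E_def
        proof (intro mult_mono powr_mono)
          show "norm (s - 1) \<le> norm x + \<delta> + 1" using norm_triangle_ineq4[of s 1] b by simp
        qed (use b \<delta> xi_const_pos[OF \<delta>] in auto)
        finally show "dist (xi_partial (Suc N) s) (xi s) < e" using elim by simp
      qed
    qed
  qed
  moreover have "cball x \<delta> \<subseteq> {s. Re s > \<theta>}" using ball \<delta> by force
  ultimately show "\<exists>d>0. cball x d \<subseteq> {s. Re s > \<theta>} \<and> uniform_limit (cball x d) (\<lambda>N. xi_partial (Suc N)) xi sequentially"
    using \<delta> by blast
qed

text \<open>Every \<open>xi_partial N\<close> with \<open>N \<ge> 1\<close> has the value \<kappa>
  at 1. Thus the point 1 is not a zero of \<open>xi\<close>, and \<open>xi\<close> does not vanish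
  identically.\<close>

lemma xi_1: "xi 1 = of_real \<kappa>"
proof -
  have "(\<lambda>N. xi_partial N 1) \<longlonglongrightarrow> of_real \<kappa>"
    by (rule tendsto_eventually)
      (auto simp: xi_partial_def intro!: eventually_mono[OF eventually_ge_at_top[of 1]])
  thus ?thesis using xi_partial_tendsto[of 1] \<theta> by (simp add: LIMSEQ_unique)
qed

lemma zeta_partial_tendsto:
  assumes "Re s > 1"
  shows "(\<lambda>N. zeta_partial N s) \<longlonglongrightarrow> xi s / (s - 1)"
proof -
  have s1: "s \<noteq> 1" using assms by auto
  have "(\<lambda>N. of_nat N powr (1 - s) :: complex) \<longlonglongrightarrow> 0"
  proof (rule Lim_null_comparison)
    show "\<forall>\<^sub>F N in sequentially. norm (of_nat N powr (1 - s) :: complex) \<le> real N powr (1 - Re s)"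
      using eventually_ge_at_top[of 1] by eventually_elim (simp add: norm_nat_powr)
    show "(\<lambda>N. real N powr (1 - Re s)) \<longlonglongrightarrow> 0" using assms by real_asymp
  qed
  hence "(\<lambda>N. (xi_partial N s - of_real \<kappa> * of_nat N powr (1 - s)) / (s - 1)) \<longlonglongrightarrow> (xi s - of_real \<kappa> * 0) / (s - 1)"
    using s1 assms \<theta> by (intro tendsto_intros xi_partial_tendsto) auto
  thus ?thesis using s1 by (simp add: xi_partial_def)
qed

lemma summable_G:
  fixes \<sigma> :: real
  assumes "\<sigma> > 1"
  shows "summable (\<lambda>n. G n * real n powr (- \<sigma>))"
proof -
  have eq: "zeta_partial N (of_real \<sigma>) = of_real (\<Sum>n=1..N. G n * real n powr (- \<sigma>))" for N
    unfolding zeta_partial_def of_real_sum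
    by (intro sum.cong refl) (simp flip: powr_of_real)
  have "convergent (\<lambda>N. complex_of_real (\<Sum>n=1..N. G n * real n powr (- \<sigma>)))"
    using zeta_partial_tendsto[of "of_real \<sigma>"] assms unfolding eq by (auto simp: convergent_def)
  hence "Bseq (\<lambda>N. complex_of_real (\<Sum>n=1..N. G n * real n powr (- \<sigma>)))" by (rule convergent_imp_Bseq)
  then obtain B where B: "\<And>N. \<bar>\<Sum>n=1..N. G n * real n powr (- \<sigma>)\<bar> \<le> B"
    unfolding Bseq_def norm_of_real by blast
  show ?thesis
  proof (rule summableI_nonneg_bounded)
    fix N
    have "(\<Sum>n<N. G n * real n powr (- \<sigma>)) \<le> (\<Sum>n\<in>insert 0 {1..N}. G n * real n powr (- \<sigma>))"
      by (rule sum_mono2) (auto simp: G_nonneg)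
    also have "\<dots> = (\<Sum>n=1..N. G n * real n powr (- \<sigma>))" by simp
    also have "\<dots> \<le> B" using B[of N] by simp
    finally show "(\<Sum>n<N. G n * real n powr (- \<sigma>)) \<le> B" .
  qed (simp add: G_nonneg)
qed

text \<open>Supplies the lower bound at the centre of the disc in Jensen's inequality. For
  \<open>n \<ge> 2\<close> and \<open>d \<ge> 2\<close> one has
  \<open>n powr (- d) \<le> 2 powr (2 - d) * n powr (- 2)\<close>, so far to the right the term
  \<open>n = 1\<close> of the zeta series dominates all others together.\<close>

lemma xi_lower_bound:
  obtains c where "c \<ge> 2" "\<And>s. Re s \<ge> c \<Longrightarrow> norm (xi s) \<ge> norm (s - 1) / 2"
proof -
  define W where "W = (\<Sum>n. G n * real n powr (- 2))"
  have W: "(\<Sum>n\<in>F. G n * real n powr (- 2)) \<le> W" if "finite F" for F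
    unfolding W_def using that summable_G[of 2] by (intro sum_le_suminf) (auto simp: G_nonneg)
  have "((\<lambda>c::real. 2 powr (2 - c) * W) \<longlongrightarrow> 0) at_top" by real_asymp
  hence "\<forall>\<^sub>F c in at_top. 2 powr (2 - c) * W < 1 / 2"
    by (rule order_tendstoD(2)) simp
  hence "\<forall>\<^sub>F c in at_top. 2 powr (2 - c) * W < 1 / 2 \<and> c \<ge> 2"
    using eventually_ge_at_top[of "2::real"] by (rule eventually_conj)
  then obtain c where c: "\<And>d. d \<ge> c \<Longrightarrow> 2 powr (2 - d) * W < 1 / 2" "c \<ge> 2"
    by (auto simp: eventually_at_top_linorder)
  have "norm (xi s) \<ge> norm (s - 1) / 2" if "Re s \<ge> c" for s
  proof -
    define d where "d = Re s"
    have d: "d \<ge> c" "Re s = d" using that by (auto simp: d_def)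
    have "norm (zeta_partial N s) \<ge> 1/2" if "N \<ge> 1" for N
    proof -
      have "{1..N} = insert 1 {2..N}" using that by auto
      hence "zeta_partial N s = 1 + (\<Sum>n=2..N. of_real (G n) * of_nat n powr (- s))"
        using G_1 by (simp add: zeta_partial_def)
      moreover have "norm (\<Sum>n=2..N. of_real (G n) * of_nat n powr (- s)) \<le> (\<Sum>n=2..N. 2 powr (2 - d) * (G n * real n powr (- 2)))"
      proof (rule sum_norm_le)
        fix n assume n: "n \<in> {2..N}"
        have "norm (of_real (G n) * of_nat n powr (- s) :: complex) = G n * (real n powr (2 - d) * real n powr (- 2))"
          using n d by (simp add: norm_mult norm_nat_powr G_nonneg flip: powr_add)
        also have "\<dots> \<le> G n * (2 powr (2 - d) * real n powr (- 2))"
          using n d c by (intro mult_left_mono mult_right_mono powr_mono2' G_nonneg) auto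
        finally show "norm (of_real (G n) * of_nat n powr (- s) :: complex) \<le> 2 powr (2 - d) * (G n * real n powr (- 2))"
          by (simp add: mult_ac)
      qed
      moreover have "(\<Sum>n=2..N. 2 powr (2 - d) * (G n * real n powr (- 2))) \<le> 2 powr (2 - d) * W"
        unfolding sum_distrib_left[symmetric] by (intro mult_left_mono W) auto
      ultimately show ?thesis
        using c(1)[OF d(1)] norm_diff_ineq[of 1 "\<Sum>n=2..N. complex_of_real (G n) * of_nat n powr (- s)"] by simp
    qed
    hence "norm (xi s / (s - 1)) \<ge> 1/2"
      using d c zeta_partial_tendsto[of s]
      by (intro tendsto_lowerbound[OF tendsto_norm[OF zeta_partial_tendsto]])
        (auto intro!: eventually_mono[OF eventually_ge_at_top[of 1]])
    moreover have "s \<noteq> 1" using d c by auto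
    ultimately show ?thesis by (simp add: norm_divide field_simps)
  qed
  thus ?thesis using that c(2) by blast
qed

section \<open>The mollifier\<close>

definition mollifier :: "nat \<Rightarrow> complex \<Rightarrow> complex" where
  "mollifier X s = (\<Sum>d=1..X. of_real (m d) * of_nat d powr (- s))"

definition moll_coeff :: "nat \<Rightarrow> nat \<Rightarrow> nat \<Rightarrow> real" where
  "moll_coeff N X n = (\<Sum>d | d dvd n \<and> d \<le> X \<and> n div d \<le> N. m d * G (n div d))"

text \<open>For \<open>n \<le> X \<le> N\<close> every divisor \<open>d\<close> of \<open>n\<close>
  satisfies \<open>d \<le> X\<close> and \<open>n div d \<le> N\<close>. The truncated convolution
  is then the full one, which by \<open>m_conv\<close> is 1 at \<open>n = 1\<close> and 0
  elsewhere.\<close>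

lemma zeta_partial_mult_mollifier:
  assumes "1 \<le> X" "X \<le> N"
  shows "zeta_partial N s * mollifier X s
    = 1 + (\<Sum>n\<in>{X<..N*X}. of_real (moll_coeff N X n) * of_nat n powr (- s))"
proof -
  define S where "S = {1..N} \<times> {1..X}"
  define h :: "nat \<times> nat \<Rightarrow> complex" where
    "h p = of_real (m (snd p) * G (fst p)) * of_nat (fst p * snd p) powr (- s)" for p
  have "zeta_partial N s * mollifier X s = (\<Sum>p\<in>S. h p)"
    unfolding zeta_partial_def mollifier_def sum_product sum.cartesian_product S_def
    by (intro sum.cong refl) (auto simp: h_def powr_times_real mult_ac)
  also have "\<dots> = (\<Sum>n\<in>{1..N*X}. \<Sum>p\<in>{p\<in>S. fst p * snd p = n}. h p)"
  proof (rule sum.group[symmetric])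
    show "(\<lambda>p. fst p * snd p) ` S \<subseteq> {1..N*X}"
    proof clarify
      fix e d assume "(e, d) \<in> S"
      hence "1 \<le> e" "e \<le> N" "1 \<le> d" "d \<le> X" by (auto simp: S_def)
      thus "fst (e, d) * snd (e, d) \<in> {1..N*X}"
        using mult_le_mono[of 1 e 1 d] mult_le_mono[of e N d X] by simp
    qed
  qed (auto simp: S_def)
  also have "\<dots> = (\<Sum>n\<in>{1..N*X}. of_real (moll_coeff N X n) * of_nat n powr (- s))"
  proof (rule sum.cong[OF refl])
    fix n assume n: "n \<in> {1..N*X}"
    have "(\<Sum>p\<in>{p\<in>S. fst p * snd p = n}. h p)
      = (\<Sum>d | d dvd n \<and> d \<le> X \<and> n div d \<le> N. of_real (m d * G (n div d)) * of_nat n powr (- s))"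
    proof (rule sum.reindex_bij_witness[of _ "\<lambda>d. (n div d, d)" snd])
      fix d assume d: "d \<in> {d. d dvd n \<and> d \<le> X \<and> n div d \<le> N}"
      have "n div d * d = n" using d by simp
      moreover from this n have "d > 0" "n div d > 0" by (auto intro: gr0I)
      ultimately show "(n div d, d) \<in> {p \<in> S. fst p * snd p = n}"
        using d by (auto simp: S_def)
    qed (auto simp: S_def h_def)
    thus "(\<Sum>p\<in>{p\<in>S. fst p * snd p = n}. h p) = of_real (moll_coeff N X n) * of_nat n powr (- s)"
      by (simp add: moll_coeff_def sum_distrib_right)
  qed
  also have "{1..N*X} = {1..X} \<union> {X<..N*X}"
  proof -
    have "X \<le> N * X" using assms mult_le_mono1[of 1 N X] by linarith
    from order_trans[OF _ this] show ?thesis by auto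
  qed
  also have "(\<Sum>n\<in>{1..X} \<union> {X<..N*X}. of_real (moll_coeff N X n) * of_nat n powr (- s))
    = (\<Sum>n\<in>{1..X}. of_real (moll_coeff N X n) * of_nat n powr (- s))
      + (\<Sum>n\<in>{X<..N*X}. of_real (moll_coeff N X n) * of_nat n powr (- s))"
    by (rule sum.union_disjoint) auto
  also have "(\<Sum>n\<in>{1..X}. of_real (moll_coeff N X n) * of_nat n powr (- s))
    = (\<Sum>n\<in>{1..X}. if n = 1 then 1 else 0 :: complex)"
  proof (rule sum.cong[OF refl])
    fix n assume n: "n \<in> {1..X}"
    have "{d. d dvd n \<and> d \<le> X \<and> n div d \<le> N} = {d. d dvd n}"
      using n assms by (auto dest: dvd_imp_le intro: order_trans[OF div_le_dividend])
    hence "moll_coeff N X n = (if n = 1 then 1 else 0)"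
      using m_conv[of n] n by (simp add: moll_coeff_def)
    thus "of_real (moll_coeff N X n) * of_nat n powr (- s) = (if n = 1 then 1 else 0 :: complex)" by simp
  qed
  also have "\<dots> = 1" using assms by simp
  finally show ?thesis .
qed

lemma moll_coeff_le:
  assumes "\<eta> > 0"
  obtains K where "K \<ge> 0" "\<And>N X n. n \<ge> 1 \<Longrightarrow> \<bar>moll_coeff N X n\<bar> \<le> K * real n powr \<eta> * G n"
proof -
  obtain K where K: "\<And>n. n \<ge> 1 \<Longrightarrow> (\<Sum>d | d dvd n. G d * G (n div d)) \<le> K * real n powr \<eta> * G n"
    using G_conv_le[OF assms] by blast
  have "\<bar>moll_coeff N X n\<bar> \<le> max K 0 * real n powr \<eta> * G n" if n: "n \<ge> 1" for N X n
  proof -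
    have "\<bar>moll_coeff N X n\<bar> \<le> (\<Sum>d | d dvd n \<and> d \<le> X \<and> n div d \<le> N. G d * G (n div d))"
      unfolding moll_coeff_def
      by (rule order_trans[OF sum_abs sum_mono])
        (auto simp: abs_mult G_nonneg intro!: mult_right_mono m_le)
    also have "\<dots> \<le> (\<Sum>d | d dvd n. G d * G (n div d))"
      using n by (intro sum_mono2) (auto simp: G_nonneg)
    also have "\<dots> \<le> K * real n powr \<eta> * G n" using K n by blast
    also have "\<dots> \<le> max K 0 * real n powr \<eta> * G n"
      by (intro mult_right_mono) (auto simp: G_nonneg)
    finally show ?thesis .
  qed
  thus ?thesis using that[of "max K 0"] by simp
qed

lemma sum_moll_coeff_square_le:
  assumes "\<eta> > 0"
  obtains K where "K \<ge> 0"
    "\<And>N X Y. Y \<ge> 1 \<Longrightarrow> (\<Sum>n\<in>{X<..Y}. (moll_coeff N X n)\<^sup>2 / n) \<le> K * real Y powr \<eta>"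
proof -
  \<comment> \<open>Four factors \<open>Y powr \<epsilon>\<close> arise: two from the squared
    coefficient bound, one from the mean square of \<open>G\<close>, one from the logarithm of the
    partial summation.\<close>
  define \<epsilon> where "\<epsilon> = \<eta> / 4"
  have \<epsilon>: "\<epsilon> > 0" using assms by (simp add: \<epsilon>_def)
  obtain K where K: "K \<ge> 0" "\<And>N X n. n \<ge> 1 \<Longrightarrow> \<bar>moll_coeff N X n\<bar> \<le> K * real n powr \<epsilon> * G n"
    using moll_coeff_le[OF \<epsilon>] by blast
  obtain L0 where L0: "\<And>N. N \<ge> 1 \<Longrightarrow> (\<Sum>n=1..N. (G n)\<^sup>2) \<le> L0 * real N powr (1 + \<epsilon>)"
    using G_square_le[OF \<epsilon>] by blast
  define L where "L = max L0 0"
  have L: "L \<ge> 0" "\<And>N. N \<ge> 1 \<Longrightarrow> (\<Sum>n=1..N. (G n)\<^sup>2) \<le> L * real N powr (1 + \<epsilon>)"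
  proof -
    fix N :: nat assume "N \<ge> 1"
    hence "(\<Sum>n=1..N. (G n)\<^sup>2) \<le> L0 * real N powr (1 + \<epsilon>)" by (rule L0)
    also have "\<dots> \<le> L * real N powr (1 + \<epsilon>)" by (intro mult_right_mono) (auto simp: L_def)
    finally show "(\<Sum>n=1..N. (G n)\<^sup>2) \<le> L * real N powr (1 + \<epsilon>)" .
  qed (simp add: L_def)
  have "(\<Sum>n\<in>{X<..Y}. (moll_coeff N X n)\<^sup>2 / n) \<le> (K\<^sup>2 * L * (2 + 1 / \<epsilon>)) * real Y powr \<eta>" if Y: "Y \<ge> 1" for N X Y
  proof -
    have "(\<Sum>n\<in>{X<..Y}. (moll_coeff N X n)\<^sup>2 / n) \<le> (\<Sum>n\<in>{X<..Y}. (K * real Y powr \<epsilon>)\<^sup>2 * ((G n)\<^sup>2 / n))"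
    proof (rule sum_mono)
      fix n assume n: "n \<in> {X<..Y}"
      have "\<bar>moll_coeff N X n\<bar> \<le> K * real n powr \<epsilon> * G n" using K(2) n by simp
      also have "\<dots> \<le> K * real Y powr \<epsilon> * G n"
        using n K(1) \<epsilon> by (intro mult_right_mono mult_left_mono powr_mono2 G_nonneg) auto
      finally have "\<bar>moll_coeff N X n\<bar>\<^sup>2 \<le> (K * real Y powr \<epsilon> * G n)\<^sup>2" by (intro power_mono) auto
      thus "(moll_coeff N X n)\<^sup>2 / n \<le> (K * real Y powr \<epsilon>)\<^sup>2 * ((G n)\<^sup>2 / n)"
        by (simp add: power_mult_distrib divide_right_mono)
    qed
    also have "\<dots> = (K * real Y powr \<epsilon>)\<^sup>2 * (\<Sum>n\<in>{X<..Y}. (G n)\<^sup>2 / n)" by (simp add: sum_distrib_left)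
    also have "\<dots> \<le> (K * real Y powr \<epsilon>)\<^sup>2 * (\<Sum>n=1..Y. (G n)\<^sup>2 / n)"
      by (intro mult_left_mono sum_mono2) auto
    also have "\<dots> \<le> (K * real Y powr \<epsilon>)\<^sup>2 * (L * real Y powr \<epsilon> * (2 + ln Y))"
      using \<epsilon> L Y by (intro mult_left_mono sum_divide_le_of_sum_le) auto
    also have "\<dots> \<le> (K * real Y powr \<epsilon>)\<^sup>2 * (L * real Y powr \<epsilon> * ((2 + 1 / \<epsilon>) * real Y powr \<epsilon>))"
      using \<epsilon> L(1) Y by (intro mult_left_mono two_plus_ln_le_powr) auto
    also have "\<dots> = K\<^sup>2 * L * (2 + 1 / \<epsilon>) * (real Y powr \<epsilon> * real Y powr \<epsilon> * real Y powr \<epsilon> * real Y powr \<epsilon>)"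
      by (simp add: power2_eq_square mult_ac)
    also have "real Y powr \<epsilon> * real Y powr \<epsilon> * real Y powr \<epsilon> * real Y powr \<epsilon> = real Y powr \<eta>"
      by (simp add: \<epsilon>_def flip: powr_add)
    finally show ?thesis .
  qed
  moreover have "K\<^sup>2 * L * (2 + 1 / \<epsilon>) \<ge> 0" using L \<epsilon> by simp
  ultimately show ?thesis using that by blast
qed

text \<open>The trivial bound: \<open>m\<close> is majorized by \<open>G\<close>, whose partial sums
  are \<open>O(k)\<close> by Axiom A, and \<open>n powr (1 - \<alpha>)\<close> is largest at
  \<open>n = X\<close>.\<close>

lemma mollifier_le:
  assumes X: "X \<ge> 1" and \<alpha>: "\<alpha> \<le> 1" "\<alpha> \<le> Re s"
  shows "norm (mollifier X s) \<le> (\<kappa> + A) * (2 + ln X) * real X powr (1 - \<alpha>)"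
proof -
  have G_sum: "(\<Sum>n=1..k. G n) \<le> (\<kappa> + A) * real k powr (1 + 0)" if k: "k \<ge> 1" for k
  proof -
    have "(\<Sum>n=1..k. G n) \<le> \<kappa> * (real k - 1) + A * real k powr \<theta>" using G_count[OF k] by linarith
    also have "\<dots> \<le> \<kappa> * real k + A * real k powr 1"
      using k \<theta> \<kappa> A by (intro add_mono mult_left_mono powr_mono) auto
    finally show ?thesis using k by (simp add: algebra_simps)
  qed
  have "norm (mollifier X s) \<le> (\<Sum>n=1..X. real X powr (1 - \<alpha>) * (G n / n))"
    unfolding mollifier_def
  proof (rule sum_norm_le)
    fix n assume n: "n \<in> {1..X}"
    have "norm (of_real (m n) * of_nat n powr (- s) :: complex) = \<bar>m n\<bar> * real n powr (- Re s)"
      using n by (simp add: norm_mult norm_nat_powr)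
    also have "\<dots> \<le> G n * real n powr (1 - \<alpha> - 1)"
      using n \<alpha> by (intro mult_mono m_le powr_mono) (auto simp: G_nonneg)
    also have "real n powr (1 - \<alpha> - 1) = real n powr (1 - \<alpha>) / real n"
      using n by (subst powr_diff) simp
    also have "G n * (real n powr (1 - \<alpha>) / real n) \<le> G n * (real X powr (1 - \<alpha>) / real n)"
      using n \<alpha> by (intro mult_left_mono divide_right_mono powr_mono2 G_nonneg) auto
    finally show "norm (of_real (m n) * of_nat n powr (- s) :: complex) \<le> real X powr (1 - \<alpha>) * (G n / n)"
      by (simp add: mult_ac)
  qed
  also have "\<dots> = real X powr (1 - \<alpha>) * (\<Sum>n=1..X. G n / n)" by (simp add: sum_distrib_left)
  also have "\<dots> \<le> real X powr (1 - \<alpha>) * ((\<kappa> + A) * real X powr 0 * (2 + ln X))"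
    using \<kappa> A X G_sum by (intro mult_left_mono sum_divide_le_of_sum_le) auto
  finally show ?thesis using X by (simp add: mult_ac)
qed

text \<open>In the half-plane of absolute convergence the mollifier stays bounded by
  \<open>W\<close>, while for \<open>X = N\<close> the polynomial \<open>D\<close> is dominated by
  the tail of a convergent series. If the zeta series vanished at \<open>s\<close>, both
  \<open>1 + D\<close> and \<open>D\<close> would be small for large \<open>N\<close>.\<close>

lemma xi_nonzero:
  assumes s: "Re s > 1"
  shows "xi s \<noteq> 0"
proof
  assume "xi s = 0"
  define \<sigma> where "\<sigma> = Re s"
  \<comment> \<open>Half of the distance to 1: the factor \<open>n powr \<eta>\<close> in the
    coefficient bound moves the series to \<open>\<sigma> - \<eta>\<close>, still to the right of
    1.\<close>
  define \<eta> where "\<eta> = (\<sigma> - 1) / 2"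
  have \<eta>: "\<eta> > 0" "\<sigma> - \<eta> > 1" using s by (auto simp: \<eta>_def \<sigma>_def field_simps)
  obtain K where K: "K \<ge> 0" "\<And>N X n. n \<ge> 1 \<Longrightarrow> \<bar>moll_coeff N X n\<bar> \<le> K * real n powr \<eta> * G n"
    using moll_coeff_le[OF \<eta>(1)] by blast
  define W where "W = (\<Sum>n. G n * real n powr (- \<sigma>))"
  have moll: "norm (mollifier N s) \<le> W" for N
  proof -
    have "norm (mollifier N s) \<le> (\<Sum>n=1..N. G n * real n powr (- \<sigma>))"
      unfolding mollifier_def
      by (rule sum_norm_le) (auto simp: norm_mult norm_nat_powr \<sigma>_def intro!: mult_right_mono m_le)
    also have "\<dots> \<le> W" unfolding W_def
      using summable_G[of \<sigma>] s by (intro sum_le_suminf) (auto simp: \<sigma>_def G_nonneg)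
    finally show ?thesis .
  qed
  have W0: "W \<ge> 0" using moll[of 0] norm_ge_zero order_trans by blast
  have ev: "\<forall>\<^sub>F N in sequentially. norm (zeta_partial N s) < 1 / (2 * (W + 1))"
    using order_tendstoD(2)[OF tendsto_norm[OF zeta_partial_tendsto[OF s]], of "1 / (2 * (W + 1))"]
      \<open>xi s = 0\<close> W0 by simp
  have "\<forall>\<^sub>F N in sequentially. \<forall>M. norm (\<Sum>n\<in>{N..<M}. G n * real n powr (- (\<sigma> - \<eta>))) < 1 / (2 * (K + 1))"
    using summable_G[OF \<eta>(2)] K(1) unfolding summable_Cauchy eventually_sequentially by simp
  then obtain N0 where N0: "\<And>N M. N \<ge> N0 \<Longrightarrow> norm (\<Sum>n\<in>{N..<M}. G n * real n powr (- (\<sigma> - \<eta>))) < 1 / (2 * (K + 1))"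
    unfolding eventually_sequentially by blast
  obtain N where "max 1 N0 \<le> N \<and> norm (zeta_partial N s) < 1 / (2 * (W + 1))"
    using eventually_happens'[OF sequentially_bot eventually_conj[OF eventually_ge_at_top ev]] by blast
  hence N: "N \<ge> 1" "N \<ge> N0" "norm (zeta_partial N s) < 1 / (2 * (W + 1))" by auto
  define D where "D = (\<Sum>n\<in>{N<..N*N}. of_real (moll_coeff N N n) * of_nat n powr (- s) :: complex)"
  have "norm D \<le> (\<Sum>n\<in>{N<..N*N}. K * (G n * real n powr (- (\<sigma> - \<eta>))))"
    unfolding D_def
  proof (rule sum_norm_le)
    fix n assume n: "n \<in> {N<..N*N}"
    have "norm (of_real (moll_coeff N N n) * of_nat n powr (- s) :: complex)
        = \<bar>moll_coeff N N n\<bar> * real n powr (- \<sigma>)"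
      using n by (simp add: norm_mult norm_nat_powr \<sigma>_def)
    also have "\<dots> \<le> (K * real n powr \<eta> * G n) * real n powr (- \<sigma>)"
      using K(2) n by (intro mult_right_mono) auto
    also have "\<dots> = K * (G n * (real n powr \<eta> * real n powr (- \<sigma>)))" by (simp add: mult_ac)
    also have "real n powr \<eta> * real n powr (- \<sigma>) = real n powr (- (\<sigma> - \<eta>))"
      by (subst powr_add[symmetric]) simp
    finally show "norm (of_real (moll_coeff N N n) * of_nat n powr (- s) :: complex)
      \<le> K * (G n * real n powr (- (\<sigma> - \<eta>)))" .
  qed
  also have "\<dots> = K * (\<Sum>n\<in>{Suc N..<Suc (N*N)}. G n * real n powr (- (\<sigma> - \<eta>)))"
    by (simp add: sum_distrib_left atLeastSucLessThan_greaterThanLessThan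
        atLeastLessThanSuc_atLeastAtMost atLeastSucAtMost_greaterThanAtMost)
  also have "\<dots> \<le> K * (1 / (2 * (K + 1)))"
    using N0[of "Suc N" "Suc (N*N)"] N(2) K(1) by (intro mult_left_mono) auto
  also have "\<dots> \<le> 1 / 2" using K(1) by (simp add: field_simps)
  finally have D: "norm D \<le> 1 / 2" .
  have "norm (1 + D) = norm (zeta_partial N s) * norm (mollifier N s)"
    using zeta_partial_mult_mollifier[of N N s] N(1) by (simp add: D_def flip: norm_mult)
  also have "\<dots> \<le> (1 / (2 * (W + 1))) * W" using N(3) moll W0 by (intro mult_mono) auto
  also have "\<dots> < 1 / 2" using W0 by (simp add: field_simps)
  finally show False using D norm_diff_ineq[of 1 D] by simp
qed

text \<open>Jensen's inequality with a centre far to the right, at the height of the middle of the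
  box. The disc of radius \<open>r\<close> passes through the left corners of the box; the disc of
  radius \<open>R\<close> stays in \<open>Re z \<ge> \<theta> + \<delta>\<close>, where
  \<open>xi\<close> grows polynomially. Both radii are independent of \<open>j\<close>, so the count
  is the logarithm of the growth.\<close>

lemma zero_count_box:
  obtains C where "C \<ge> 0"
    "\<And>Z j. finite Z \<Longrightarrow> Z \<subseteq> {z. xi z = 0 \<and> (1 + \<theta>) / 2 \<le> Re z \<and> Re z \<le> 1 \<and> of_int j \<le> Im z \<and> Im z \<le> of_int j + 1}
      \<Longrightarrow> (\<Sum>z\<in>Z. real (nat (zorder xi z))) \<le> C * (2 + ln (1 + \<bar>of_int j\<bar>))"
proof -
  obtain c0 where c0: "c0 \<ge> 2" "\<And>s. Re s \<ge> c0 \<Longrightarrow> norm (xi s) \<ge> norm (s - 1) / 2"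
    by (rule xi_lower_bound) (rule that)
  define \<delta> where "\<delta> = (1 - \<theta>) / 4"
  have \<delta>: "\<delta> > 0" using \<theta> by (simp add: \<delta>_def)
  \<comment> \<open>The left side of the box is at \<open>\<theta> + 2 \<delta>\<close>. With
    \<open>x\<close> its distance from the centre, \<open>r = sqrt (x^2 + 1/4)\<close> and
    \<open>R = x + \<delta>\<close>, so \<open>r < R\<close> follows from
    \<open>\<delta> x \<ge> 1\<close>, that is, from a centre far enough to the right.\<close>
  define c where "c = max c0 (2 + 1 / \<delta>)"
  have c: "c \<ge> c0" "c \<ge> 2" "c \<ge> 2 + 1 / \<delta>" using c0 by (auto simp: c_def)
  define r where "r = sqrt ((c - (1 + \<theta>) / 2)\<^sup>2 + 1 / 4)"
  define R where "R = c - \<theta> - \<delta>"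
  have r0: "r > 0" unfolding r_def by (intro real_sqrt_gt_zero add_nonneg_pos) auto
  have rR: "r < R"
  proof -
    define x where "x = c - (1 + \<theta>) / 2"
    have R: "R = x + \<delta>" by (simp add: R_def x_def \<delta>_def field_simps)
    have x1: "x \<ge> 1 / \<delta>" using c(3) \<theta> by (simp add: x_def field_simps)
    have "1 \<le> \<delta> * x" using mult_left_mono[OF x1, of \<delta>] \<delta> by simp
    moreover have "(x + \<delta>)\<^sup>2 = x\<^sup>2 + 2 * (\<delta> * x) + \<delta>\<^sup>2" by (simp add: power2_eq_square algebra_simps)
    ultimately have "x\<^sup>2 + 1 / 4 < (x + \<delta>)\<^sup>2" using zero_le_power2[of \<delta>] by linarith
    moreover have "1 / \<delta> > 0" using \<delta> by simp
    hence "x + \<delta> > 0" using x1 \<delta> by linarith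
    ultimately have "sqrt (x\<^sup>2 + 1/4) < x + \<delta>" by (intro real_less_lsqrt) auto
    thus ?thesis by (simp add: r_def R x_def)
  qed
  have R0: "R > 0" using r0 rR by simp
  define q where "q = R / r"
  have q: "q > 1" using r0 rR by (simp add: q_def)
  define K where "K = 1 + \<kappa> + xi_const \<delta>"
  have K: "K \<ge> 1" using \<kappa> xi_const_pos[OF \<delta>] by (simp add: K_def)
  \<comment> \<open>With \<open>u = 1 + |j|\<close> one has
    \<open>1 + norm z \<le> (2 c + 3) u\<close> on the larger disc, so
    \<open>norm (xi z) \<le> K (1 + norm z)^2 \<le> B u^2\<close> there.\<close>
  define B where "B = K * (2 * c + 3)\<^sup>2"
  have B1: "B \<ge> 1"
  proof -
    have "1 \<le> (2 * c + 3)\<^sup>2" using c by (intro one_le_power) auto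
    thus ?thesis unfolding B_def using K mult_mono[of 1 K 1 "(2 * c + 3)\<^sup>2"] by simp
  qed
  have lq: "ln q > 0" using q by simp
  define C where "C = (ln (2 * B) + 2) / ln q"
  have C0: "C \<ge> 0" using lq B1 by (simp add: C_def)
  have "(\<Sum>z\<in>Z. real (nat (zorder xi z))) \<le> C * (2 + ln (1 + \<bar>of_int j\<bar>))"
    if Z: "finite Z" "Z \<subseteq> {z. xi z = 0 \<and> (1 + \<theta>) / 2 \<le> Re z \<and> Re z \<le> 1 \<and> of_int j \<le> Im z \<and> Im z \<le> of_int j + 1}" for Z j
  proof -
    define u where "u = 1 + \<bar>real_of_int j\<bar>"
    have u: "u \<ge> 1" by (simp add: u_def)
    define a where "a = Complex c (of_int j + 1/2)"
    have na: "norm a \<le> c + u"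
      using cmod_le[of a] c by (simp add: a_def u_def)
    have reg: "\<theta> + \<delta> \<le> Re z \<and> norm z \<le> 2 * c + u" if "norm (z - a) \<le> R" for z
    proof -
      have "Re a - Re z \<le> norm (z - a)"
        using complex_Re_le_cmod[of "a - z"] by (simp add: norm_minus_commute)
      moreover have "norm z \<le> norm a + norm (z - a)" using norm_triangle_ineq[of a "z - a"] by simp
      moreover have "R \<le> c" using \<theta> \<delta> by (simp add: R_def)
      moreover have "Re a = c" by (simp add: a_def)
      ultimately show ?thesis using that na unfolding R_def by linarith
    qed
    define R' where "R' = c - \<theta>"
    have "norm (xi a) * (R / r) ^ (\<Sum>z\<in>Z. nat (zorder xi z)) \<le> B * u\<^sup>2"
    proof (rule jensen_zero_bound[OF Z(1)])
      show "xi holomorphic_on ball a R'"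
      proof (rule holomorphic_on_subset[OF xi_holomorphic], clarify)
        fix z assume "z \<in> ball a R'"
        hence "norm (a - z) < R'" by (simp add: dist_norm)
        moreover have "Re a - Re z \<le> norm (a - z)" using complex_Re_le_cmod[of "a - z"] by simp
        ultimately show "\<theta> < Re z" by (simp add: R'_def a_def)
      qed
      show "R < R'" using \<delta> by (simp add: R_def R'_def)
      show "xi a \<noteq> 0" using c by (intro xi_nonzero) (simp add: a_def)
      show "Z \<subseteq> cball a r"
      proof
        fix z assume "z \<in> Z"
        hence z: "(1 + \<theta>) / 2 \<le> Re z" "Re z \<le> 1" "of_int j \<le> Im z" "Im z \<le> of_int j + 1" using Z by auto
        have "(c - Re z)\<^sup>2 \<le> (c - (1 + \<theta>) / 2)\<^sup>2" using z c by (intro power_mono) auto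
        moreover have "\<bar>of_int j + 1/2 - Im z\<bar> \<le> \<bar>1/2\<bar>" using z by linarith
        hence "(of_int j + 1/2 - Im z)\<^sup>2 \<le> (1/2)\<^sup>2" by (simp only: abs_le_square_iff)
        ultimately have "norm (a - z) \<le> r"
          unfolding r_def cmod_def a_def by (intro real_sqrt_le_mono) (simp add: power2_eq_square)
        thus "z \<in> cball a r" by (simp add: dist_norm)
      qed
      show "norm (xi z) \<le> B * u\<^sup>2" if "z \<in> sphere a R" for z
      proof -
        have z: "norm (z - a) \<le> R" using that by (simp add: dist_norm norm_minus_commute)
        have zr: "\<theta> + \<delta> \<le> Re z" and zn: "norm z \<le> 2 * c + u" using reg[OF z] by auto
        have z1: "norm (z - 1) \<le> 1 + norm z" using norm_triangle_ineq4[of z 1] by simp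
        have "norm (xi z) \<le> norm (xi_partial 1 z) + norm (xi z - xi_partial 1 z)"
          using norm_triangle_ineq[of "xi_partial 1 z" "xi z - xi_partial 1 z"] by simp
        also have "norm (xi z - xi_partial 1 z) \<le> xi_const \<delta> * norm (z - 1) * (1 + norm z)"
          using xi_approx[OF \<delta> zr, of 1] by simp
        also have "xi_partial 1 z = (z - 1) + of_real \<kappa>"
          using G_1 by (simp add: xi_partial_def zeta_partial_def)
        also have "norm \<dots> \<le> norm (z - 1) + \<kappa>"
          using norm_triangle_ineq[of "z - 1" "of_real \<kappa>"] \<kappa> by simp
        finally have "norm (xi z) \<le> norm (z - 1) + \<kappa> + xi_const \<delta> * norm (z - 1) * (1 + norm z)" by simp
        also have "\<dots> \<le> 1 * (1 + norm z)\<^sup>2 + \<kappa> * (1 + norm z)\<^sup>2 + xi_const \<delta> * (1 + norm z)\<^sup>2"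
        proof (intro add_mono)
          have n1: "1 + norm z \<ge> 1" by simp
          have n2: "1 + norm z \<le> (1 + norm z)\<^sup>2" using self_le_power[OF n1] by simp
          show "norm (z - 1) \<le> 1 * (1 + norm z)\<^sup>2" using z1 n2 by linarith
          show "\<kappa> \<le> \<kappa> * (1 + norm z)\<^sup>2" using \<kappa> n1 n2 by (simp add: mult_le_cancel_left1)
          show "xi_const \<delta> * norm (z - 1) * (1 + norm z) \<le> xi_const \<delta> * (1 + norm z)\<^sup>2"
            unfolding power2_eq_square mult.assoc using z1 xi_const_pos[OF \<delta>]
            by (intro mult_left_mono mult_right_mono) auto
        qed
        also have "\<dots> = K * (1 + norm z)\<^sup>2" by (simp add: K_def algebra_simps)
        also have "\<dots> \<le> K * ((2 * c + 3) * u)\<^sup>2"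
        proof (intro mult_left_mono power_mono)
          have "2 * c \<le> 2 * c * u" using u c by simp
          thus "1 + norm z \<le> (2 * c + 3) * u" using zn u by (simp add: algebra_simps)
        qed (use K in auto)
        finally show ?thesis by (simp add: B_def power_mult_distrib mult_ac)
      qed
    qed (use Z r0 rR in auto)
    moreover have "norm (xi a) \<ge> 1 / 2"
    proof -
      have "norm (a - 1) \<ge> 1" using complex_Re_le_cmod[of "a - 1"] c by (simp add: a_def)
      moreover have "norm (xi a) \<ge> norm (a - 1) / 2" using c0(2)[of a] c(1) by (simp add: a_def)
      ultimately show ?thesis by linarith
    qed
    hence "1 / 2 * q ^ (\<Sum>z\<in>Z. nat (zorder xi z)) \<le> norm (xi a) * (R / r) ^ (\<Sum>z\<in>Z. nat (zorder xi z))"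
      unfolding q_def[symmetric] using q by (intro mult_right_mono) auto
    ultimately have "q ^ (\<Sum>z\<in>Z. nat (zorder xi z)) \<le> 2 * B * u\<^sup>2" by simp
    hence "ln (q ^ (\<Sum>z\<in>Z. nat (zorder xi z))) \<le> ln (2 * B * u\<^sup>2)"
      using q B1 u by (subst ln_le_cancel_iff) auto
    hence "real (\<Sum>z\<in>Z. nat (zorder xi z)) * ln q \<le> ln (2 * B) + 2 * ln u"
      using q B1 u by (simp add: ln_realpow ln_mult)
    also have "\<dots> \<le> (ln (2 * B) + 2) * (2 + ln u)"
    proof -
      have "ln u \<ge> 0" "ln (2 * B) \<ge> 0" using u B1 by auto
      thus ?thesis by (simp add: algebra_simps)
    qed
    finally have "real (\<Sum>z\<in>Z. nat (zorder xi z)) \<le> C * (2 + ln u)"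
      using lq by (simp add: C_def field_simps)
    thus ?thesis by (simp add: u_def)
  qed
  thus ?thesis using that C0 by blast
qed

section \<open>The density estimate\<close>

text \<open>The vanishing of \<open>xi s\<close> turns \<open>xi_approx\<close> into a bound for
  \<open>xi_partial N s\<close>, and division by \<open>s - 1\<close> bounds the partial zeta sum.
  Its main term gains only \<open>1 / v\<close>, so \<open>D\<close> is not isolated: the squared
  form can be summed over many zeros, with \<open>v\<close> and \<open>U\<close> depending on the
  strip.\<close>

lemma mollified_zero:
  assumes s: "xi s = 0" "\<alpha> \<le> Re s" and \<alpha>: "(1 + \<theta>) / 2 \<le> \<alpha>" "\<alpha> \<le> 1"
    and X: "1 \<le> X" "X \<le> N" and v: "0 < v" "v \<le> \<bar>Im s\<bar>" and U: "1 + norm s \<le> U"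
  defines "Kc \<equiv> xi_const ((1 - \<theta>) / 2)"
  shows "1 \<le> 2 * (norm (\<Sum>n\<in>{X<..N*X}. of_real (moll_coeff N X n) * of_nat n powr (- s)))\<^sup>2
    + 4 * ((\<kappa> + A) * (2 + ln X) * real (N * X) powr (1 - \<alpha>))\<^sup>2 * (\<kappa>\<^sup>2 / v\<^sup>2 + Kc\<^sup>2 * U\<^sup>2 * (real N powr (\<theta> - 1))\<^sup>2)"
proof -
  define D where "D = (\<Sum>n\<in>{X<..N*X}. of_real (moll_coeff N X n) * of_nat n powr (- s) :: complex)"
  define \<delta> where "\<delta> = (1 - \<theta>) / 2"
  have \<delta>: "\<delta> > 0" using \<theta> by (simp add: \<delta>_def)
  have Kc: "Kc > 0" unfolding Kc_def using xi_const_pos[OF \<delta>] by (simp add: \<delta>_def)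
  have N1: "N \<ge> 1" using X by simp
  have U0: "U > 0" using U norm_ge_zero[of s] by linarith
  have s\<delta>: "Re s \<ge> \<theta> + \<delta>" using s \<alpha> by (simp add: \<delta>_def field_simps)
  define w where "w = norm (s - 1)"
  have w: "w \<ge> v" "w > 0" using v abs_Im_le_cmod[of "s - 1"] by (auto simp: w_def)
  have "norm (xi_partial N s) \<le> Kc * w * (1 + norm s) * real N powr (\<theta> - Re s)"
    using xi_approx[OF \<delta> s\<delta> N1] s(1) by (simp add: w_def Kc_def \<delta>_def)
  moreover have "w * norm (zeta_partial N s) \<le> norm (xi_partial N s) + norm (of_real \<kappa> * of_nat N powr (1 - s) :: complex)"
    unfolding w_def norm_mult[symmetric] xi_partial_def
    using norm_triangle_ineq4[of "(s - 1) * zeta_partial N s + of_real \<kappa> * of_nat N powr (1 - s)" "of_real \<kappa> * of_nat N powr (1 - s)"]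
    by simp
  moreover have "norm (of_real \<kappa> * of_nat N powr (1 - s) :: complex) = \<kappa> * real N powr (1 - Re s)"
    using N1 \<kappa> by (simp add: norm_mult norm_nat_powr)
  ultimately have "w * norm (zeta_partial N s) \<le> Kc * w * (1 + norm s) * real N powr (\<theta> - Re s) + \<kappa> * real N powr (1 - Re s)"
    by linarith
  hence "norm (zeta_partial N s) \<le> Kc * (1 + norm s) * real N powr (\<theta> - Re s) + \<kappa> / w * real N powr (1 - Re s)"
    using w by (simp add: field_simps)
  also have "\<dots> \<le> Kc * U * real N powr (\<theta> - \<alpha>) + \<kappa> / v * real N powr (1 - \<alpha>)"
    using Kc U U0 s N1 \<kappa> v w by (intro add_mono mult_mono powr_mono divide_left_mono) auto
  \<comment> \<open>Both error terms now carry \<open>N powr (1 - \<alpha>)\<close>, which combines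
    with \<open>X powr (1 - \<alpha>)\<close> from the mollifier to a power of
    \<open>N * X\<close>.\<close>
  also have "real N powr (\<theta> - \<alpha>) = real N powr (1 - \<alpha>) * real N powr (\<theta> - 1)"
    by (subst powr_add[symmetric]) simp
  finally have zb: "norm (zeta_partial N s) \<le> real N powr (1 - \<alpha>) * (\<kappa> / v + Kc * U * real N powr (\<theta> - 1))"
    by (simp add: algebra_simps)
  define Q where "Q = (\<kappa> + A) * (2 + ln X) * real (N * X) powr (1 - \<alpha>)"
  define x where "x = \<kappa> / v"
  define y where "y = Kc * U * real N powr (\<theta> - 1)"
  have Q0: "Q \<ge> 0" using \<kappa> A X by (simp add: Q_def)
  have xy: "x \<ge> 0" "y \<ge> 0" using \<kappa> v Kc U0 by (auto simp: x_def y_def)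
  have "norm (1 + D) = norm (zeta_partial N s) * norm (mollifier X s)"
    using zeta_partial_mult_mollifier[OF X, of s] by (simp add: D_def flip: norm_mult)
  also have "\<dots> \<le> (real N powr (1 - \<alpha>) * (x + y)) * ((\<kappa> + A) * (2 + ln X) * real X powr (1 - \<alpha>))"
    using zb mollifier_le[OF X(1) \<alpha>(2) s(2)] xy unfolding x_def y_def by (intro mult_mono) auto
  also have "\<dots> = Q * (x + y)" by (simp add: Q_def powr_mult mult_ac)
  finally have "norm (1 + D) \<le> Q * (x + y)" .
  moreover have "1 \<le> norm (1 + D) + norm D" using norm_triangle_ineq4[of "1 + D" D] by simp
  ultimately have "1 \<le> norm D + Q * (x + y)" by linarith
  hence "1 \<le> (norm D + Q * (x + y))\<^sup>2" by (rule one_le_power)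
  also have "\<dots> \<le> 2 * (norm D)\<^sup>2 + 2 * (Q * (x + y))\<^sup>2"
    using sum_squares_bound[of "norm D" "Q * (x + y)"] by (simp add: power2_sum)
  also have "(Q * (x + y))\<^sup>2 \<le> Q\<^sup>2 * (2 * (x\<^sup>2 + y\<^sup>2))"
    unfolding power_mult_distrib using sum_squares_bound[of x y]
    by (intro mult_left_mono) (auto simp: power2_sum)
  finally have "1 \<le> 2 * (norm D)\<^sup>2 + 4 * Q\<^sup>2 * (x\<^sup>2 + y\<^sup>2)" by (simp add: algebra_simps)
  moreover have "x\<^sup>2 = \<kappa>\<^sup>2 / v\<^sup>2" by (simp add: x_def power_divide)
  moreover have "y\<^sup>2 = Kc\<^sup>2 * U\<^sup>2 * (real N powr (\<theta> - 1))\<^sup>2" by (simp add: y_def power_mult_distrib)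
  ultimately show ?thesis unfolding D_def Q_def by (simp only:)
qed

text \<open>The strips with index -1 and 0 touch the real axis, where the bound
  \<open>1 / |Im s|\<close> in \<open>mollified_zero\<close> is useless. For every other index
  \<open>|Im s| \<ge> |j| / 2\<close>, and the errors can be summed over \<open>J\<close>.\<close>

lemma selected_zeros_bound:
  assumes \<epsilon>: "\<epsilon> > 0"
  obtains C where "C \<ge> 0"
    "\<And>t \<alpha> J s. t \<ge> 1 \<Longrightarrow> (1 + \<theta>) / 2 \<le> \<alpha> \<Longrightarrow> \<alpha> \<le> 1 \<Longrightarrow> J \<subseteq> {- int t..int t} - {-1, 0} \<Longrightarrow>
      (\<forall>j\<in>J. xi (s j) = 0 \<and> \<alpha> \<le> Re (s j) \<and> Re (s j) \<le> 1 \<and> of_int j \<le> Im (s j) \<and> Im (s j) \<le> of_int j + 1)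
      \<Longrightarrow> real (card J) \<le> C * real t powr ((6 - 2 * \<theta>) / (1 - \<theta>) * (1 - \<alpha>) + \<epsilon>)"
proof -
  \<comment> \<open>The lengths of the mollifier and of \<open>zeta_partial\<close> will be \<open>t powr (3/2)\<close> and \<open>t powr a\<close>. The first is
    what makes the off-diagonal terms in \<open>dirichlet_large_values\<close> harmless, and \<open>a\<close> is the least
    exponent for which the error terms of \<open>xi_approx\<close>, squared and summed over \<open>J\<close>, are harmless.\<close>
  define a where "a = 3 / (2 * (1 - \<theta>))"
  have a: "a \<ge> 3/2" using \<theta> by (simp add: a_def field_simps)
  define E where "E = a + 3/2"
  have E: "E > 0" using a by (simp add: E_def)
  \<comment> \<open>The final bound contains \<open>Y powr (4 * \<eta>)\<close>, three times \<eta>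
    from \<open>L ^ 3\<close> and once from the mean square, and \<open>Y\<close> is at most
    \<open>4 * t powr E\<close>. The cap 1/4 keeps the total exponent of \<open>Y\<close> at most 2,
    so that the 4 contributes at most 16.\<close>
  define \<eta> where "\<eta> = min (1/4) (\<epsilon> / (4 * E))"
  have \<eta>: "\<eta> > 0" "\<eta> \<le> 1/4" using \<epsilon> E by (auto simp: \<eta>_def)
  have \<eta>E: "4 * \<eta> * E \<le> \<epsilon>"
  proof -
    have "\<eta> \<le> \<epsilon> / (4 * E)" by (simp add: \<eta>_def)
    thus ?thesis using E by (simp add: field_simps)
  qed
  obtain KK where KK: "KK \<ge> 0"
    "\<And>N X Y. Y \<ge> 1 \<Longrightarrow> (\<Sum>n\<in>{X<..Y}. (moll_coeff N X n)\<^sup>2 / n) \<le> KK * real Y powr \<eta>"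
    using sum_moll_coeff_square_le[OF \<eta>(1)] by blast
  define Kc where "Kc = xi_const ((1 - \<theta>) / 2)"
  \<comment> \<open>\<open>254 = 2 * 127\<close> comes from \<open>dirichlet_large_values\<close>,
    \<open>8 * \<kappa>\<^sup>2\<close> from \<open>4 * \<kappa>\<^sup>2\<close> times the sum
    \<open>2 * L\<close> of the \<open>1 / |j|\<close>, and \<open>48 = 16 * 3\<close> from at most
    \<open>3 t\<close> strips with error \<open>16 * Kc\<^sup>2 / t\<close>.\<close>
  define C1 where "C1 = 254 * KK + 4 * (\<kappa> + A)\<^sup>2 * (8 * \<kappa>\<^sup>2 + 48 * Kc\<^sup>2)"
  have C1: "C1 \<ge> 0" using KK by (simp add: C1_def)
  define C2 where "C2 = (2 + 1 / \<eta>)"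
  have C2: "C2 \<ge> 0" using \<eta> by (simp add: C2_def)
  define C where "C = C1 * C2 ^ 3 * 16"
  have "real (card J) \<le> C * real t powr ((6 - 2 * \<theta>) / (1 - \<theta>) * (1 - \<alpha>) + \<epsilon>)"
    if t: "t \<ge> 1" and \<alpha>: "(1 + \<theta>) / 2 \<le> \<alpha>" "\<alpha> \<le> 1" and J: "J \<subseteq> {- int t..int t} - {-1, 0}"
      and s: "\<forall>j\<in>J. xi (s j) = 0 \<and> \<alpha> \<le> Re (s j) \<and> Re (s j) \<le> 1 \<and> of_int j \<le> Im (s j) \<and> Im (s j) \<le> of_int j + 1"
    for t \<alpha> J s
  proof -
    define X where "X = nat \<lceil>real t powr (3/2)\<rceil>"
    define N where "N = nat \<lceil>real t powr a\<rceil>"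
    define Y where "Y = N * X"
    have tp: "real t powr e \<ge> 1" if "e \<ge> 0" for e using t that by (intro ge_one_powr_ge_zero) auto
    have ceil: "x \<le> real (nat \<lceil>x\<rceil>) \<and> real (nat \<lceil>x\<rceil>) \<le> 2 * x" if "x \<ge> 1" for x :: real
      using that by linarith
    have Xb: "real t powr (3/2) \<le> X" "X \<le> 2 * real t powr (3/2)"
      and Nb: "real t powr a \<le> N" "N \<le> 2 * real t powr a"
      unfolding X_def N_def using ceil[OF tp[of "3/2"]] ceil[OF tp[of a]] a by auto
    have X1: "1 \<le> X" using Xb(1) tp[of "3/2"] by linarith
    have XN: "X \<le> N" unfolding X_def N_def
      using t a by (intro nat_mono ceiling_mono powr_mono) auto
    have N1: "N \<ge> 1" using X1 XN by simp
    have XY: "X \<le> Y" using N1 mult_le_mono1[of 1 N X] by (simp add: Y_def)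
    have Y1: "Y \<ge> 1" using X1 XY by simp
    have Yb: "real Y \<le> 4 * real t powr E"
    proof -
      have "real Y \<le> (2 * real t powr a) * (2 * real t powr (3/2))"
        unfolding Y_def of_nat_mult using Xb Nb by (intro mult_mono) auto
      also have "\<dots> = 4 * real t powr E" by (simp add: E_def powr_add)
      finally show ?thesis .
    qed
    have tX: "real t ^ 3 \<le> real X ^ 2"
    proof -
      have "real t ^ 3 = real t powr 3" using t by (simp add: powr_numeral)
      also have "\<dots> = (real t powr (3/2)) ^ 2" by (simp add: power2_eq_square flip: powr_add)
      also have "\<dots> \<le> real X ^ 2" using Xb by (intro power_mono) auto
      finally show ?thesis .
    qed
    have tN: "(real N powr (\<theta> - 1))\<^sup>2 \<le> 1 / real t ^ 3"
    proof -
      have "(real N powr (\<theta> - 1)) \<le> (real t powr a) powr (\<theta> - 1)"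
        using Nb(1) t \<theta> by (intro powr_mono2') auto
      hence "(real N powr (\<theta> - 1))\<^sup>2 \<le> ((real t powr a) powr (\<theta> - 1))\<^sup>2" by (intro power_mono) auto
      also have "\<dots> = real t powr (2 * (a * (\<theta> - 1)))"
        by (simp add: power2_eq_square powr_powr flip: powr_add)
      also have "2 * (a * (\<theta> - 1)) = - 3" using \<theta> by (simp add: a_def field_simps)
      also have "real t powr (- 3) = 1 / real t ^ 3"
        using t by (simp add: powr_minus field_simps powr_realpow)
      finally show ?thesis .
    qed
    have finJ: "finite J" using J by (rule finite_subset) auto
    have J1: "J \<subseteq> {- int t..int t}" "0 \<notin> J" using J by auto
    define L where "L = 2 + ln (real Y)"
    have lnY: "ln (real Y) \<ge> 0" using Y1 by simp
    have tX': "t \<le> X"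
    proof -
      have "real t powr 1 \<le> real t powr (3/2)" using t by (intro powr_mono) auto
      thus ?thesis using Xb(1) t by simp
    qed
    have L: "1 + ln (real Y) \<le> L" "2 + ln (real X) \<le> L" "1 + ln (real t) \<le> L" "L \<ge> 1"
    proof -
      show "2 + ln (real X) \<le> L" unfolding L_def using X1 XY by simp
      have "ln (real t) \<le> ln (real Y)" using t tX' XY by (subst ln_le_cancel_iff) auto
      thus "1 + ln (real t) \<le> L" by (simp add: L_def)
    qed (use lnY in \<open>auto simp: L_def\<close>)
    define V where "V = real Y powr (2 - 2 * \<alpha>)"
    define D where "D j = (norm (\<Sum>n\<in>{X<..Y}. of_real (moll_coeff N X n) * of_nat n powr (- s j) :: complex))\<^sup>2" for j
    define Q where "Q = 4 * ((\<kappa> + A) * (2 + ln X) * real (N * X) powr (1 - \<alpha>))\<^sup>2"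
    have Q: "0 \<le> Q" "Q \<le> 4 * (\<kappa> + A)\<^sup>2 * L\<^sup>2 * V"
    proof -
      have "Q = 4 * (\<kappa> + A)\<^sup>2 * (2 + ln X)\<^sup>2 * (real Y powr (1 - \<alpha>))\<^sup>2"
        by (simp add: Q_def Y_def power_mult_distrib)
      also have "(real Y powr (1 - \<alpha>))\<^sup>2 = V" by (simp add: V_def power2_eq_square flip: powr_add)
      also have "4 * (\<kappa> + A)\<^sup>2 * (2 + ln X)\<^sup>2 * V \<le> 4 * (\<kappa> + A)\<^sup>2 * L\<^sup>2 * V"
        using L X1 by (intro mult_right_mono mult_left_mono power_mono) (auto simp: V_def)
      finally show "Q \<le> 4 * (\<kappa> + A)\<^sup>2 * L\<^sup>2 * V" .
    qed (simp add: Q_def)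
    have per: "1 \<le> 2 * D j + Q * (4 * \<kappa>\<^sup>2 * (1 / \<bar>real_of_int j\<bar>) + 16 * Kc\<^sup>2 / real t)" if j: "j \<in> J" for j
    proof -
      have "- int t \<le> j" "j \<le> int t" and j0: "j \<noteq> 0" "j \<noteq> -1" using J j by auto
      hence jt: "\<bar>real_of_int j\<bar> \<le> real t" by linarith
      have sj: "xi (s j) = 0" "\<alpha> \<le> Re (s j)" "Re (s j) \<le> 1" "of_int j \<le> Im (s j)" "Im (s j) \<le> of_int j + 1"
        using s j by auto
      have j2: "j \<ge> 1 \<or> j \<le> -2" using j0 by linarith
      have v: "\<bar>real_of_int j\<bar> / 2 \<le> \<bar>Im (s j)\<bar>" "\<bar>real_of_int j\<bar> \<ge> 1"
      proof -
        have "real_of_int j \<ge> 1 \<or> real_of_int j \<le> -2" using j2 by linarith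
        thus "\<bar>real_of_int j\<bar> / 2 \<le> \<bar>Im (s j)\<bar>" "\<bar>real_of_int j\<bar> \<ge> 1" using sj by auto
      qed
      have "0 \<le> Re (s j)" using sj(2) \<alpha> \<theta> by simp
      hence "\<bar>Re (s j)\<bar> \<le> 1" using sj(3) by simp
      moreover have "\<bar>Im (s j)\<bar> \<le> real t + 1" using sj jt by linarith
      ultimately have "1 + norm (s j) \<le> 3 + real t" using cmod_le[of "s j"] by linarith
      hence U: "1 + norm (s j) \<le> 4 * real t" using t by linarith
      have "1 \<le> 2 * D j + Q * (\<kappa>\<^sup>2 / (\<bar>real_of_int j\<bar> / 2)\<^sup>2 + Kc\<^sup>2 * (4 * real t)\<^sup>2 * (real N powr (\<theta> - 1))\<^sup>2)"
        using mollified_zero[OF sj(1,2) \<alpha> X1 XN _ v(1) U] v(2)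
        unfolding D_def Q_def Y_def Kc_def by linarith
      also have "\<dots> \<le> 2 * D j + Q * (4 * \<kappa>\<^sup>2 * (1 / \<bar>real_of_int j\<bar>) + 16 * Kc\<^sup>2 / real t)"
      proof (intro add_left_mono mult_left_mono add_mono Q)
        \<comment> \<open>Weakening \<open>1 / j^2\<close> to \<open>1 / |j|\<close> allows the use
          of \<open>sum_inverse_int_le_ln\<close>; the extra logarithm disappears in
          \<epsilon>.\<close>
        have "\<bar>real_of_int j\<bar> \<le> \<bar>real_of_int j\<bar>\<^sup>2" using self_le_power[OF v(2), of 2] by simp
        hence "1 / \<bar>real_of_int j\<bar>\<^sup>2 \<le> 1 / \<bar>real_of_int j\<bar>" using v(2) by (intro divide_left_mono) auto
        hence "4 * \<kappa>\<^sup>2 * (1 / \<bar>real_of_int j\<bar>\<^sup>2) \<le> 4 * \<kappa>\<^sup>2 * (1 / \<bar>real_of_int j\<bar>)" by (intro mult_left_mono) auto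
        thus "\<kappa>\<^sup>2 / (\<bar>real_of_int j\<bar> / 2)\<^sup>2 \<le> 4 * \<kappa>\<^sup>2 * (1 / \<bar>real_of_int j\<bar>)" by (simp add: power_divide mult.commute)
        have "Kc\<^sup>2 * (4 * real t)\<^sup>2 * (real N powr (\<theta> - 1))\<^sup>2 \<le> Kc\<^sup>2 * (4 * real t)\<^sup>2 * (1 / real t ^ 3)"
          using tN by (intro mult_left_mono) auto
        also have "\<dots> = 16 * Kc\<^sup>2 / real t" using t by (simp add: power2_eq_square power3_eq_cube)
        finally show "Kc\<^sup>2 * (4 * real t)\<^sup>2 * (real N powr (\<theta> - 1))\<^sup>2 \<le> 16 * Kc\<^sup>2 / real t" .
      qed
      finally show ?thesis .
    qed
    have D_sum: "(\<Sum>j\<in>J. D j) \<le> 127 * L * (V * (KK * real Y powr \<eta>))"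
    proof -
      have "(\<Sum>j\<in>J. D j) \<le> 127 * (1 + ln Y) * (V * (\<Sum>n\<in>{X<..Y}. (norm (complex_of_real (moll_coeff N X n)))\<^sup>2 / n))"
        unfolding D_def V_def
        by (rule dirichlet_large_values[OF J1(1) t]) (use s \<alpha> \<theta> tX XY in auto)
      also have "\<dots> = 127 * (1 + ln Y) * (V * (\<Sum>n\<in>{X<..Y}. (moll_coeff N X n)\<^sup>2 / n))" by simp
      also have "\<dots> \<le> 127 * L * (V * (KK * real Y powr \<eta>))"
        using L lnY KK(2)[OF Y1] by (intro mult_mono mult_left_mono) (auto simp: V_def intro!: sum_nonneg mult_nonneg_nonneg)
      finally show ?thesis .
    qed
    have inv_sum: "(\<Sum>j\<in>J. 1 / \<bar>real_of_int j\<bar>) \<le> 2 * L"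
      by (rule order_trans[OF sum_inverse_int_le_ln[OF J1 t]]) (use L(3) in simp)
    \<comment> \<open>The total of the second error terms over all strips, up to the factor
      \<open>Q\<close>. It is bounded because \<open>(N powr (\<theta> - 1))^2 \<le> 1 / t^3\<close>
      beats the factor \<open>t^2\<close> from \<open>norm s\<close> and the number of
      strips.\<close>
    define c where "c = real (card J) * (16 * Kc\<^sup>2 / real t)"
    have c: "0 \<le> c" "c \<le> 48 * Kc\<^sup>2"
    proof -
      have "card J \<le> card {- int t..int t}" using J1 by (intro card_mono) auto
      hence "real (card J) \<le> 3 * real t" using t by simp
      hence "c \<le> 3 * real t * (16 * Kc\<^sup>2 / real t)" unfolding c_def by (intro mult_right_mono) auto
      thus "c \<le> 48 * Kc\<^sup>2" using t by simp
    qed (simp add: c_def)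
    have "real (card J) = (\<Sum>j\<in>J. 1)" by simp
    also have "\<dots> \<le> (\<Sum>j\<in>J. 2 * D j + Q * (4 * \<kappa>\<^sup>2 * (1 / \<bar>real_of_int j\<bar>) + 16 * Kc\<^sup>2 / real t))"
      by (intro sum_mono per)
    also have "\<dots> = 2 * (\<Sum>j\<in>J. D j) + Q * (4 * \<kappa>\<^sup>2 * (\<Sum>j\<in>J. 1 / \<bar>real_of_int j\<bar>) + c)"
      unfolding sum.distrib sum_distrib_left[symmetric] c_def by simp
    also have "\<dots> \<le> 2 * (127 * L * (V * (KK * real Y powr \<eta>))) + (4 * (\<kappa> + A)\<^sup>2 * L\<^sup>2 * V) * (4 * \<kappa>\<^sup>2 * (2 * L) + 48 * Kc\<^sup>2)"
    proof (intro add_mono mult_left_mono D_sum mult_mono[OF Q(2)] inv_sum c)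
      show "0 \<le> 4 * \<kappa>\<^sup>2 * (\<Sum>j\<in>J. 1 / \<bar>real_of_int j\<bar>) + c"
        using c(1) by (intro add_nonneg_nonneg mult_nonneg_nonneg sum_nonneg) auto
    qed (auto simp: V_def)
    also have "\<dots> \<le> C1 * (L ^ 3 * V * real Y powr \<eta>)"
    proof -
      have Yp: "real Y powr \<eta> \<ge> 1" using Y1 \<eta> by (intro ge_one_powr_ge_zero) auto
      have V0: "V \<ge> 0" by (simp add: V_def)
      have "L * V * real Y powr \<eta> \<le> L ^ 3 * V * real Y powr \<eta>"
        using L(4) V0 self_le_power[OF L(4), of 3] by (intro mult_right_mono) auto
      hence 1: "254 * KK * (L * V * real Y powr \<eta>) \<le> 254 * KK * (L ^ 3 * V * real Y powr \<eta>)"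
        using KK(1) by (intro mult_left_mono) auto
      have "L\<^sup>2 * V * (4 * \<kappa>\<^sup>2 * (2 * L) + 48 * Kc\<^sup>2) \<le> L\<^sup>2 * V * ((8 * \<kappa>\<^sup>2 + 48 * Kc\<^sup>2) * L)"
        using L(4) V0 mult_right_mono[OF L(4), of "Kc\<^sup>2"]
        by (intro mult_left_mono) (auto simp: algebra_simps)
      also have "\<dots> = (8 * \<kappa>\<^sup>2 + 48 * Kc\<^sup>2) * (L ^ 3 * V) * 1" by (simp add: power2_eq_square power3_eq_cube)
      also have "\<dots> \<le> (8 * \<kappa>\<^sup>2 + 48 * Kc\<^sup>2) * (L ^ 3 * V) * real Y powr \<eta>"
        using Yp L(4) V0 by (intro mult_left_mono) auto
      finally have "4 * (\<kappa> + A)\<^sup>2 * (L\<^sup>2 * V * (4 * \<kappa>\<^sup>2 * (2 * L) + 48 * Kc\<^sup>2))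
          \<le> 4 * (\<kappa> + A)\<^sup>2 * ((8 * \<kappa>\<^sup>2 + 48 * Kc\<^sup>2) * (L ^ 3 * V) * real Y powr \<eta>)"
        by (intro mult_left_mono) auto
      with 1 have "254 * KK * (L * V * real Y powr \<eta>) + 4 * (\<kappa> + A)\<^sup>2 * (L\<^sup>2 * V * (4 * \<kappa>\<^sup>2 * (2 * L) + 48 * Kc\<^sup>2))
        \<le> 254 * KK * (L ^ 3 * V * real Y powr \<eta>) + 4 * (\<kappa> + A)\<^sup>2 * ((8 * \<kappa>\<^sup>2 + 48 * Kc\<^sup>2) * (L ^ 3 * V) * real Y powr \<eta>)"
        by (rule add_mono)
      also have "\<dots> = C1 * (L ^ 3 * V * real Y powr \<eta>)" unfolding C1_def by algebra
      finally have "254 * KK * (L * V * real Y powr \<eta>) + 4 * (\<kappa> + A)\<^sup>2 * (L\<^sup>2 * V * (4 * \<kappa>\<^sup>2 * (2 * L) + 48 * Kc\<^sup>2))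
        \<le> C1 * (L ^ 3 * V * real Y powr \<eta>)" .
      moreover have "2 * (127 * L * (V * (KK * real Y powr \<eta>))) = 254 * KK * (L * V * real Y powr \<eta>)"
        by simp
      moreover have "4 * (\<kappa> + A)\<^sup>2 * L\<^sup>2 * V * W = 4 * (\<kappa> + A)\<^sup>2 * (L\<^sup>2 * V * W)" for W
        by (simp only: mult.assoc)
      ultimately show ?thesis by (simp only:)
    qed
    also have "\<dots> \<le> C1 * ((C2 * real Y powr \<eta>) ^ 3 * V * real Y powr \<eta>)"
    proof (intro mult_left_mono mult_right_mono power_mono C1)
      show "L \<le> C2 * real Y powr \<eta>" unfolding L_def C2_def using \<eta> Y1 by (intro two_plus_ln_le_powr) auto
    qed (use L in \<open>auto simp: V_def\<close>)
    also have "\<dots> = C1 * C2 ^ 3 * real Y powr (2 - 2 * \<alpha> + 4 * \<eta>)"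
    proof -
      have "real Y powr (2 - 2 * \<alpha> + 4 * \<eta>) = V * (real Y powr \<eta> * real Y powr \<eta> * real Y powr \<eta> * real Y powr \<eta>)"
        by (simp add: V_def flip: powr_add)
      thus ?thesis by (simp add: power3_eq_cube mult_ac)
    qed
    also have "\<dots> \<le> C1 * C2 ^ 3 * (16 * real t powr ((6 - 2 * \<theta>) / (1 - \<theta>) * (1 - \<alpha>) + \<epsilon>))"
    proof (intro mult_left_mono)
      define p where "p = 2 - 2 * \<alpha> + 4 * \<eta>"
      have p: "0 \<le> p" "p \<le> 2" using \<alpha> \<theta> \<eta> by (auto simp: p_def)
      have "real Y powr p \<le> (4 * real t powr E) powr p" using Yb p by (intro powr_mono2) auto
      also have "\<dots> = 4 powr p * real t powr (E * p)" by (simp add: powr_mult powr_powr)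
      also have "\<dots> \<le> 4 powr 2 * real t powr ((6 - 2 * \<theta>) / (1 - \<theta>) * (1 - \<alpha>) + \<epsilon>)"
      proof (intro mult_mono powr_mono)
        have "E * p = 2 * E * (1 - \<alpha>) + 4 * \<eta> * E" by (simp add: p_def algebra_simps)
        \<comment> \<open>The lengths \<open>N\<close> and \<open>X\<close> give
          \<open>6 - 3 \<theta>\<close>; passing to \<open>6 - 2 \<theta>\<close> is a weakening, as
          \<open>\<theta> > 0\<close> and \<open>\<alpha> \<le> 1\<close>.\<close>
        also have "2 * E = (6 - 3 * \<theta>) / (1 - \<theta>)" using \<theta> by (simp add: E_def a_def field_simps)
        also have "(6 - 3 * \<theta>) / (1 - \<theta>) * (1 - \<alpha>) \<le> (6 - 2 * \<theta>) / (1 - \<theta>) * (1 - \<alpha>)"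
          using \<theta> \<alpha> by (intro mult_right_mono divide_right_mono) auto
        finally show "E * p \<le> (6 - 2 * \<theta>) / (1 - \<theta>) * (1 - \<alpha>) + \<epsilon>" using \<eta>E by linarith
      qed (use p t in auto)
      finally show "real Y powr (2 - 2 * \<alpha> + 4 * \<eta>) \<le> 16 * real t powr ((6 - 2 * \<theta>) / (1 - \<theta>) * (1 - \<alpha>) + \<epsilon>)"
        by (simp add: p_def)
    qed (use C1 C2 in auto)
    finally show ?thesis by (simp add: C_def mult_ac)
  qed
  moreover have "C \<ge> 0" using C1 C2 by (simp add: C_def)
  ultimately show ?thesis using that[of C] by blast
qed

text \<open>By \<open>xi_nonzero\<close> the zeros lie in a compact rectangle with right side at 1.
  The finiteness theorem there excludes constant functions; a constant \<open>xi\<close> would equal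
  \<kappa> and have no zeros.\<close>

lemma finite_zeros:
  assumes "\<alpha> > \<theta>"
  shows "finite {z. xi z = 0 \<and> \<alpha> \<le> Re z \<and> \<bar>Im z\<bar> \<le> T}"
proof (cases "xi constant_on {s. Re s > \<theta>}")
  case True
  then obtain c where c: "\<And>z. Re z > \<theta> \<Longrightarrow> xi z = c" by (auto simp: constant_on_def)
  hence "c \<noteq> 0" using xi_1 c[of 1] \<theta> \<kappa> by auto
  hence "{z. xi z = 0 \<and> \<alpha> \<le> Re z \<and> \<bar>Im z\<bar> \<le> T} = {}" using c assms by force
  thus ?thesis by (metis finite.emptyI)
next
  case False
  have "finite {z \<in> cbox (Complex \<alpha> (-T)) (Complex 1 T). xi z = 0}"
  proof (rule holomorphic_compact_finite_zeros[OF xi_holomorphic _ _ _ _ False])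
    show "open {s. Re s > \<theta>}" by (rule open_halfspace_Re_gt)
    show "connected {s. Re s > \<theta>}" by (intro convex_connected convex_halfspace_Re_gt)
    show "cbox (Complex \<alpha> (-T)) (Complex 1 T) \<subseteq> {s. Re s > \<theta>}" using assms by (auto simp: in_cbox_complex_iff)
  qed auto
  thus ?thesis
  proof (rule rev_finite_subset)
    show "{z. xi z = 0 \<and> \<alpha> \<le> Re z \<and> \<bar>Im z\<bar> \<le> T} \<subseteq> {z \<in> cbox (Complex \<alpha> (-T)) (Complex 1 T). xi z = 0}"
    proof
      fix z assume "z \<in> {z. xi z = 0 \<and> \<alpha> \<le> Re z \<and> \<bar>Im z\<bar> \<le> T}"
      hence z: "xi z = 0" "\<alpha> \<le> Re z" "\<bar>Im z\<bar> \<le> T" by auto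
      have "Re z \<le> 1" using z(1) xi_nonzero[of z] by (cases "Re z > 1") auto
      thus "z \<in> {z \<in> cbox (Complex \<alpha> (-T)) (Complex 1 T). xi z = 0}"
        using z by (auto simp: in_cbox_complex_iff)
    qed
  qed
qed

lemma zero_density:
  assumes \<epsilon>: "\<epsilon> > 0"
  obtains C where "C \<ge> 0"
    "\<And>T \<alpha>. T \<ge> 1 \<Longrightarrow> (1 + \<theta>) / 2 \<le> \<alpha> \<Longrightarrow> \<alpha> \<le> 1 \<Longrightarrow>
      (\<Sum>z | xi z = 0 \<and> \<alpha> \<le> Re z \<and> \<bar>Im z\<bar> \<le> T. real (nat (zorder xi z)))
        \<le> C * T powr ((6 - 2 * \<theta>) / (1 - \<theta>) * (1 - \<alpha>) + \<epsilon>)"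
proof -
  \<comment> \<open>One half of \<epsilon> goes to the number of strips, the other to the
    logarithmic number of zeros in each.\<close>
  define \<eta> where "\<eta> = \<epsilon> / 2"
  have \<eta>: "\<eta> > 0" using \<epsilon> by (simp add: \<eta>_def)
  obtain C1 where C1: "C1 \<ge> 0"
    "\<And>Z j. finite Z \<Longrightarrow> Z \<subseteq> {z. xi z = 0 \<and> (1 + \<theta>) / 2 \<le> Re z \<and> Re z \<le> 1 \<and> of_int j \<le> Im z \<and> Im z \<le> of_int j + 1}
      \<Longrightarrow> (\<Sum>z\<in>Z. real (nat (zorder xi z))) \<le> C1 * (2 + ln (1 + \<bar>of_int j\<bar>))"
    by (rule zero_count_box) (rule that)
  obtain C2 where C2: "C2 \<ge> 0"
    "\<And>t \<alpha> J s. t \<ge> 1 \<Longrightarrow> (1 + \<theta>) / 2 \<le> \<alpha> \<Longrightarrow> \<alpha> \<le> 1 \<Longrightarrow> J \<subseteq> {- int t..int t} - {-1, 0} \<Longrightarrow>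
      (\<forall>j\<in>J. xi (s j) = 0 \<and> \<alpha> \<le> Re (s j) \<and> Re (s j) \<le> 1 \<and> of_int j \<le> Im (s j) \<and> Im (s j) \<le> of_int j + 1)
      \<Longrightarrow> real (card J) \<le> C2 * real t powr ((6 - 2 * \<theta>) / (1 - \<theta>) * (1 - \<alpha>) + \<eta>)"
    by (rule selected_zeros_bound[OF \<eta>]) (rule that)
  define P where "P = (6 - 2 * \<theta>) / (1 - \<theta>)"
  have P: "P \<ge> 0" using \<theta> by (simp add: P_def)
  define C3 where "C3 = 2 + 1 / \<eta>"
  have C3: "C3 \<ge> 0" using \<eta> by (simp add: C3_def)
  define C where "C = (C2 + 2) * (C1 * C3) * 4 powr (P + \<epsilon>)"
  have "(\<Sum>z | xi z = 0 \<and> \<alpha> \<le> Re z \<and> \<bar>Im z\<bar> \<le> T. real (nat (zorder xi z)))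
        \<le> C * T powr (P * (1 - \<alpha>) + \<epsilon>)" if T: "T \<ge> 1" and \<alpha>: "(1 + \<theta>) / 2 \<le> \<alpha>" "\<alpha> \<le> 1" for T \<alpha>
  proof -
    define Z where "Z = {z. xi z = 0 \<and> \<alpha> \<le> Re z \<and> \<bar>Im z\<bar> \<le> T}"
    have "\<alpha> > \<theta>" using \<alpha>(1) \<theta> by (simp add: field_simps)
    hence finZ: "finite Z" unfolding Z_def by (rule finite_zeros)
    have Re1: "Re z \<le> 1" if "z \<in> Z" for z
      using that xi_nonzero[of z] by (cases "Re z > 1") (auto simp: Z_def)
    \<comment> \<open>The extra 1 makes room for the floor, which can reach down to
      \<open>- T - 1\<close>. As \<open>T \<ge> 1\<close>,
      \<open>1 + t \<le> T + 3 \<le> 4 T\<close>.\<close>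
    define t where "t = nat \<lceil>T\<rceil> + 1"
    have t: "t \<ge> 1" "real t \<ge> T + 1" "1 + real t \<le> 4 * T" using T unfolding t_def by linarith+
    define J where "J = (\<lambda>z. \<lfloor>Im z\<rfloor>) ` Z"
    have finJ: "finite J" using finZ by (simp add: J_def)
    have Jt: "J \<subseteq> {- int t..int t}"
    proof
      fix j assume "j \<in> J"
      then obtain z where z: "z \<in> Z" "j = \<lfloor>Im z\<rfloor>" by (auto simp: J_def)
      have "\<bar>Im z\<bar> \<le> T" using z by (simp add: Z_def)
      hence "real_of_int j \<le> real t" "- real t \<le> real_of_int j"
        using t(2) floor_correct[of "Im z"] unfolding z(2) by linarith+
      thus "j \<in> {- int t..int t}" unfolding atLeastAtMost_iff by linarith
    qed
    define s where "s j = (SOME z. z \<in> Z \<and> \<lfloor>Im z\<rfloor> = j)" for j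
    have s: "s j \<in> Z \<and> \<lfloor>Im (s j)\<rfloor> = j" if "j \<in> J" for j
      unfolding s_def by (rule someI_ex) (use that in \<open>auto simp: J_def\<close>)
    define p where "p = P * (1 - \<alpha>)"
    have p: "0 \<le> p" "p \<le> P" using P \<alpha> \<theta> mult_left_mono[of "1 - \<alpha>" 1 P] by (auto simp: p_def)
    have cardJ: "real (card J) \<le> (C2 + 2) * real t powr (p + \<eta>)"
    proof -
      have "real (card (J - {-1, 0})) \<le> C2 * real t powr (p + \<eta>)"
        unfolding p_def P_def
      proof (rule C2(2)[OF t(1) \<alpha>])
        show "\<forall>j\<in>J - {-1, 0}. xi (s j) = 0 \<and> \<alpha> \<le> Re (s j) \<and> Re (s j) \<le> 1 \<and> of_int j \<le> Im (s j) \<and> Im (s j) \<le> of_int j + 1"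
        proof
          fix j assume "j \<in> J - {-1, 0}"
          hence sj: "s j \<in> Z" "\<lfloor>Im (s j)\<rfloor> = j" using s by auto
          have "of_int j \<le> Im (s j)" "Im (s j) \<le> of_int j + 1"
            using floor_correct[of "Im (s j)", unfolded sj(2)] by linarith+
          thus "xi (s j) = 0 \<and> \<alpha> \<le> Re (s j) \<and> Re (s j) \<le> 1 \<and> of_int j \<le> Im (s j) \<and> Im (s j) \<le> of_int j + 1"
            using sj(1) Re1[OF sj(1)] by (simp add: Z_def)
        qed
      qed (use Jt in auto)
      \<comment> \<open>The two strips at the real axis return here; their cost is the 2 in
        \<open>C2 + 2\<close>.\<close>
      moreover have "card J \<le> card (J - {-1, 0}) + 2"
        using diff_card_le_card_Diff[of "{-1, 0}" J] by simp
      moreover have "1 \<le> real t powr (p + \<eta>)" using t p \<eta> by (intro ge_one_powr_ge_zero) auto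
      ultimately show ?thesis by (simp add: algebra_simps)
    qed
    have "(\<Sum>z\<in>Z. real (nat (zorder xi z))) = (\<Sum>j\<in>J. \<Sum>z\<in>{z\<in>Z. \<lfloor>Im z\<rfloor> = j}. real (nat (zorder xi z)))"
      using finZ finJ by (intro sum.group[symmetric]) (auto simp: J_def)
    also have "\<dots> \<le> (\<Sum>j\<in>J. C1 * (C3 * (1 + real t) powr \<eta>))"
    proof (rule sum_mono)
      fix j assume j: "j \<in> J"
      have "(\<Sum>z\<in>{z\<in>Z. \<lfloor>Im z\<rfloor> = j}. real (nat (zorder xi z))) \<le> C1 * (2 + ln (1 + \<bar>of_int j\<bar>))"
      proof (rule C1(2))
        show "{z\<in>Z. \<lfloor>Im z\<rfloor> = j} \<subseteq> {z. xi z = 0 \<and> (1 + \<theta>) / 2 \<le> Re z \<and> Re z \<le> 1 \<and> of_int j \<le> Im z \<and> Im z \<le> of_int j + 1}"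
        proof clarify
          fix z assume z: "z \<in> Z"
          have "of_int \<lfloor>Im z\<rfloor> \<le> Im z" "Im z \<le> of_int \<lfloor>Im z\<rfloor> + 1"
            using floor_correct[of "Im z"] by linarith+
          thus "xi z = 0 \<and> (1 + \<theta>) / 2 \<le> Re z \<and> Re z \<le> 1 \<and> of_int \<lfloor>Im z\<rfloor> \<le> Im z \<and> Im z \<le> of_int \<lfloor>Im z\<rfloor> + 1"
            using z Re1[OF z] \<alpha> by (auto simp: Z_def)
        qed
      qed (use finZ in auto)
      also have "\<dots> \<le> C1 * (2 + ln (1 + real t))"
      proof -
        have "- int t \<le> j" "j \<le> int t" using Jt j by auto
        hence "\<bar>real_of_int j\<bar> \<le> real t" by linarith
        thus ?thesis using C1(1) by (intro mult_left_mono) auto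
      qed
      also have "\<dots> \<le> C1 * (C3 * (1 + real t) powr \<eta>)"
        unfolding C3_def using C1(1) \<eta> by (intro mult_left_mono two_plus_ln_le_powr) auto
      finally show "(\<Sum>z\<in>{z\<in>Z. \<lfloor>Im z\<rfloor> = j}. real (nat (zorder xi z))) \<le> C1 * (C3 * (1 + real t) powr \<eta>)" .
    qed
    also have "\<dots> = real (card J) * (C1 * (C3 * (1 + real t) powr \<eta>))" by simp
    also have "\<dots> \<le> ((C2 + 2) * (4 * T) powr (p + \<eta>)) * (C1 * (C3 * (4 * T) powr \<eta>))"
    proof (intro mult_mono)
      have "real t powr (p + \<eta>) \<le> (4 * T) powr (p + \<eta>)" using t p \<eta> by (intro powr_mono2) auto
      thus "real (card J) \<le> (C2 + 2) * (4 * T) powr (p + \<eta>)"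
        using C2(1) by (intro order_trans[OF cardJ] mult_left_mono) auto
      show "(1 + real t) powr \<eta> \<le> (4 * T) powr \<eta>" using t \<eta> by (intro powr_mono2) auto
    qed (use C1 C2 C3 in auto)
    also have "\<dots> = (C2 + 2) * (C1 * C3) * ((4 * T) powr (p + \<eta>) * (4 * T) powr \<eta>)" by (simp add: mult_ac)
    also have "(4 * T) powr (p + \<eta>) * (4 * T) powr \<eta> = (4 * T) powr (p + \<epsilon>)"
      by (subst powr_add[symmetric]) (simp add: \<eta>_def add.commute)
    also have "\<dots> = 4 powr (p + \<epsilon>) * T powr (p + \<epsilon>)" by (simp add: powr_mult)
    also have "(C2 + 2) * (C1 * C3) * (4 powr (p + \<epsilon>) * T powr (p + \<epsilon>)) \<le> (C2 + 2) * (C1 * C3) * (4 powr (P + \<epsilon>) * T powr (p + \<epsilon>))"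
      using C1(1) C2(1) C3 p by (intro mult_left_mono mult_right_mono powr_mono) auto
    finally show ?thesis by (simp add: C_def p_def Z_def mult_ac)
  qed
  moreover have "C \<ge> 0" using C1(1) C2(1) C3 by (simp add: C_def)
  ultimately show ?thesis using that[of C] unfolding P_def by simp
qed

end

section \<open>Arithmetical semigroups\<close>

text \<open>A submultiset is determined by its multiplicities on the support of \<open>M\<close>,
  and each multiplicity of \<open>p\<close> lies between 0 and \<open>count M p\<close>.\<close>

lemma submultisets:
  fixes M :: "'a multiset"
  shows finite_submultisets: "finite {A. A \<subseteq># M}"
    and card_submultisets_le: "card {A. A \<subseteq># M} \<le> (\<Prod>p\<in>set_mset M. count M p + 1)"
proof -
  define F where "F A = restrict (count A) (set_mset M)" for A :: "'a multiset"
  define T where "T = (\<Pi>\<^sub>E p\<in>set_mset M. {..count M p})"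
  have inj: "inj_on F {A. A \<subseteq># M}"
  proof (rule inj_onI)
    fix A B assume AB: "A \<in> {A. A \<subseteq># M}" "B \<in> {A. A \<subseteq># M}" "F A = F B"
    show "A = B"
    proof (rule multiset_eqI)
      fix p
      show "count A p = count B p"
      proof (cases "p \<in># M")
        case True
        thus ?thesis using fun_cong[OF AB(3), of p] by (simp add: F_def)
      next
        case False
        hence "p \<notin># A" "p \<notin># B" using AB by (auto dest: mset_subset_eqD)
        thus ?thesis by (simp add: not_in_iff)
      qed
    qed
  qed
  have sub: "F ` {A. A \<subseteq># M} \<subseteq> T"
    by (auto simp: F_def T_def subseteq_mset_def)
  have fin: "finite T" unfolding T_def by (intro finite_PiE) auto
  show "finite {A. A \<subseteq># M}" using inj_on_finite[OF inj sub fin] .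
  have "card {A. A \<subseteq># M} \<le> card T" using card_inj_on_le[OF inj sub fin] .
  thus "card {A. A \<subseteq># M} \<le> (\<Prod>p\<in>set_mset M. count M p + 1)" by (simp add: T_def card_PiE)
qed

context arithmetical_semigroup
begin

definition factors :: "'a \<Rightarrow> 'a multiset" where
  "factors g = (THE M. set_mset M \<subseteq> P \<and> prod_mset M = g)"

lemma factors: "set_mset (factors g) \<subseteq> P" "prod_mset (factors g) = g"
  using theI'[OF unique_factorization[of g]] by (auto simp: factors_def)

lemma factors_eqI: "set_mset M \<subseteq> P \<Longrightarrow> prod_mset M = g \<Longrightarrow> factors g = M"
  unfolding factors_def by (rule the1_equality[OF unique_factorization]) simp

lemma factors_mult: "factors (g * h) = factors g + factors h"
  using factors[of g] factors[of h] by (intro factors_eqI) auto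

lemma factors_eq_empty_iff: "factors g = {#} \<longleftrightarrow> g = 1"
  using factors(2)[of g] factors_eqI[of "{#}" 1] by auto

lemma nrm_1: "nrm 1 = 1"
  using nrm_mult[of 1 1] nrm_pos[of 1] by simp

lemma nrm_power: "nrm (g ^ k) = nrm g ^ k"
  by (induction k) (simp_all add: nrm_1 nrm_mult)

lemma nrm_prod: "nrm (prod f S) = (\<Prod>x\<in>S. nrm (f x))"
  by (induction S rule: infinite_finite_induct) (simp_all add: nrm_1 nrm_mult)

lemma nrm_factors: "nrm g = (\<Prod>p\<in>set_mset (factors g). nrm p ^ count (factors g) p)"
proof -
  have "nrm g = nrm (\<Prod>p\<in>set_mset (factors g). p ^ count (factors g) p)"
    using factors(2)[of g] by (simp add: prod_mset_multiplicity)
  thus ?thesis by (simp add: nrm_prod nrm_power)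
qed

lemma finite_nrm_eq: "finite {g. nrm g = x}"
  using finite_nrm_interval[of x x] by (simp add: order_eq_iff conj_commute)

lemma finite_nrm_le: "finite {g. nrm g \<le> x}"
proof -
  have "{g. nrm g \<le> x} = {g. 0 \<le> nrm g \<and> nrm g \<le> x}" using nrm_pos by (auto intro: less_imp_le)
  thus ?thesis using finite_nrm_interval by simp
qed

text \<open>A prime of norm 1 would have infinitely many distinct powers of norm 1.\<close>

lemma nrm_prime_ne_1:
  assumes "p \<in> P"
  shows "nrm p \<noteq> 1"
proof
  assume 1: "nrm p = 1"
  have f: "factors (p ^ k) = replicate_mset k p" for k
    using assms by (intro factors_eqI) (auto simp: in_replicate_mset)
  have "inj (\<lambda>k::nat. p ^ k)"
  proof (rule injI)
    fix j k :: nat assume "p ^ j = p ^ k"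
    hence "replicate_mset j p = replicate_mset k p" using f[of j] f[of k] by simp
    hence "size (replicate_mset j p) = size (replicate_mset k p)" by simp
    thus "j = k" by simp
  qed
  hence "infinite (range (\<lambda>k::nat. p ^ k))" by (simp add: finite_image_iff)
  moreover have "range (\<lambda>k::nat. p ^ k) \<subseteq> {g. nrm g = 1}" using 1 by (auto simp: nrm_power)
  ultimately show False using finite_nrm_eq finite_subset by blast
qed

definition mu :: "'a \<Rightarrow> real" where
  "mu g = (if \<forall>p. count (factors g) p \<le> 1 then (- 1) ^ size (factors g) else 0)"

lemma abs_mu_le_1: "\<bar>mu g\<bar> \<le> 1"
  by (simp add: mu_def power_abs)

text \<open>Divisors of \<open>g\<close> correspond to submultisets of \<open>factors g\<close>.
  Only the multiplicity-free ones contribute, and these are the subsets of the set of primes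
  dividing \<open>g\<close>; a nonempty finite set has as many subsets of even as of odd
  size.\<close>

lemma sum_mu_divisors:
  "(\<Sum>A | A \<subseteq># factors g. mu (prod_mset A)) = (if g = 1 then 1 else 0)"
proof -
  define M where "M = factors g"
  define mu' :: "'a multiset \<Rightarrow> real" where
    "mu' A = (if \<forall>p. count A p \<le> 1 then (- 1) ^ size A else 0)" for A
  have "(\<Sum>A | A \<subseteq># M. mu (prod_mset A)) = (\<Sum>A | A \<subseteq># M. mu' A)"
  proof (rule sum.cong[OF refl])
    fix A assume "A \<in> {A. A \<subseteq># M}"
    hence "set_mset A \<subseteq> P" using factors(1)[of g] set_mset_mono[of A M] by (auto simp: M_def)
    thus "mu (prod_mset A) = mu' A" using factors_eqI[of A] by (simp add: mu_def mu'_def)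
  qed
  also have "\<dots> = (\<Sum>A\<in>mset_set ` Pow (set_mset M). mu' A)"
  proof (rule sum.mono_neutral_right[OF finite_submultisets])
    show "mset_set ` Pow (set_mset M) \<subseteq> {A. A \<subseteq># M}"
    proof clarify
      fix S assume S: "S \<subseteq> set_mset M"
      hence "finite S" using finite_subset by blast
      thus "mset_set S \<subseteq># M" using S by (auto simp: subseteq_mset_def count_mset_set' Suc_le_eq)
    qed
    show "\<forall>A\<in>{A. A \<subseteq># M} - mset_set ` Pow (set_mset M). mu' A = 0"
    proof
      fix A assume A: "A \<in> {A. A \<subseteq># M} - mset_set ` Pow (set_mset M)"
      have "\<not> (\<forall>p. count A p \<le> 1)"
      proof
        assume c: "\<forall>p. count A p \<le> 1"
        have "A = mset_set (set_mset A)"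
        proof (rule multiset_eqI)
          fix p
          show "count A p = count (mset_set (set_mset A)) p"
            using c[rule_format, of p] count_greater_zero_iff[of A p]
            by (auto simp: count_mset_set' not_in_iff simp del: count_greater_zero_iff)
        qed
        moreover have "set_mset A \<in> Pow (set_mset M)" using A by (auto dest: set_mset_mono)
        ultimately show False using A by blast
      qed
      thus "mu' A = 0" by (auto simp: mu'_def)
    qed
  qed
  also have "\<dots> = (\<Sum>S\<in>Pow (set_mset M). mu' (mset_set S))"
  proof (subst sum.reindex)
    show "inj_on mset_set (Pow (set_mset M))"
    proof (rule inj_onI)
      fix S S' assume S: "S \<in> Pow (set_mset M)" "S' \<in> Pow (set_mset M)" "mset_set S = mset_set S'"
      have "finite S" "finite S'" using S finite_subset by auto
      thus "S = S'" using arg_cong[OF S(3), of set_mset] by simp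
    qed
  qed simp
  also have "\<dots> = (\<Sum>S\<in>Pow (set_mset M). (- 1) ^ card S)"
  proof (rule sum.cong[OF refl])
    fix S assume "S \<in> Pow (set_mset M)"
    hence "finite S" using finite_subset by blast
    thus "mu' (mset_set S) = (- 1) ^ card S" by (auto simp: mu'_def count_mset_set')
  qed
  also have "\<dots> = (if g = 1 then 1 else 0)"
  proof (cases "g = 1")
    case True
    hence "M = {#}" by (simp add: M_def factors_eq_empty_iff)
    thus ?thesis using True by simp
  next
    case False
    hence "set_mset M \<noteq> {}" by (simp add: M_def factors_eq_empty_iff)
    hence "{} \<subset> set_mset M" by blast
    from card_subsupersets_even_odd[OF finite_set_mset this]
    have "(\<Sum>S\<in>Pow (set_mset M). (- 1) ^ card S) = (0::real)"
      by (intro sum_alternating_cancels) auto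
    thus ?thesis using False by simp
  qed
  finally show ?thesis by (simp add: M_def)
qed

end

section \<open>Integer norms and the coefficient sequences \<open>G\<close> and
  \<open>m\<close>\<close>

locale integral_semigroup = arithmetical_semigroup +
  assumes condition_B: "condition_B nrm"
begin

definition nnorm :: "'a \<Rightarrow> nat" where
  "nnorm g = nat \<lfloor>nrm g\<rfloor>"

lemma of_nat_nnorm: "real (nnorm g) = nrm g"
proof -
  have "nrm g \<in> \<nat>" using condition_B by (simp add: condition_B_def)
  then obtain n where "nrm g = of_nat n" by (rule Nats_cases)
  thus ?thesis by (simp add: nnorm_def)
qed

lemma nrm_eq_iff: "nrm g = real n \<longleftrightarrow> nnorm g = n"
  by (metis of_nat_nnorm of_nat_eq_iff)

lemma nrm_le_iff: "nrm g \<le> real n \<longleftrightarrow> nnorm g \<le> n"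
  by (metis of_nat_nnorm of_nat_le_iff)

lemma nnorm_pos: "nnorm g \<ge> 1"
proof -
  have "0 < real (nnorm g)" by (simp only: of_nat_nnorm nrm_pos)
  thus ?thesis by simp
qed

lemma nnorm_mult: "nnorm (g * h) = nnorm g * nnorm h"
proof -
  have "real (nnorm (g * h)) = real (nnorm g * nnorm h)"
    by (simp only: of_nat_mult of_nat_nnorm nrm_mult)
  thus ?thesis by (simp only: of_nat_eq_iff)
qed

lemma nrm_prime_ge_2:
  assumes "p \<in> P"
  shows "nrm p \<ge> 2"
proof -
  have "nnorm p \<noteq> 1" using nrm_prime_ne_1[OF assms] nrm_eq_iff[of p 1] by simp
  hence "real (nnorm p) \<ge> 2" using nnorm_pos[of p] by simp
  thus ?thesis by (simp only: of_nat_nnorm)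
qed

definition level :: "nat \<Rightarrow> 'a set" where
  "level n = {g. nnorm g = n}"

definition G :: "nat \<Rightarrow> real" where
  "G n = real (card (level n))"

definition m :: "nat \<Rightarrow> real" where
  "m n = (\<Sum>g\<in>level n. mu g)"

lemma finite_level: "finite (level n)"
  using finite_nrm_eq[of "real n"] by (simp add: level_def nrm_eq_iff)

lemma level_1: "level 1 = {1}"
proof
  show "level 1 \<subseteq> {1}"
  proof
    fix g assume "g \<in> level 1"
    hence g: "nnorm g = 1" by (simp add: level_def)
    have "factors g = {#}"
    proof (rule ccontr)
      assume "factors g \<noteq> {#}"
      then obtain p where p: "p \<in># factors g" by (rule multiset_nonemptyE)
      obtain N where N: "factors g = add_mset p N" using multi_member_split[OF p] by (rule exE)
      have "prod_mset (factors g) = p * prod_mset N" unfolding N by simp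
      hence "nnorm (p * prod_mset N) = 1" using g by (simp only: factors(2))
      hence "nnorm p = 1" by (simp add: nnorm_mult)
      hence "nrm p = 1" using nrm_eq_iff[of p 1] by simp
      moreover have "p \<in> P" using factors(1)[of g] p by auto
      ultimately show False using nrm_prime_ne_1 by simp
    qed
    thus "g \<in> {1}" by (simp add: factors_eq_empty_iff)
  qed
  have "nnorm 1 = 1" using nrm_1 by (simp add: nnorm_def)
  thus "{1} \<subseteq> level 1" by (simp add: level_def)
qed

lemma sum_level: "(\<Sum>n=1..N. \<Sum>g\<in>level n. f g) = (\<Sum>g | nrm g \<le> real N. f g)"
proof -
  have "(\<Sum>g | nrm g \<le> real N. f g) = (\<Sum>n=1..N. \<Sum>g\<in>{g \<in> {g. nrm g \<le> real N}. nnorm g = n}. f g)"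
    using nnorm_pos by (intro sum.group[symmetric] finite_nrm_le) (auto simp: nrm_le_iff)
  also have "\<dots> = (\<Sum>n=1..N. \<Sum>g\<in>level n. f g)"
    by (intro sum.cong refl) (auto simp: level_def nrm_le_iff)
  finally show ?thesis ..
qed

text \<open>Both sides sum \<open>f h\<close> over the pairs \<open>(h, k)\<close> with norms
  multiplying to \<open>n\<close>, grouped on the left by the norm of \<open>h\<close> and on the
  right by the product \<open>h * k\<close>. With \<open>f = mu\<close> this yields the inversion
  formula, with \<open>f = 1\<close> the divisor count.\<close>

lemma dirichlet_convolution_level:
  assumes n: "n \<ge> 1"
  shows "(\<Sum>d | d dvd n. (\<Sum>h\<in>level d. f h) * G (n div d))
    = (\<Sum>g\<in>level n. \<Sum>A | A \<subseteq># factors g. f (prod_mset A))"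
proof -
  define S where "S = {(h, k). nnorm h * nnorm k = n}"
  have lev: "{p\<in>S. nnorm (fst p) = d} = level d \<times> level (n div d)" if "d dvd n" for d
  proof -
    have "d > 0" using that n by (auto intro: gr0I)
    thus ?thesis using that by (auto simp: S_def level_def)
  qed
  have S_dvd: "nnorm (fst p) dvd n" if "p \<in> S" for p using that by (auto simp: S_def)
  have finS: "finite S"
  proof -
    have "S \<subseteq> (\<Union>d\<in>{d. d dvd n}. level d \<times> level (n div d))"
    proof
      fix p assume p: "p \<in> S"
      have "p \<in> {q\<in>S. nnorm (fst q) = nnorm (fst p)}" using p by simp
      thus "p \<in> (\<Union>d\<in>{d. d dvd n}. level d \<times> level (n div d))"
        unfolding lev[OF S_dvd[OF p]] using S_dvd[OF p] by blast
    qed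
    moreover have "finite {d. d dvd n}" using n by simp
    ultimately show ?thesis using finite_level by (auto intro: finite_subset)
  qed
  have "(\<Sum>p\<in>S. f (fst p)) = (\<Sum>d | d dvd n. \<Sum>p\<in>{p\<in>S. nnorm (fst p) = d}. f (fst p))"
    using n finS S_dvd by (intro sum.group[symmetric]) auto
  also have "\<dots> = (\<Sum>d | d dvd n. (\<Sum>h\<in>level d. f h) * G (n div d))"
  proof (rule sum.cong[OF refl])
    fix d assume "d \<in> {d. d dvd n}"
    hence "(\<Sum>p\<in>{p\<in>S. nnorm (fst p) = d}. f (fst p)) = (\<Sum>h\<in>level d. \<Sum>k\<in>level (n div d). f h)"
      by (simp add: lev sum.cartesian_product case_prod_beta del: sum_constant)
    also have "\<dots> = (\<Sum>h\<in>level d. f h) * G (n div d)"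
      by (simp add: G_def sum_distrib_right mult.commute)
    finally show "(\<Sum>p\<in>{p\<in>S. nnorm (fst p) = d}. f (fst p)) = (\<Sum>h\<in>level d. f h) * G (n div d)" .
  qed
  finally have 1: "(\<Sum>p\<in>S. f (fst p)) = (\<Sum>d | d dvd n. (\<Sum>h\<in>level d. f h) * G (n div d))" .
  have "(\<Sum>p\<in>S. f (fst p)) = (\<Sum>g\<in>level n. \<Sum>p\<in>{p\<in>S. fst p * snd p = g}. f (fst p))"
    using finS finite_level by (intro sum.group[symmetric]) (auto simp: S_def level_def nnorm_mult)
  also have "\<dots> = (\<Sum>g\<in>level n. \<Sum>A | A \<subseteq># factors g. f (prod_mset A))"
  proof (rule sum.cong[OF refl])
    fix g assume g: "g \<in> level n"
    show "(\<Sum>p\<in>{p\<in>S. fst p * snd p = g}. f (fst p)) = (\<Sum>A | A \<subseteq># factors g. f (prod_mset A))"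
    proof (rule sum.reindex_bij_witness[of _ "\<lambda>A. (prod_mset A, prod_mset (factors g - A))" "\<lambda>p. factors (fst p)"])
      fix p assume "p \<in> {p\<in>S. fst p * snd p = g}"
      then obtain h k where p: "p = (h, k)" "g = h * k" by (cases p) auto
      show "(prod_mset (factors (fst p)), prod_mset (factors g - factors (fst p))) = p"
        "factors (fst p) \<in> {A. A \<subseteq># factors g}" "f (prod_mset (factors (fst p))) = f (fst p)"
        by (auto simp: p factors_mult factors)
    next
      fix A assume A: "A \<in> {A. A \<subseteq># factors g}"
      have "set_mset A \<subseteq> P" using A factors(1)[of g] by (auto dest: set_mset_mono)
      thus "factors (fst (prod_mset A, prod_mset (factors g - A))) = A" by (auto intro: factors_eqI)
      have "prod_mset A * prod_mset (factors g - A) = g"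
      proof -
        have "prod_mset (A + (factors g - A)) = g" using A factors(2)[of g] by simp
        thus ?thesis by (simp only: prod_mset_Un)
      qed
      thus "(prod_mset A, prod_mset (factors g - A)) \<in> {p\<in>S. fst p * snd p = g}"
        using g by (auto simp: S_def level_def nnorm_mult[symmetric])
    qed
  qed
  finally show ?thesis using 1 by simp
qed

text \<open>The classical divisor bound, prime by prime: a prime of multiplicity \<open>k\<close>
  contributes \<open>k + 1\<close> divisors. If \<open>nrm p powr \<eta> \<ge> 2\<close> this is at
  most \<open>2 ^ k\<close> and needs no constant; the finitely many smaller primes contribute at
  most a factor \<open>c\<close> each.\<close>

lemma card_divisors_le:
  assumes \<eta>: "\<eta> > 0"
  obtains K where "\<And>g. real (card {A. A \<subseteq># factors g}) \<le> K * nrm g powr \<eta>"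
proof -
  \<comment> \<open>For a small prime \<open>nrm p powr (\<eta> k) \<ge> 2 powr (\<eta> k) = exp (k
    x) \<ge> 1 + k x\<close>, and \<open>c = 1 + 1 / x\<close> is chosen so that
    \<open>c (1 + k x) \<ge> k + 1\<close>.\<close>
  define x where "x = \<eta> * ln 2"
  have x: "x > 0" using \<eta> by (simp add: x_def)
  define c where "c = 1 + 1 / x"
  have c: "c \<ge> 1" using x by (simp add: c_def)
  define B :: real where "B = 2 powr (1 / \<eta>)"
  define Q where "Q = {g. nrm g \<le> B}"
  have finQ: "finite Q" unfolding Q_def by (rule finite_nrm_le)
  define w where "w p = (if p \<in> Q then c else 1)" for p
  have local_bound: "real (k + 1) \<le> w p * (nrm p ^ k) powr \<eta>" if "p \<in> P" for p k
  proof -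
    have p2: "nrm p \<ge> 2" using nrm_prime_ge_2 that .
    have eq: "(nrm p ^ k) powr \<eta> = (nrm p powr \<eta>) ^ k"
      by (induction k) (use p2 in \<open>simp_all add: powr_mult\<close>)
    show ?thesis
    proof (cases "p \<in> Q")
      case True
      have "real (k + 1) \<le> c * (1 + real k * x)"
        using x by (simp add: c_def field_simps)
      also have "\<dots> \<le> c * exp (real k * x)" using c exp_ge_add_one_self[of "real k * x"] by (intro mult_left_mono) auto
      also have "exp (real k * x) = (2 powr \<eta>) ^ k" by (simp add: x_def powr_def exp_of_nat_mult[symmetric])
      also have "c * (2 powr \<eta>) ^ k \<le> c * (nrm p powr \<eta>) ^ k"
        using c p2 \<eta> by (intro mult_left_mono power_mono powr_mono2) auto
      finally show ?thesis using True by (simp add: w_def eq)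
    next
      case False
      have "2 = B powr \<eta>" using \<eta> by (simp add: B_def powr_powr)
      also have "\<dots> \<le> nrm p powr \<eta>"
        using False \<eta> by (intro powr_mono2) (auto simp: Q_def B_def)
      finally have "2 ^ k \<le> (nrm p powr \<eta>) ^ k" by (intro power_mono) auto
      moreover have "real (k + 1) \<le> 2 ^ k" by (induction k) auto
      ultimately have "real (k + 1) \<le> (nrm p powr \<eta>) ^ k" by linarith
      thus ?thesis using False by (simp add: w_def eq)
    qed
  qed
  have "real (card {A. A \<subseteq># factors g}) \<le> c ^ card Q * nrm g powr \<eta>" for g
  proof -
    define M where "M = factors g"
    have "real (card {A. A \<subseteq># M}) \<le> real (\<Prod>p\<in>set_mset M. count M p + 1)"
      using card_submultisets_le[of M] by linarith
    also have "\<dots> = (\<Prod>p\<in>set_mset M. real (count M p + 1))" by (rule of_nat_prod)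
    also have "\<dots> \<le> (\<Prod>p\<in>set_mset M. w p * (nrm p ^ count M p) powr \<eta>)"
      using factors(1)[of g] local_bound by (intro prod_mono) (auto simp: M_def)
    also have "\<dots> = (\<Prod>p\<in>set_mset M. w p) * (\<Prod>p\<in>set_mset M. (nrm p ^ count M p) powr \<eta>)"
      by (rule prod.distrib)
    also have "(\<Prod>p\<in>set_mset M. (nrm p ^ count M p) powr \<eta>) = nrm g powr \<eta>"
      unfolding nrm_factors[of g] M_def
      by (rule prod_powr_distrib[symmetric])
    also have "(\<Prod>p\<in>set_mset M. w p) = (\<Prod>p\<in>set_mset M \<inter> Q. c)"
      unfolding w_def by (rule prod.inter_restrict[symmetric]) simp
    also have "\<dots> = c ^ card (set_mset M \<inter> Q)" by simp
    also have "c ^ card (set_mset M \<inter> Q) * nrm g powr \<eta> \<le> c ^ card Q * nrm g powr \<eta>"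
      using c finQ by (intro mult_right_mono power_increasing card_mono) auto
    finally show ?thesis by (simp add: M_def)
  qed
  thus ?thesis using that by blast
qed

text \<open>Each norm \<open>n\<close> is attained by \<open>G n\<close> elements, so the sum of
  squares equals the sum of \<open>G (nnorm g)\<close> over the elements \<open>g\<close> of norm at
  most \<open>N\<close>. There \<open>G (nnorm g) \<ge> 1\<close>, since \<open>g\<close> itself is
  counted, and the first power is at most the \<open>p\<close>-th power for
  \<open>p > 1\<close>.\<close>

lemma G_square_sum_le:
  assumes condG: "condition_G nrm" and \<eta>: "\<eta> > 0"
  shows "\<exists>K. \<forall>N\<ge>1. (\<Sum>n=1..N. (G n)\<^sup>2) \<le> K * real N powr (1 + \<eta>)"
proof -
  obtain p where p: "p > 1" "(\<lambda>X. ln (F_mean nrm p X)) \<in> o[at_top](\<lambda>X. ln X)"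
    using condG unfolding condition_G_def by blast
  have mult: "real (nrm_multiplicity nrm (nrm g)) = G (nnorm g)" for g
    by (simp add: nrm_multiplicity_def G_def level_def nrm_eq_iff flip: of_nat_nnorm[of g])
  have G1: "G (nnorm g) \<ge> 1" for g
  proof -
    have "g \<in> level (nnorm g)" by (simp add: level_def)
    hence "card (level (nnorm g)) > 0" using finite_level card_gt_0_iff by blast
    thus ?thesis by (simp add: G_def Suc_le_eq)
  qed
  define V where "V N = (\<Sum>n=1..N. (G n)\<^sup>2)" for N
  have V_le: "V N \<le> F_mean nrm p (real N) * real N" and F_pos: "F_mean nrm p (real N) > 0" if N: "N \<ge> 1" for N
  proof -
    have "V N = (\<Sum>n=1..N. \<Sum>g\<in>level n. G (nnorm g))"
      unfolding V_def by (intro sum.cong refl) (simp add: level_def G_def power2_eq_square)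
    also have "\<dots> = (\<Sum>g | nrm g \<le> real N. G (nnorm g))" by (rule sum_level)
    also have "\<dots> \<le> (\<Sum>g | nrm g \<le> real N. G (nnorm g) powr p)"
    proof (rule sum_mono)
      fix g
      have "G (nnorm g) powr 1 \<le> G (nnorm g) powr p" using p G1 by (intro powr_mono) auto
      thus "G (nnorm g) \<le> G (nnorm g) powr p" using G1[of g] by simp
    qed
    also have "\<dots> = F_mean nrm p (real N) * real N" using N by (simp add: F_mean_def mult)
    finally show V: "V N \<le> F_mean nrm p (real N) * real N" .
    \<comment> \<open>Positivity of \<open>F_mean\<close> matters: only then does
      \<open>exp (ln F)\<close> give back \<open>F\<close> when the bound on the logarithm is
      exponentiated.\<close>
    have "1 \<le> V N"
    proof -
      have "G 1 = 1" using level_1 by (simp add: G_def)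
      hence "(\<Sum>n\<in>{1}. (G n)\<^sup>2) = 1" by simp
      moreover have "(\<Sum>n\<in>{1}. (G n)\<^sup>2) \<le> V N" unfolding V_def using N by (intro sum_mono2) auto
      ultimately show ?thesis by simp
    qed
    hence "F_mean nrm p (real N) * real N > 0" using V by linarith
    thus "F_mean nrm p (real N) > 0" using N by (simp add: zero_less_mult_iff)
  qed
  have "\<forall>\<^sub>F X in at_top. norm (ln (F_mean nrm p X)) \<le> \<eta> * norm (ln X)"
    using landau_o.smallD[OF p(2) \<eta>] .
  then obtain X0 where X0: "\<And>X. X \<ge> X0 \<Longrightarrow> \<bar>ln (F_mean nrm p X)\<bar> \<le> \<eta> * \<bar>ln X\<bar>"
    by (auto simp: eventually_at_top_linorder)
  \<comment> \<open>Condition G speaks only about large arguments; smaller \<open>N\<close> are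
    covered by monotonicity, with \<open>V N0\<close> as the constant.\<close>
  define N0 where "N0 = nat \<lceil>X0\<rceil>"
  have "V N \<le> (1 + V N0) * real N powr (1 + \<eta>)" if N: "N \<ge> 1" for N
  proof (cases "N \<ge> N0")
    case True
    hence "real N \<ge> X0" unfolding N0_def by linarith
    hence "ln (F_mean nrm p (real N)) \<le> \<eta> * ln (real N)" using X0[of "real N"] N by simp
    hence "exp (ln (F_mean nrm p (real N))) \<le> exp (\<eta> * ln (real N))" by simp
    hence F: "F_mean nrm p (real N) \<le> real N powr \<eta>" using F_pos[OF N] N by (simp add: powr_def)
    have "V N \<le> real N powr \<eta> * real N" by (rule order_trans[OF V_le[OF N] mult_right_mono[OF F]]) simp
    also have "\<dots> = 1 * real N powr (1 + \<eta>)" using N by (simp add: powr_add)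
    also have "\<dots> \<le> (1 + V N0) * real N powr (1 + \<eta>)"
      by (intro mult_right_mono) (auto simp: V_def intro!: sum_nonneg)
    finally show ?thesis .
  next
    case False
    have "V N \<le> V N0" unfolding V_def using False by (intro sum_mono2) auto
    also have "\<dots> \<le> (1 + V N0) * 1" by simp
    also have "\<dots> \<le> (1 + V N0) * real N powr (1 + \<eta>)"
      using N \<eta> by (intro mult_left_mono ge_one_powr_ge_zero) (auto simp: V_def intro!: add_nonneg_nonneg sum_nonneg)
    finally show ?thesis .
  qed
  thus ?thesis unfolding V_def by blast
qed

lemma beurling_coeffs:
  assumes axA: "axiom_A nrm \<kappa> A \<theta>" and condG: "condition_G nrm"
  shows "beurling_coeffs G m \<kappa> A \<theta>"
proof
  show "G n \<ge> 0" for n by (simp add: G_def)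
  show "G 1 = 1" using level_1 by (simp add: G_def)
  show "\<kappa> > 0" "A > 0" "0 < \<theta>" "\<theta> < 1" using axA by (auto simp: axiom_A_def)
  show "\<bar>(\<Sum>n=1..N. G n) - \<kappa> * (real N - 1)\<bar> \<le> A * real N powr \<theta>" if "N \<ge> 1" for N
  proof -
    have "(\<Sum>n=1..N. G n) = (\<Sum>n=1..N. \<Sum>g\<in>level n. 1)" by (simp add: G_def)
    also have "\<dots> = real (counting_fun nrm (real N))" unfolding sum_level by (simp add: counting_fun_def)
    finally show ?thesis using axA that by (simp add: axiom_A_def remainder_fun_def)
  qed
  show "\<bar>m n\<bar> \<le> G n" for n
  proof -
    have "\<bar>m n\<bar> \<le> (\<Sum>g\<in>level n. 1)"
      unfolding m_def by (rule order_trans[OF sum_abs sum_mono]) (rule abs_mu_le_1)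
    thus ?thesis by (simp add: G_def)
  qed
  show "(\<Sum>d | d dvd n. m d * G (n div d)) = (if n = 1 then 1 else 0)" if n: "n \<ge> 1" for n
  proof -
    have "(\<Sum>d | d dvd n. m d * G (n div d)) = (\<Sum>g\<in>level n. if g = 1 then 1 else 0)"
      unfolding m_def dirichlet_convolution_level[OF n] sum_mu_divisors ..
    also have "\<dots> = (if 1 \<in> level n then 1 else 0)" using finite_level by (simp add: sum.delta)
    also have "1 \<in> level n \<longleftrightarrow> n = 1" using level_1 by (auto simp: level_def)
    finally show ?thesis .
  qed
  show "\<exists>K. \<forall>n\<ge>1. (\<Sum>d | d dvd n. G d * G (n div d)) \<le> K * real n powr \<eta> * G n" if \<eta>: "\<eta> > 0" for \<eta>
  proof -
    obtain K where K: "\<And>g. real (card {A. A \<subseteq># factors g}) \<le> K * nrm g powr \<eta>"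
      using card_divisors_le[OF \<eta>] by blast
    \<comment> \<open>The convolution of \<open>G\<close> with itself counts the factorizations of
      all elements of norm \<open>n\<close>, hence the divisor bound applies to each of
      them.\<close>
    have "(\<Sum>d | d dvd n. G d * G (n div d)) \<le> K * real n powr \<eta> * G n" if n: "n \<ge> 1" for n
    proof -
      have "(\<Sum>d | d dvd n. G d * G (n div d)) = (\<Sum>d | d dvd n. (\<Sum>h\<in>level d. 1) * G (n div d))"
        by (simp add: G_def)
      also have "\<dots> = (\<Sum>g\<in>level n. real (card {A. A \<subseteq># factors g}))"
        by (subst dirichlet_convolution_level[OF n]) simp
      also have "\<dots> \<le> (\<Sum>g\<in>level n. K * real n powr \<eta>)"
        using K by (intro sum_mono) (auto simp: level_def of_nat_nnorm)
      also have "\<dots> = K * real n powr \<eta> * G n" by (simp add: G_def)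
      finally show ?thesis .
    qed
    thus ?thesis by blast
  qed
  show "\<exists>K. \<forall>N\<ge>1. (\<Sum>n=1..N. (G n)\<^sup>2) \<le> K * real N powr (1 + \<eta>)" if "\<eta> > 0" for \<eta>
    using G_square_sum_le[OF condG that] .
qed

section \<open>Identification with the Beurling zeta function and its zeros\<close>

text \<open>The unordered sum converges absolutely, hence may be evaluated along any sequence of
  finite sets that eventually contains every given one. The sets of elements of norm at most
  \<open>N\<close> form such a sequence, and the sums over them are the partial sums
  \<open>zeta_partial\<close>.\<close>

lemma infsum_nrm_powr:
  assumes "beurling_coeffs G m \<kappa> A \<theta>" and s: "Re s > 1"
  shows "(\<Sum>\<^sub>\<infinity>g. complex_of_real (nrm g) powr (- s)) = beurling_coeffs.xi G \<kappa> s / (s - 1)"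
proof -
  interpret B: beurling_coeffs G m \<kappa> A \<theta> by fact
  define f where "f g = complex_of_real (nrm g) powr (- s)" for g
  have partial: "B.zeta_partial N s = (\<Sum>g | nrm g \<le> real N. f g)" for N
  proof -
    have "B.zeta_partial N s = (\<Sum>n=1..N. \<Sum>g\<in>level n. f g)"
      unfolding B.zeta_partial_def
    proof (rule sum.cong[OF refl])
      fix n
      have "f g = of_nat n powr (- s)" if "g \<in> level n" for g
      proof -
        have "nrm g = real n" using that by (simp add: level_def nrm_eq_iff)
        thus ?thesis by (simp add: f_def)
      qed
      thus "of_real (G n) * of_nat n powr (- s) = (\<Sum>g\<in>level n. f g)" by (simp add: G_def)
    qed
    thus ?thesis by (simp only: sum_level)
  qed
  have norm_f: "norm (f g) = nrm g powr (- Re s)" for g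
    unfolding f_def using nrm_pos[of g] by (subst norm_powr_real_powr) auto
  have "(\<lambda>g. norm (f g)) summable_on UNIV"
  proof (rule nonneg_bdd_above_summable_on)
    show "bdd_above (sum (\<lambda>g. norm (f g)) ` {F. F \<subseteq> UNIV \<and> finite F})"
    proof (rule bdd_aboveI)
      fix x assume "x \<in> sum (\<lambda>g. norm (f g)) ` {F. F \<subseteq> UNIV \<and> finite F}"
      then obtain F where F: "finite F" "x = (\<Sum>g\<in>F. norm (f g))" by auto
      define N where "N = Max (insert 0 (nnorm ` F))"
      have "F \<subseteq> {g. nrm g \<le> real N}" using F(1) by (auto simp: nrm_le_iff N_def)
      hence "x \<le> (\<Sum>g | nrm g \<le> real N. norm (f g))"
        unfolding F(2) by (intro sum_mono2 finite_nrm_le) auto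
      also have "\<dots> = (\<Sum>n=1..N. \<Sum>g\<in>level n. norm (f g))" by (simp only: sum_level)
      also have "\<dots> = (\<Sum>n=1..N. G n * real n powr (- Re s))"
      proof (rule sum.cong[OF refl])
        fix n
        have "norm (f g) = real n powr (- Re s)" if "g \<in> level n" for g
        proof -
          have "nrm g = real n" using that by (simp add: level_def nrm_eq_iff)
          thus ?thesis by (simp add: norm_f)
        qed
        thus "(\<Sum>g\<in>level n. norm (f g)) = G n * real n powr (- Re s)" by (simp add: G_def)
      qed
      also have "\<dots> \<le> (\<Sum>n. G n * real n powr (- Re s))"
        using B.summable_G[OF s] by (intro sum_le_suminf) (auto simp: B.G_nonneg)
      finally show "x \<le> (\<Sum>n. G n * real n powr (- Re s))" .
    qed
  qed auto
  hence "f summable_on UNIV" by (rule abs_summable_summable)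
  hence "(sum f \<longlongrightarrow> infsum f UNIV) (finite_subsets_at_top UNIV)"
    by (simp add: summable_iff_has_sum_infsum has_sum_def)
  moreover have "filterlim (\<lambda>N. {g. nrm g \<le> real N}) (finite_subsets_at_top UNIV) sequentially"
    unfolding filterlim_finite_subsets_at_top
  proof safe
    fix F :: "'a set" assume F: "finite F"
    show "\<forall>\<^sub>F N in sequentially. finite {g. nrm g \<le> real N} \<and> F \<subseteq> {g. nrm g \<le> real N} \<and> {g. nrm g \<le> real N} \<subseteq> UNIV"
      using eventually_ge_at_top[of "Max (insert 0 (nnorm ` F))"]
    proof eventually_elim
      case (elim N)
      hence "F \<subseteq> {g. nrm g \<le> real N}" using F by (auto simp: nrm_le_iff)
      thus ?case using finite_nrm_le by simp
    qed
  qed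
  ultimately have "(\<lambda>N. \<Sum>g | nrm g \<le> real N. f g) \<longlonglongrightarrow> infsum f UNIV"
    by (rule filterlim_compose)
  hence "(\<lambda>N. B.zeta_partial N s) \<longlonglongrightarrow> infsum f UNIV" by (simp only: partial)
  from LIMSEQ_unique[OF this B.zeta_partial_tendsto[OF s]] show ?thesis by (simp add: f_def[abs_def])
qed

text \<open>\<open>xi s / (s - 1)\<close> meets the description under the choice operator, so the
  chosen function meets it too. Both agree for \<open>Re s > 1\<close>, and the half-plane without
  the point 1 is still connected, so the identity theorem applies.\<close>

lemma beurling_zeta_eq:
  assumes bc: "beurling_coeffs G m \<kappa> A \<theta>" and s: "Re s > \<theta>" "s \<noteq> 1"
  shows "beurling_zeta nrm \<theta> s = beurling_coeffs.xi G \<kappa> s / (s - 1)"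
proof -
  interpret B: beurling_coeffs G m \<kappa> A \<theta> by fact
  define H where "H = {s. Re s > \<theta>}"
  have H: "open H" "connected H"
    unfolding H_def by (auto intro: open_halfspace_Re_gt convex_connected convex_halfspace_Re_gt)
  define Q where "Q f \<longleftrightarrow> f meromorphic_on H \<and> f holomorphic_on (H - {1}) \<and>
    (\<forall>s. Re s > 1 \<longrightarrow> f s = (\<Sum>\<^sub>\<infinity>g. complex_of_real (nrm g) powr (- s)))" for f
  define z where "z s = B.xi s / (s - 1)" for s
  have hol: "B.xi holomorphic_on H" unfolding H_def by (rule B.xi_holomorphic)
  have "Q z"
    unfolding Q_def
  proof (intro conjI allI impI)
    have "B.xi meromorphic_on H"
      using hol H by (intro analytic_on_imp_meromorphic_on) (simp add: analytic_on_open)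
    thus "z meromorphic_on H" unfolding z_def by (intro meromorphic_intros)
    show "z holomorphic_on (H - {1})" unfolding z_def
      by (intro holomorphic_intros holomorphic_on_subset[OF hol]) auto
    show "z s = (\<Sum>\<^sub>\<infinity>g. complex_of_real (nrm g) powr (- s))" if "Re s > 1" for s
      using infsum_nrm_powr[OF bc that] by (simp add: z_def)
  qed
  hence "Q (SOME f. Q f)" by (rule someI[of Q z])
  moreover have "beurling_zeta nrm \<theta> = (SOME f. Q f)"
    by (simp add: beurling_zeta_def Q_def H_def)
  ultimately have f: "Q (beurling_zeta nrm \<theta>)" by simp
  show ?thesis
  proof (rule analytic_continuation_open[where s = "{s. Re s > 1}" and s' = "H - {1}" and f = "beurling_zeta nrm \<theta>" and g = "\<lambda>s. B.xi s / (s - 1)"])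
    show "connected (H - {1})" using H by (intro connected_open_delete) auto
    show "open {s::complex. Re s > 1}" by (rule open_halfspace_Re_gt)
    have "(2::complex) \<in> {s. Re s > 1}" by simp
    thus "{s::complex. Re s > 1} \<noteq> {}" by blast
    show "{s. Re s > 1} \<subseteq> H - {1}" using B.\<theta> by (auto simp: H_def)
    show "beurling_zeta nrm \<theta> holomorphic_on (H - {1})" using f by (simp add: Q_def)
    show "(\<lambda>s. B.xi s / (s - 1)) holomorphic_on (H - {1})"
      by (intro holomorphic_intros holomorphic_on_subset[OF hol]) auto
    show "beurling_zeta nrm \<theta> w = B.xi w / (w - 1)" if "w \<in> {s. Re s > 1}" for w
      using f \<open>Q z\<close> that unfolding Q_def z_def by simp
  qed (use H s in \<open>auto simp: H_def\<close>)
qed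

text \<open>Away from 1 the factor \<open>inverse (w - 1)\<close> is analytic and nonzero, so zeros
  and orders are those of \<open>xi\<close>. The point 1 is excluded from the zeros of zeta by
  definition and from those of \<open>xi\<close> by \<open>xi_1\<close>. Finiteness turns the sum in
  \<open>ennreal\<close> into an ordinary one.\<close>

lemma zeta_zero_count_eq:
  assumes bc: "beurling_coeffs G m \<kappa> A \<theta>" and \<alpha>: "\<alpha> > \<theta>"
  defines "xi \<equiv> beurling_coeffs.xi G \<kappa>"
  shows "zeta_zero_count nrm \<theta> \<alpha> T
    = ennreal (\<Sum>z | xi z = 0 \<and> \<alpha> \<le> Re z \<and> \<bar>Im z\<bar> \<le> T. real (nat (zorder xi z)))"
proof -
  interpret B: beurling_coeffs G m \<kappa> A \<theta> by fact
  define Z where "Z = {z. B.xi z = 0 \<and> \<alpha> \<le> Re z \<and> \<bar>Im z\<bar> \<le> T}"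
  have Z: "zeta_zeros nrm \<theta> \<alpha> T = Z"
  proof (rule set_eqI)
    fix z
    show "z \<in> zeta_zeros nrm \<theta> \<alpha> T \<longleftrightarrow> z \<in> Z"
    proof (cases "z \<noteq> 1 \<and> \<alpha> \<le> Re z")
      case True
      thus ?thesis using beurling_zeta_eq[OF bc, of z] \<alpha> by (simp add: zeta_zeros_def Z_def)
    next
      case False
      thus ?thesis using B.xi_1 B.\<kappa> by (auto simp: zeta_zeros_def Z_def)
    qed
  qed
  have H: "open {s. Re s > \<theta>}" "connected {s. Re s > \<theta>}"
    by (auto intro: open_halfspace_Re_gt convex_connected convex_halfspace_Re_gt)
  have ord: "zorder (beurling_zeta nrm \<theta>) z = zorder B.xi z" if "z \<in> Z" for z
  proof -
    have z: "Re z > \<theta>" "z \<noteq> 1" using that \<alpha> B.xi_1 B.\<kappa> by (auto simp: Z_def)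
    have "\<forall>\<^sub>F w in at z. w \<in> {s. Re s > \<theta>} - {1}"
      using z H by (intro eventually_at_in_open') auto
    hence "\<forall>\<^sub>F w in at z. beurling_zeta nrm \<theta> w = B.xi w * inverse (w - 1)"
      by eventually_elim (simp add: beurling_zeta_eq[OF bc] divide_inverse)
    hence "zorder (beurling_zeta nrm \<theta>) z = zorder (\<lambda>w. B.xi w * inverse (w - 1)) z"
      by (rule zorder_cong) (rule refl)
    also have "\<dots> = zorder B.xi z + zorder (\<lambda>w. inverse (w - 1)) z"
    proof (rule zorder_times_analytic)
      show "B.xi analytic_on {z}" using B.xi_holomorphic H(1) z analytic_at by blast
      show "(\<lambda>w. inverse (w - 1)) analytic_on {z}" using z by (auto intro!: analytic_intros)
      have "\<forall>\<^sub>F w in at z. B.xi w \<noteq> 0 \<and> w \<in> {s. Re s > \<theta>}"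
        by (rule non_zero_neighbour_alt[where \<beta> = 1, OF B.xi_holomorphic H])
          (use z B.xi_1 B.\<kappa> B.\<theta> in auto)
      moreover have "\<forall>\<^sub>F w in at z. w \<in> - {1}" using z by (intro eventually_at_in_open') auto
      ultimately show "\<forall>\<^sub>F w in at z. B.xi w * inverse (w - 1) \<noteq> 0"
        by eventually_elim auto
    qed
    also have "zorder (\<lambda>w. inverse (w - 1)) z = 0"
      using z by (intro zorder_eq_0I) (auto intro!: analytic_intros)
    finally show ?thesis by simp
  qed
  have "finite Z" unfolding Z_def by (rule B.finite_zeros[OF \<alpha>])
  hence "zeta_zero_count nrm \<theta> \<alpha> T = (\<Sum>z\<in>Z. of_nat (nat (zorder (beurling_zeta nrm \<theta>) z)))"
    by (simp add: zeta_zero_count_def Z)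
  also have "\<dots> = (\<Sum>z\<in>Z. ennreal (real (nat (zorder B.xi z))))"
    by (intro sum.cong refl) (simp only: ord ennreal_of_nat_eq_real_of_nat)
  also have "\<dots> = ennreal (\<Sum>z\<in>Z. real (nat (zorder B.xi z)))" by (intro sum_ennreal) simp
  finally show ?thesis by (simp add: Z_def xi_def)
qed

end

theorem theorem1p1:
  fixes P :: "'a::comm_monoid_mult set"
    and nrm :: "'a \<Rightarrow> real"
    and \<kappa> A \<theta> :: real
  assumes "arithmetical_semigroup P nrm"
    and "axiom_A nrm \<kappa> A \<theta>"
    and "condition_B nrm"
    and "condition_G nrm"
  shows "\<forall>\<epsilon>>0. \<exists>C::real. eventually (\<lambda>T::real.
           \<forall>\<alpha> > (1 + \<theta>) / 2.
             zeta_zero_count nrm \<theta> \<alpha> T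
               \<le> ennreal (C * T powr ((6 - 2 * \<theta>) / (1 - \<theta>) * (1 - \<alpha>) + \<epsilon>))) at_top"
proof (intro allI impI)
  fix \<epsilon> :: real assume \<epsilon>: "\<epsilon> > 0"
  interpret integral_semigroup P nrm
    using assms by (simp add: integral_semigroup_def integral_semigroup_axioms_def)
  have bc: "beurling_coeffs G m \<kappa> A \<theta>" using assms by (intro beurling_coeffs)
  interpret B: beurling_coeffs G m \<kappa> A \<theta> by fact
  obtain C where C: "C \<ge> 0"
    "\<And>T \<alpha>. T \<ge> 1 \<Longrightarrow> (1 + \<theta>) / 2 \<le> \<alpha> \<Longrightarrow> \<alpha> \<le> 1 \<Longrightarrow>
      (\<Sum>z | B.xi z = 0 \<and> \<alpha> \<le> Re z \<and> \<bar>Im z\<bar> \<le> T. real (nat (zorder B.xi z)))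
        \<le> C * T powr ((6 - 2 * \<theta>) / (1 - \<theta>) * (1 - \<alpha>) + \<epsilon>)"
    by (rule B.zero_density[OF \<epsilon>]) (rule that)
  have "zeta_zero_count nrm \<theta> \<alpha> T \<le> ennreal (C * T powr ((6 - 2 * \<theta>) / (1 - \<theta>) * (1 - \<alpha>) + \<epsilon>))"
    if T: "T \<ge> 1" and \<alpha>: "\<alpha> > (1 + \<theta>) / 2" for T \<alpha>
  proof -
    have "\<alpha> > \<theta>" using \<alpha> B.\<theta> by (simp add: field_simps)
    note count = zeta_zero_count_eq[OF bc this, of T]
    show ?thesis
    proof (cases "\<alpha> \<le> 1")
      case True
      thus ?thesis unfolding count using C(2)[OF T] \<alpha> by (intro ennreal_leI) auto
    next
      case False
      \<comment> \<open>For \<open>\<alpha> > 1\<close> the density estimate does not apply, but the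
        region then lies inside the zero-free half-plane.\<close>
      have empty: "{z. B.xi z = 0 \<and> \<alpha> \<le> Re z \<and> \<bar>Im z\<bar> \<le> T} = {}"
      proof (rule equals0I)
        fix z assume "z \<in> {z. B.xi z = 0 \<and> \<alpha> \<le> Re z \<and> \<bar>Im z\<bar> \<le> T}"
        hence "B.xi z = 0" "Re z > 1" using False by auto
        thus False using B.xi_nonzero[of z] by simp
      qed
      show ?thesis unfolding count empty by simp
    qed
  qed
  hence "\<forall>\<^sub>F T in at_top. \<forall>\<alpha> > (1 + \<theta>) / 2. zeta_zero_count nrm \<theta> \<alpha> T
      \<le> ennreal (C * T powr ((6 - 2 * \<theta>) / (1 - \<theta>) * (1 - \<alpha>) + \<epsilon>))"
    by (intro eventually_mono[OF eventually_ge_at_top[of 1]]) simp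
  thus "\<exists>C::real. \<forall>\<^sub>F T in at_top. \<forall>\<alpha> > (1 + \<theta>) / 2. zeta_zero_count nrm \<theta> \<alpha> T
      \<le> ennreal (C * T powr ((6 - 2 * \<theta>) / (1 - \<theta>) * (1 - \<alpha>) + \<epsilon>))" ..
qed

end
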